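(* Let $\mathbf M$ be a strongly log-convex weight sequence with $m_k^{1/k}\to\infty$ and such that $(M_{k+1}/M_k)^{1/(k+1)}$ is bounded. Let $U\in\mathscr D(\mathbb R^n)$. Then $f\in\mathcal B^{(\mathbf M)}(U)$ if and only if $f$ admits an extension $F\in C^1_c(\mathbb C^n)$ (i.e. $F|_U=f$) such that for every $\rho>0$ there is $C\ge1$ with $|\overline\partial F(z)|\le C\,h_{\mathbf m}(\rho\, d(z,\overline U))$ for all $z\in\mathbb C^n$.
   Context: A weight sequence is $\mathbf M=(M_k)_{k\in\mathbb N}$ with $M_0=1$, $\mu_k:=M_k/M_{k-1}$ satisfying $1\le\mu_1\le\mu_2\le\cdots$, and $M_k^{1/k}\to\infty$; $m_k=M_k/k!$. $\mathbf M$ is strongly log-convex if $(m_k)$ is log-convex, i.e. $\mu_k/k$ is increasing. $h_{\mathbf m}(t)=\inf_k m_kt^k$ for $t>0$, $h_{\mathbf m}(0)=0$. $d(z,\overline U)=\inf_{x\in\overline U}|z-x|$. $\mathscr D(\mathbb R^n)$ is the set of non-empty bounded open quasiconvex $U\subseteq\mathbb R^n$ (there is $C$ such that any $x,y\in U$ are joined by a rectifiable path in $U$ of length $\le C|x-y|$). $\mathcal B^{(\mathbf M)}(U)$ is the set of $f\in C^\infty(U)$ with $\sup_{x\in U,\alpha}|\partial^\alpha f(x)|/(\rho^{|\alpha|}M_{|\alpha|})<\infty$ for every $\rho>0$. *)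

theory Defs
  imports "HOL-Analysis.Analysis"
begin

definition mu :: "(nat \<Rightarrow> real) \<Rightarrow> nat \<Rightarrow> real" where
  "mu M k = M k / M (k - 1)"

definition weight_sequence :: "(nat \<Rightarrow> real) \<Rightarrow> bool" where
  "weight_sequence M \<longleftrightarrow>
     M 0 = 1 \<and> 1 \<le> mu M 1 \<and> (\<forall>k\<ge>1. mu M k \<le> mu M (Suc k)) \<and>
     filterlim (\<lambda>k. root k (M k)) at_top sequentially"

definition small_m :: "(nat \<Rightarrow> real) \<Rightarrow> nat \<Rightarrow> real" where
  "small_m M k = M k / fact k"

definition strongly_log_convex :: "(nat \<Rightarrow> real) \<Rightarrow> bool" where
  "strongly_log_convex M \<longleftrightarrow> (\<forall>k\<ge>1. mu M k / real k \<le> mu M (Suc k) / real (Suc k))"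

definition h_fun :: "(nat \<Rightarrow> real) \<Rightarrow> real \<Rightarrow> real" where
  "h_fun m t = (if t = 0 then 0 else (INF k. m k * t ^ k))"

definition variation_sums :: "(real \<Rightarrow> 'a::metric_space) \<Rightarrow> real set" where
  "variation_sums g = {(\<Sum>i<k. dist (g (t (Suc i))) (g (t i))) | t k.
      t 0 = 0 \<and> t k = 1 \<and> (\<forall>i<k. t i \<le> t (Suc i))}"

definition rectifiable_path :: "(real \<Rightarrow> 'a::metric_space) \<Rightarrow> bool" where
  "rectifiable_path g \<longleftrightarrow> path g \<and> bdd_above (variation_sums g)"

definition path_length :: "(real \<Rightarrow> 'a::metric_space) \<Rightarrow> real" where
  "path_length g = Sup (variation_sums g)"

definition quasiconvex :: "'a::metric_space set \<Rightarrow> bool" where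
  "quasiconvex U \<longleftrightarrow> (\<exists>C. \<forall>x\<in>U. \<forall>y\<in>U. \<exists>g. rectifiable_path g \<and> path_image g \<subseteq> U \<and>
      pathstart g = x \<and> pathfinish g = y \<and> path_length g \<le> C * dist x y)"

definition D_domain :: "(real ^ 'n) set \<Rightarrow> bool" where
  "D_domain U \<longleftrightarrow> U \<noteq> {} \<and> bounded U \<and> open U \<and> quasiconvex U"

definition partial :: "'n \<Rightarrow> (real ^ 'n \<Rightarrow> complex) \<Rightarrow> real ^ 'n \<Rightarrow> complex" where
  "partial i f x = vector_derivative (\<lambda>t. f (x + t *\<^sub>R axis i 1)) (at 0)"

fun partials :: "'n list \<Rightarrow> (real ^ 'n \<Rightarrow> complex) \<Rightarrow> real ^ 'n \<Rightarrow> complex" where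
  "partials [] f = f"
| "partials (i # is) f = partial i (partials is f)"

definition smooth_on :: "(real ^ 'n) set \<Rightarrow> (real ^ 'n \<Rightarrow> complex) \<Rightarrow> bool" where
  "smooth_on U f \<longleftrightarrow> (\<forall>is. continuous_on U (partials is f) \<and>
      (\<forall>x\<in>U. \<forall>i. ((\<lambda>t. partials is f (x + t *\<^sub>R axis i 1))
                    has_vector_derivative partials (i # is) f x) (at 0)))"

definition dalpha :: "('n::finite \<Rightarrow> nat) \<Rightarrow> (real ^ 'n \<Rightarrow> complex) \<Rightarrow> real ^ 'n \<Rightarrow> complex" where
  "dalpha \<alpha> f = partials (SOME is. \<forall>i. count (mset is) i = \<alpha> i) f"

definition mi_abs :: "('n::finite \<Rightarrow> nat) \<Rightarrow> nat" where
  "mi_abs \<alpha> = (\<Sum>i\<in>UNIV. \<alpha> i)"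

definition beurling_class :: "(nat \<Rightarrow> real) \<Rightarrow> (real ^ 'n::finite) set \<Rightarrow> (real ^ 'n \<Rightarrow> complex) set" where
  "beurling_class M U = {f. smooth_on U f \<and>
     (\<forall>\<rho>>0. \<exists>C. \<forall>x\<in>U. \<forall>\<alpha>. norm (dalpha \<alpha> f x) / (\<rho> ^ mi_abs \<alpha> * M (mi_abs \<alpha>)) \<le> C)}"

definition C1c :: "(complex ^ 'n \<Rightarrow> complex) \<Rightarrow> bool" where
  "C1c F \<longleftrightarrow> (\<exists>F'. (\<forall>z. (F has_derivative F' z) (at z)) \<and> (\<forall>v. continuous_on UNIV (\<lambda>z. F' z v)))
     \<and> compact (closure {z. F z \<noteq> 0})"

definition dbar_j :: "(complex ^ 'n \<Rightarrow> complex) \<Rightarrow> 'n \<Rightarrow> complex ^ 'n \<Rightarrow> complex" where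
  "dbar_j F j z = (frechet_derivative F (at z) (axis j 1) + \<i> * frechet_derivative F (at z) (axis j \<i>)) / 2"

definition dbar :: "(complex ^ 'n \<Rightarrow> complex) \<Rightarrow> complex ^ 'n \<Rightarrow> complex ^ 'n" where
  "dbar F z = (\<chi> j. dbar_j F j z)"

definition cemb :: "real ^ 'n \<Rightarrow> complex ^ 'n" where
  "cemb x = (\<chi> j. complex_of_real (x $ j))"

end

theory Submission
  imports Defs
begin

text \<open>
  Suppose that \<open>f\<close> is the restriction of \<open>F\<close>. For a multi-index \<open>\<alpha>\<close> of order \<open>k\<close>, the average of
  \<open>F (x + r * e(\<theta>)) * e(- \<alpha> \<cdot> \<theta>)\<close> over the torus, divided by \<open>r ^ k\<close>, has an \<open>r\<close>-derivative that only involves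
  the antiholomorphic derivatives of \<open>F\<close> at distance \<open>O(r)\<close> from \<open>x\<close>; so it is \<open>O(\<rho> ^ k * m k)\<close>, and the average
  has a limit as \<open>r\<close> tends to 0. A similar identity for the derivatives in \<open>x\<close> shows that the limits are
  the Taylor coefficients of \<open>f\<close>, and the bound follows by comparison with \<open>r = 1\<close>.

  Conversely, choose a log-convex weight \<open>l\<close> that dominates the derivatives of \<open>f\<close> and is \<open>O(\<rho> ^ k * m k)\<close> for
  every \<open>\<rho>\<close>. At scale \<open>d k = \<delta> / 2 ^ k\<close> approximate \<open>f\<close> by its Taylor polynomials, viewed as functions on complex
  space, of the degree which minimizes \<open>l q * t ^ q\<close>, where \<open>t\<close> is a fixed multiple of \<open>d k\<close>. By quasiconvexity
  the polynomials at neighbouring base points, and those of consecutive scales, differ by a multiple of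
  this minimum. Gluing them with partitions of unity gives \<open>F\<close>, and since polynomials are holomorphic, the
  antiholomorphic derivative of \<open>F\<close> is of the size of the minimum divided by \<open>d k\<close>. The bound on
  \<open>M (k + 1) / M k\<close> absorbs the division by \<open>d k\<close>.
\<close>

section \<open>Weight sequences\<close>

text \<open>A single \<open>F\<close> has to satisfy the estimate for every \<open>\<rho>\<close>,
  while the constants in the Beurling condition depend on \<open>\<rho>\<close>; interposing the one
  weight \<open>l\<close> makes the construction independent of \<open>\<rho>\<close>. Log-convexity
  of \<open>l\<close> matters because the terms \<open>l j * t ^ j\<close> then decrease up to the
  optimal index, so every degree that enters when the scale is halved is controlled by the minimum
  at the coarser scale. In the other direction the obstacle is that \<open>F\<close> is only C1: it
  has no higher derivatives from which the smoothness of \<open>f\<close> could be read off. On the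
  torus, integration by parts in the angles trades a holomorphic derivative of \<open>F\<close> for
  a Fourier coefficient one order higher, at the price of an antiholomorphic term. Derivatives of
  every order are thus reached as uniform limits of integrals that involve only \<open>F\<close> and
  its first derivatives.\<close>

lemma decreasing_majorant:
  fixes r :: "nat \<Rightarrow> real"
  assumes "r \<longlonglongrightarrow> 0"
  obtains \<theta> where "decseq \<theta>" "\<theta> \<longlonglongrightarrow> 0" "\<And>k. r k \<le> \<theta> k" "\<And>k. 0 \<le> \<theta> k"
proof -
  define \<theta> where "\<theta> k = (SUP j\<in>{k..}. \<bar>r j\<bar>)" for k
  have bd: "bdd_above ((\<lambda>j. \<bar>r j\<bar>) ` {k..})" for k
  proof -
    have "Bseq r" using assms convergent_imp_Bseq convergentI by blast
    then show ?thesis unfolding Bseq_def bdd_above_def by auto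
  qed
  have le: "\<bar>r j\<bar> \<le> \<theta> k" if "k \<le> j" for j k
    unfolding \<theta>_def by (rule cSUP_upper[OF _ bd]) (use that in auto)
  have dec: "decseq \<theta>"
  proof (rule decseq_SucI)
    fix k show "\<theta> (Suc k) \<le> \<theta> k"
      unfolding \<theta>_def by (rule cSUP_subset_mono[OF _ bd]) auto
  qed
  have nn: "0 \<le> \<theta> k" for k using le[of k k] by linarith
  have "\<theta> \<longlonglongrightarrow> 0"
  proof (rule LIMSEQ_I)
    fix e :: real assume "0 < e"
    then obtain N where N: "\<And>j. j \<ge> N \<Longrightarrow> \<bar>r j\<bar> < e/2"
      using LIMSEQ_D[OF assms, of "e/2"] by auto
    have "\<theta> k \<le> e/2" if "k \<ge> N" for k
      unfolding \<theta>_def by (rule cSUP_least) (use N that in \<open>auto intro: less_imp_le\<close>)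
    then show "\<exists>N. \<forall>k\<ge>N. norm (\<theta> k - 0) < e"
      using nn \<open>0 < e\<close> by (intro exI[of _ N]) (fastforce simp: abs_of_nonneg)
  qed
  moreover have "r k \<le> \<theta> k" for k using le[of k k] by linarith
  ultimately show ?thesis using that dec nn by blast
qed

lemma bounded_if_eventually_decreasing:
  fixes a :: "nat \<Rightarrow> real"
  assumes "\<And>k. 0 \<le> a k" "\<And>k. K \<le> k \<Longrightarrow> a (Suc k) \<le> a k"
  shows "a k \<le> (\<Sum>j\<le>K. a j)"
proof (induction k)
  case 0
  show ?case using member_le_sum[of 0 "{..K}" a] assms(1) by auto
next
  case (Suc k)
  show ?case
  proof (cases "Suc k \<le> K")
    case True
    then show ?thesis using member_le_sum[of "Suc k" "{..K}" a] assms(1) by auto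
  next
    case False
    then show ?thesis using Suc assms(2)[of k] by auto
  qed
qed

text \<open>Quotients bounded by \<open>D\<close> would force \<open>m k \<le> m 0 * D ^ k\<close>
  and hence bounded roots; an increasing unbounded sequence tends to infinity.\<close>

lemma quotient_at_top_if_root_at_top:
  fixes m :: "nat \<Rightarrow> real"
  assumes pos: "\<And>k. 0 < m k" and mono: "incseq (\<lambda>k. m (Suc k) / m k)"
    and root: "filterlim (\<lambda>k. root k (m k)) at_top sequentially"
  shows "filterlim (\<lambda>k. m (Suc k) / m k) at_top sequentially"
proof -
  have unb: "\<exists>k. B \<le> m (Suc k) / m k" for B
  proof (rule ccontr)
    assume "\<not> ?thesis"
    then have lt: "m (Suc k) / m k < B" for k by (meson not_le)
    define D where "D = max B 1"
    have le: "m k \<le> m 0 * D ^ k" for k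
    proof (induction k)
      case (Suc k)
      have "m (Suc k) \<le> D * m k"
        using lt[of k] pos[of k] unfolding D_def
        by (smt (verit, best) divide_less_eq mult_right_mono max.cobounded1)
      also have "\<dots> \<le> D * (m 0 * D ^ k)" using Suc D_def by (intro mult_left_mono) auto
      finally show ?case by (simp add: algebra_simps)
    qed simp
    \<comment> \<open>Since \<open>max (m 0) 1\<close> is at least 1, its \<open>k\<close>-th power
      still dominates \<open>m 0\<close>.\<close>
    have "root k (m k) \<le> max (m 0) 1 * D" if "k \<ge> 1" for k
    proof -
      have "root k (m k) \<le> root k ((max (m 0) 1 * D) ^ k)"
      proof -
        have "m 0 \<le> max (m 0) 1 ^ k"
          using that self_le_power[of "max (m 0) 1" k] by auto
        then have "m 0 * D ^ k \<le> (max (m 0) 1 * D) ^ k"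
          unfolding power_mult_distrib by (intro mult_right_mono) (auto simp: D_def)
        then show ?thesis using le[of k] that by simp
      qed
      also have "\<dots> = max (m 0) 1 * D" using that by (simp add: real_root_power_cancel D_def)
      finally show ?thesis .
    qed
    moreover have "eventually (\<lambda>k. root k (m k) > max (m 0) 1 * D \<and> k \<ge> 1) sequentially"
      using root eventually_ge_at_top[of 1] by (auto simp: filterlim_at_top_dense eventually_conj_iff)
    ultimately show False
      by (metis (no_types, lifting) eventually_sequentially leD order_refl)
  qed
  show ?thesis unfolding filterlim_at_top
  proof
    fix B
    obtain k where k: "B \<le> m (Suc k) / m k" using unb by blast
    show "eventually (\<lambda>k. B \<le> m (Suc k) / m k) sequentially"
      unfolding eventually_sequentially using k incseqD[OF mono] order_trans by blast
  qed
qed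

text \<open>Condenses the estimates for all \<open>\<rho>\<close> into a single null sequence: the
  constants \<open>C\<close> are harmless because \<open>k\<close>-th roots of constants tend to
  1.\<close>

lemma root_quotient_tendsto_0:
  fixes m s :: "nat \<Rightarrow> real"
  assumes pos: "\<And>k. 0 < m k" and s0: "\<And>k. 0 \<le> s k"
    and bnd: "\<And>\<rho>. 0 < \<rho> \<Longrightarrow> \<exists>C. \<forall>k. s k \<le> C * \<rho> ^ k * m k"
  shows "(\<lambda>k. root k (s k / m k)) \<longlonglongrightarrow> 0"
proof (rule LIMSEQ_I)
  fix e :: real assume e: "0 < e"
  obtain C where C: "\<And>k. s k \<le> C * (e/3) ^ k * m k" using bnd[of "e/3"] e by auto
  define D where "D = max C 1"
  have "(\<lambda>k. root k D) \<longlonglongrightarrow> 1" by (rule LIMSEQ_root_const) (auto simp: D_def)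
  then have "eventually (\<lambda>k. root k D < 2) sequentially" by (rule order_tendstoD) auto
  moreover have "norm (root k (s k / m k) - 0) < e" if "root k D < 2" "k \<ge> 1" for k
  proof -
    have "s k / m k \<le> D * (e/3) ^ k"
    proof -
      have "C * (e/3) ^ k \<le> D * (e/3) ^ k" using e by (intro mult_right_mono) (auto simp: D_def)
      then have "C * (e/3) ^ k * m k \<le> D * (e/3) ^ k * m k"
        by (rule mult_right_mono) (use pos[of k] in simp)
      then show ?thesis using C[of k] pos[of k] by (simp add: pos_divide_le_eq)
    qed
    then have "root k (s k / m k) \<le> root k (D * (e/3)^k)" using that by simp
    also have "\<dots> = root k D * (e/3)" using that e by (simp add: real_root_mult real_root_power_cancel)
    also have "\<dots> < 2 * (e/2)" using that e by (intro mult_strict_mono) auto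
    finally show ?thesis using s0[of k] pos[of k] that by simp
  qed
  ultimately show "\<exists>N. \<forall>k\<ge>N. norm (root k (s k / m k) - 0) < e"
    unfolding eventually_sequentially by (metis max.bounded_iff)
qed

text \<open>Let \<open>\<nu>\<close> be the quotients of \<open>m\<close> and
  \<open>\<theta>\<close> a decreasing null sequence above the roots of \<open>s k / m k\<close>.
  Weights with quotients \<open>\<theta> * \<nu>\<close> dominate \<open>s\<close> because
  \<open>\<theta>\<close> decreases, and are \<open>O(\<rho> ^ k * m k)\<close> because
  \<open>\<theta>\<close> tends to 0. An increasing envelope of these quotients makes the weight
  log-convex.\<close>

lemma intermediate_log_convex_weight:
  fixes m s :: "nat \<Rightarrow> real"
  assumes pos: "\<And>k. 0 < m k" and mono: "incseq (\<lambda>k. m (Suc k) / m k)"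
    and root: "filterlim (\<lambda>k. root k (m k)) at_top sequentially"
    and s0: "\<And>k. 0 \<le> s k"
    and bnd: "\<And>\<rho>. 0 < \<rho> \<Longrightarrow> \<exists>C. \<forall>k. s k \<le> C * \<rho> ^ k * m k"
  obtains \<sigma> C where "incseq \<sigma>" "\<And>k. 0 < \<sigma> k" "filterlim \<sigma> at_top sequentially"
    "\<And>k. s k \<le> C * (\<Prod>j<k. \<sigma> j)" "0 \<le> C"
    "\<And>\<rho>. 0 < \<rho> \<Longrightarrow> \<exists>C\<ge>0. \<forall>k. (\<Prod>j<k. \<sigma> j) \<le> C * \<rho> ^ k * m k"
proof -
  define \<nu> where "\<nu> k = m (Suc k) / m k" for k
  have \<nu>pos: "0 < \<nu> k" for k by (simp add: \<nu>_def pos)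
  have \<nu>mono: "i \<le> j \<Longrightarrow> \<nu> i \<le> \<nu> j" for i j using incseqD[OF mono] by (simp add: \<nu>_def)
  have \<nu>lim: "filterlim \<nu> at_top sequentially"
    using quotient_at_top_if_root_at_top[OF pos mono root] by (simp add: \<nu>_def[abs_def])
  obtain \<theta>1 where \<theta>1: "decseq \<theta>1" "\<theta>1 \<longlonglongrightarrow> 0" "\<And>k. root k (s k / m k) \<le> \<theta>1 k" "\<And>k. 0 \<le> \<theta>1 k"
    using decreasing_majorant[OF root_quotient_tendsto_0[OF pos s0 bnd]] by metis
  \<comment> \<open>The second term still tends to 0, but it makes \<open>\<theta>\<close> strictly
    positive and \<open>\<theta> k * \<nu> k\<close> at least \<open>sqrt (\<nu> k)\<close>, so that
    the new quotients tend to infinity.\<close>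
  define \<theta> where "\<theta> k = \<theta>1 k + 1 / sqrt (\<nu> k)" for k
  have \<theta>pos: "0 < \<theta> k" for k using \<theta>1(4)[of k] \<nu>pos[of k] by (simp add: \<theta>_def add_nonneg_pos)
  have \<theta>dec: "\<theta> j \<le> \<theta> i" if "i \<le> j" for i j
    unfolding \<theta>_def using decseqD[OF \<theta>1(1) that] \<nu>mono[OF that] \<nu>pos[of i]
    by (intro add_mono) (auto intro!: divide_left_mono simp: \<nu>pos)
  have "(\<lambda>k. 1 / sqrt (\<nu> k)) \<longlonglongrightarrow> 0"
    by (intro tendsto_divide_0[OF tendsto_const] filterlim_at_top_imp_at_infinity
        filterlim_compose[OF sqrt_at_top \<nu>lim])
  then have \<theta>lim: "\<theta> \<longlonglongrightarrow> 0" unfolding \<theta>_def[abs_def] using tendsto_add[OF \<theta>1(2)] by fastforce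
  \<comment> \<open>One factor of \<open>\<theta> * \<nu>\<close> decreases and the other increases,
    so the product need not be monotone; its running maximum is.\<close>
  define \<sigma> where "\<sigma> k = Max ((\<lambda>i. \<theta> i * \<nu> i) ` {..k})" for k
  have \<sigma>ge: "\<theta> i * \<nu> i \<le> \<sigma> k" if "i \<le> k" for i k unfolding \<sigma>_def using that by (intro Max_ge) auto
  have \<sigma>le: "\<sigma> k \<le> x" if "\<And>i. i \<le> k \<Longrightarrow> \<theta> i * \<nu> i \<le> x" for k x unfolding \<sigma>_def using that by (subst Max_le_iff) auto
  have \<sigma>inc: "incseq \<sigma>" by (rule incseq_SucI, rule \<sigma>le, rule \<sigma>ge) auto
  have \<sigma>pos: "0 < \<sigma> k" for k using \<sigma>ge[of k k] \<theta>pos[of k] \<nu>pos[of k]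
    by (meson mult_pos_pos order_less_le_trans order_refl)
  have \<sigma>lim: "filterlim \<sigma> at_top sequentially"
  proof (rule filterlim_at_top_mono)
    show "filterlim (\<lambda>k. sqrt (\<nu> k)) at_top sequentially" by (rule filterlim_compose[OF sqrt_at_top \<nu>lim])
    have "sqrt (\<nu> k) \<le> \<sigma> k" for k
    proof -
      have "sqrt (\<nu> k) = 1 / sqrt (\<nu> k) * \<nu> k" using \<nu>pos[of k]
        by (metis mult.commute less_eq_real_def real_div_sqrt times_divide_eq_right mult.right_neutral)
      also have "\<dots> \<le> \<theta> k * \<nu> k" using \<nu>pos[of k] \<theta>1(4)[of k] by (intro mult_right_mono) (auto simp: \<theta>_def)
      also have "\<dots> \<le> \<sigma> k" by (rule \<sigma>ge) simp
      finally show ?thesis .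
    qed
    then show "eventually (\<lambda>k. sqrt (\<nu> k) \<le> \<sigma> k) sequentially" by simp
  qed
  have mprod: "m k = m 0 * (\<Prod>j<k. \<nu> j)" for k
  proof (induction k)
    case (Suc k)
    have "m (Suc k) = m k * \<nu> k" using pos[of k] by (simp add: \<nu>_def)
    with Suc show ?case by (simp add: algebra_simps)
  qed simp
  have s_le: "s k \<le> (m 0 + s 0) * (\<Prod>j<k. \<sigma> j)" for k
  proof (cases k)
    case 0 then show ?thesis using pos[of 0] by simp
  next
    case (Suc k')
    have "root k (s k / m k) \<le> \<theta> k" using \<theta>1(3)[of k] \<nu>pos[of k]
      unfolding \<theta>_def by (smt (verit) divide_nonneg_nonneg real_sqrt_ge_zero)
    moreover have "0 \<le> root k (s k / m k)" using s0[of k] pos[of k] by (simp add: real_root_ge_zero)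
    ultimately have "root k (s k / m k) ^ k \<le> \<theta> k ^ k" by (intro power_mono) auto
    then have "s k / m k \<le> \<theta> k ^ k"
      using Suc s0[of k] pos[of k] real_root_pow_pos2[of k "s k / m k"] by simp
    then have "s k \<le> \<theta> k ^ k * m k" using pos[of k] by (simp add: pos_divide_le_eq)
    \<comment> \<open>The \<open>k\<close> copies of \<open>\<theta> k\<close> are distributed over
      the \<open>k\<close> quotients of \<open>m\<close>; for \<open>j < k\<close> each copy is at
      most \<open>\<theta> j\<close>.\<close>
    also have "\<dots> = m 0 * (\<Prod>j<k. \<theta> k * \<nu> j)" by (subst mprod) (simp add: prod.distrib)
    also have "\<dots> \<le> m 0 * (\<Prod>j<k. \<sigma> j)"
    proof (intro mult_left_mono prod_mono conjI)
      fix j assume "j \<in> {..<k}"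
      then have "\<theta> k * \<nu> j \<le> \<theta> j * \<nu> j" using \<nu>pos[of j] by (intro mult_right_mono \<theta>dec) auto
      also have "\<dots> \<le> \<sigma> j" by (rule \<sigma>ge) simp
      finally show "\<theta> k * \<nu> j \<le> \<sigma> j" .
      show "0 \<le> \<theta> k * \<nu> j" using \<theta>pos[of k] \<nu>pos[of j] by simp
    qed (use pos[of 0] in auto)
    also have "\<dots> \<le> (m 0 + s 0) * (\<Prod>j<k. \<sigma> j)"
      using s0[of 0] \<sigma>pos by (intro mult_right_mono prod_nonneg) (auto intro: less_imp_le)
    finally show ?thesis .
  qed
  have l_le: "\<exists>C\<ge>0. \<forall>k. (\<Prod>j<k. \<sigma> j) \<le> C * e ^ k * m k" if e: "0 < e" for e
  proof -
    have "eventually (\<lambda>k. \<theta> k < e) sequentially" using \<theta>lim e by (rule order_tendstoD)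
    then obtain J where J: "\<And>j. j \<ge> J \<Longrightarrow> \<theta> j < e" unfolding eventually_sequentially by blast
    have "eventually (\<lambda>k. \<sigma> J / e \<le> \<nu> k) sequentially" using \<nu>lim unfolding filterlim_at_top by blast
    then obtain K where K: "\<And>k. k \<ge> K \<Longrightarrow> \<sigma> J / e \<le> \<nu> k" unfolding eventually_sequentially by blast
    \<comment> \<open>Early indices, where \<open>\<theta>\<close> may exceed \<open>e\<close>,
      contribute at most the fixed number \<open>\<sigma> J\<close>, which
      \<open>e * \<nu> k\<close> eventually exceeds.\<close>
    have \<sigma>e: "\<sigma> k \<le> e * \<nu> k" if "k \<ge> K" for k
    proof (rule \<sigma>le)
      fix i assume i: "i \<le> k"
      show "\<theta> i * \<nu> i \<le> e * \<nu> k"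
      proof (cases "i \<le> J")
        case True
        have "\<theta> i * \<nu> i \<le> \<sigma> J" by (rule \<sigma>ge[OF True])
        also have "\<dots> \<le> e * \<nu> k" using K[OF that] e by (simp add: pos_divide_le_eq mult.commute)
        finally show ?thesis .
      next
        case False
        then show ?thesis using J[of i] \<nu>mono[OF i] \<nu>pos[of i] e by (intro mult_mono) auto
      qed
    qed
    define a where "a k = (\<Prod>j<k. \<sigma> j) / (e ^ k * m k)" for k
    have a0: "0 \<le> a k" for k using e pos[of k] \<sigma>pos by (auto simp: a_def intro!: divide_nonneg_pos prod_nonneg intro: less_imp_le)
    have "a (Suc k) \<le> a k" if "k \<ge> K" for k
    proof -
      have "a (Suc k) = a k * (\<sigma> k / (e * \<nu> k))" using pos[of k] pos[of "Suc k"] e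
        by (simp add: a_def \<nu>_def field_simps)
      also have "\<dots> \<le> a k * 1" using \<sigma>e[OF that] e \<nu>pos[of k] a0[of k] by (intro mult_left_mono) auto
      finally show ?thesis by simp
    qed
    then have bd: "a k \<le> (\<Sum>j\<le>K. a j)" for k using bounded_if_eventually_decreasing[of a K] a0 by blast
    have "(\<Prod>j<k. \<sigma> j) \<le> (\<Sum>j\<le>K. a j) * e ^ k * m k" for k
      using bd[of k] e pos[of k] unfolding a_def[of k] by (simp add: pos_divide_le_eq mult.assoc)
    then show ?thesis using a0 by (intro exI[of _ "\<Sum>j\<le>K. a j"]) (auto intro: sum_nonneg)
  qed
  show ?thesis
    by (rule that[OF \<sigma>inc \<sigma>pos \<sigma>lim s_le _ l_le]) (use s0[of 0] pos[of 0] in auto)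
qed

section \<open>The minimizing index of a log-convex weight\<close>

text \<open>For the weights \<open>l k = (\<Prod>j<k. \<sigma> j)\<close> this is the index at which \<open>l k * t ^ k\<close> is minimal.\<close>

definition opt_index :: "(nat \<Rightarrow> real) \<Rightarrow> real \<Rightarrow> nat" where
  "opt_index \<sigma> t = (LEAST k. 1 \<le> \<sigma> k * t)"

text \<open>The quotient of consecutive terms is \<open>\<sigma> k * t\<close>. As
  \<open>\<sigma>\<close> increases, the first index where it reaches 1 is the only turning
  point.\<close>

lemma opt_index:
  fixes \<sigma> :: "nat \<Rightarrow> real"
  assumes inc: "incseq \<sigma>" and pos: "\<And>k. 0 < \<sigma> k" and lim: "filterlim \<sigma> at_top sequentially" and t: "0 < t"
  shows "1 \<le> \<sigma> (opt_index \<sigma> t) * t"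
    and "k < opt_index \<sigma> t \<Longrightarrow> \<sigma> k * t < 1"
    and "opt_index \<sigma> t \<le> k \<Longrightarrow> 1 \<le> \<sigma> k * t"
proof -
  have "eventually (\<lambda>k. 1 / t \<le> \<sigma> k) sequentially" using lim unfolding filterlim_at_top by blast
  then obtain k0 where "1 / t \<le> \<sigma> k0" unfolding eventually_sequentially by blast
  then have "1 \<le> \<sigma> k0 * t" using t by (simp add: pos_divide_le_eq)
  then show 1: "1 \<le> \<sigma> (opt_index \<sigma> t) * t" unfolding opt_index_def by (rule LeastI)
  show "k < opt_index \<sigma> t \<Longrightarrow> \<sigma> k * t < 1"
    unfolding opt_index_def using not_less_Least by fastforce
  show "1 \<le> \<sigma> k * t" if "opt_index \<sigma> t \<le> k"
    using 1 incseqD[OF inc that] t by (meson mult_right_mono less_imp_le order_trans)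
qed

lemma opt_index_antimono:
  fixes \<sigma> :: "nat \<Rightarrow> real"
  assumes "incseq \<sigma>" "\<And>k. 0 < \<sigma> k" "filterlim \<sigma> at_top sequentially" "0 < t" "t \<le> u"
  shows "opt_index \<sigma> u \<le> opt_index \<sigma> t"
proof -
  have "1 \<le> \<sigma> (opt_index \<sigma> t) * t" using opt_index(1) assms by blast
  also have "\<dots> \<le> \<sigma> (opt_index \<sigma> t) * u" using assms by (intro mult_left_mono) (auto intro: less_imp_le)
  finally show ?thesis unfolding opt_index_def[of \<sigma> u] by (rule Least_le)
qed

text \<open>Needed for all degrees between the optimal indices of two neighbouring scales, where
  comparison with the minimum alone is not enough.\<close>

lemma decreasing_below_opt_index:
  fixes \<sigma> :: "nat \<Rightarrow> real"
  assumes "incseq \<sigma>" "\<And>k. 0 < \<sigma> k" "filterlim \<sigma> at_top sequentially" "0 < t" "i \<le> j" "j \<le> opt_index \<sigma> t"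
  shows "(\<Prod>j<j. \<sigma> j) * t ^ j \<le> (\<Prod>j<i. \<sigma> j) * t ^ i"
  using assms(5,6)
proof (induction j rule: dec_induct)
  case (step n)
  have "(\<Prod>j<Suc n. \<sigma> j) * t ^ Suc n = (\<Prod>j<n. \<sigma> j) * t ^ n * (\<sigma> n * t)" by simp
  also have "\<dots> \<le> (\<Prod>j<n. \<sigma> j) * t ^ n * 1"
    using opt_index(2)[OF assms(1-4), of n] step assms(2,4)
    by (intro mult_left_mono mult_nonneg_nonneg prod_nonneg) (auto intro: less_imp_le)
  finally show ?case using step by linarith
qed simp

lemma opt_index_minimal:
  fixes \<sigma> :: "nat \<Rightarrow> real"
  assumes "incseq \<sigma>" "\<And>k. 0 < \<sigma> k" "filterlim \<sigma> at_top sequentially" "0 < t"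
  shows "(\<Prod>j<opt_index \<sigma> t. \<sigma> j) * t ^ opt_index \<sigma> t \<le> (\<Prod>j<q. \<sigma> j) * t ^ q"
proof (cases "q \<le> opt_index \<sigma> t")
  case True then show ?thesis using decreasing_below_opt_index[OF assms] by blast
next
  case False
  then have "opt_index \<sigma> t \<le> q" by simp
  then show ?thesis
  proof (induction q rule: dec_induct)
    case (step n)
    have "(\<Prod>j<n. \<sigma> j) * t ^ n * 1 \<le> (\<Prod>j<n. \<sigma> j) * t ^ n * (\<sigma> n * t)"
      using opt_index(3)[OF assms, of n] step assms(2,4)
      by (intro mult_left_mono mult_nonneg_nonneg prod_nonneg) (auto intro: less_imp_le)
    also have "\<dots> = (\<Prod>j<Suc n. \<sigma> j) * t ^ Suc n" by simp
    finally show ?case using step by linarith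
  qed simp
qed

section \<open>Partial derivatives and Taylor polynomials\<close>

lemma vector_mvt_bound:
  fixes f :: "real \<Rightarrow> 'a::real_normed_vector"
  assumes "a \<le> b" and "\<And>t. t \<in> {a..b} \<Longrightarrow> (f has_vector_derivative f' t) (at t within {a..b})"
    and "\<And>t. t \<in> {a..b} \<Longrightarrow> norm (f' t) \<le> B"
  shows "norm (f b - f a) \<le> B * (b - a)"
proof -
  have "norm (f b - f a) \<le> B * norm (b - a)"
  proof (rule differentiable_bound[of "{a..b}" f "\<lambda>t h. h *\<^sub>R f' t"])
    fix t assume t: "t \<in> {a..b}"
    show "(f has_derivative (\<lambda>h. h *\<^sub>R f' t)) (at t within {a..b})"
      using assms(2)[OF t] by (simp add: has_vector_derivative_def)
    show "onorm (\<lambda>h. h *\<^sub>R f' t) \<le> B"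
      using assms(3)[OF t] by (intro onorm_le) (simp add: mult_right_mono mult.commute[of B] mult_left_mono)
  qed (use assms(1) in auto)
  then show ?thesis using assms(1) by simp
qed

text \<open>Smoothness is defined by derivatives at parameter 0, one base point at a time; mean
  value arguments need them at every parameter of a line.\<close>

lemma directional_derivative_shift:
  fixes g :: "'a::real_normed_vector \<Rightarrow> 'b::real_normed_vector"
  assumes "((\<lambda>t. g (x + s *\<^sub>R a + t *\<^sub>R a)) has_vector_derivative D) (at 0)"
  shows "((\<lambda>t. g (x + t *\<^sub>R a)) has_vector_derivative D) (at s within A)"
proof -
  have "(((\<lambda>t. g (x + s *\<^sub>R a + t *\<^sub>R a)) \<circ> (\<lambda>t. t - s)) has_vector_derivative 1 *\<^sub>R D) (at s)"
    by (rule vector_diff_chain_at) (auto intro!: derivative_eq_intros assms)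
  then have "((\<lambda>t. g (x + t *\<^sub>R a)) has_vector_derivative D) (at s)"
    by (simp add: o_def algebra_simps)
  then show ?thesis by (rule has_vector_derivative_at_within)
qed

text \<open>Two nested mean value estimates compare the second difference over a small parallelogram
  with the mixed derivative. Only derivatives along \<open>a\<close> and \<open>b\<close> are
  assumed, no total derivative.\<close>

lemma mixed_difference_estimate:
  fixes g :: "'a::real_normed_vector \<Rightarrow> 'b::real_normed_vector"
  assumes S: "open S" "x \<in> S"
    and ga: "\<And>y. y \<in> S \<Longrightarrow> ((\<lambda>t. g (y + t *\<^sub>R a)) has_vector_derivative ga y) (at 0)"
    and gab: "\<And>y. y \<in> S \<Longrightarrow> ((\<lambda>t. ga (y + t *\<^sub>R b)) has_vector_derivative gab y) (at 0)"
    and cont: "continuous_on S gab" and e: "0 < e"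
  shows "\<exists>d>0. \<forall>h. 0 < h \<and> h < d \<longrightarrow>
    norm (g (x + h *\<^sub>R a + h *\<^sub>R b) - g (x + h *\<^sub>R a) - g (x + h *\<^sub>R b) + g x - (h * h) *\<^sub>R gab x) \<le> e * h * h"
proof -
  obtain r1 where r1: "0 < r1" "ball x r1 \<subseteq> S" using S open_contains_ball by blast
  obtain r2 where r2: "0 < r2" "\<And>y. y \<in> S \<Longrightarrow> dist y x < r2 \<Longrightarrow> dist (gab y) (gab x) < e"
    using cont S(2) e unfolding continuous_on_iff by metis
  define r where "r = min r1 r2"
  have r: "0 < r" using r1 r2 by (simp add: r_def)
  define d where "d = r / (norm a + norm b + 1)"
  have pos: "0 < norm a + norm b + 1" using norm_ge_zero[of a] norm_ge_zero[of b] by linarith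
  have d: "0 < d" using r pos by (simp add: d_def)
  have main: "norm (g (x + h *\<^sub>R a + h *\<^sub>R b) - g (x + h *\<^sub>R a) - g (x + h *\<^sub>R b) + g x - (h * h) *\<^sub>R gab x) \<le> e * h * h"
    if h: "0 < h" "h < d" for h
  proof -
    have near: "dist (x + s *\<^sub>R a + t *\<^sub>R b) x < r" if "s \<in> {0..h}" "t \<in> {0..h}" for s t
    proof -
      have "norm (s *\<^sub>R a + t *\<^sub>R b) \<le> s * norm a + t * norm b"
        using that by (metis abs_of_nonneg atLeastAtMost_iff norm_scaleR norm_triangle_ineq)
      also have "\<dots> \<le> h * norm a + h * norm b" using that by (intro add_mono mult_right_mono) auto
      also have "\<dots> < h * (norm a + norm b + 1)" using h by (simp add: algebra_simps)
      also have "\<dots> < d * (norm a + norm b + 1)" using h pos by (intro mult_strict_right_mono)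
      also have "\<dots> = r" using pos by (simp add: d_def)
      finally show ?thesis by (simp add: dist_norm add.assoc)
    qed
    have inS: "x + s *\<^sub>R a + t *\<^sub>R b \<in> S" if "s \<in> {0..h}" "t \<in> {0..h}" for s t
      using near[OF that] r1 by (auto simp: r_def dist_commute)
    have inS0: "x + s *\<^sub>R a \<in> S" if "s \<in> {0..h}" for s using inS[OF that, of 0] h by auto
    \<comment> \<open>The expected growth is subtracted beforehand, so that the mean value estimate
      bounds the error instead of the difference.\<close>
    define u where "u s = g (x + h *\<^sub>R b + s *\<^sub>R a) - g (x + s *\<^sub>R a) - s *\<^sub>R (h *\<^sub>R gab x)" for s
    have "norm (u h - u 0) \<le> (e * h) * (h - 0)"
    proof (rule vector_mvt_bound)
      fix s assume s: "s \<in> {0..h}"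
      have 1: "((\<lambda>s. g (x + h *\<^sub>R b + s *\<^sub>R a)) has_vector_derivative ga (x + h *\<^sub>R b + s *\<^sub>R a)) (at s within {0..h})"
        using inS[OF s, of h] h by (intro directional_derivative_shift[OF ga]) (auto simp: algebra_simps)
      have 2: "((\<lambda>s. g (x + s *\<^sub>R a)) has_vector_derivative ga (x + s *\<^sub>R a)) (at s within {0..h})"
        using inS0[OF s] by (intro directional_derivative_shift[OF ga]) auto
      show "(u has_vector_derivative (ga (x + h *\<^sub>R b + s *\<^sub>R a) - ga (x + s *\<^sub>R a) - h *\<^sub>R gab x)) (at s within {0..h})"
        unfolding u_def
        by (intro has_vector_derivative_diff 1 2) (auto simp: has_vector_derivative_def intro!: derivative_eq_intros)
      define v where "v t = ga (x + s *\<^sub>R a + t *\<^sub>R b) - t *\<^sub>R gab x" for t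
      have "norm (v h - v 0) \<le> e * (h - 0)"
      proof (rule vector_mvt_bound)
        fix t assume t: "t \<in> {0..h}"
        have 3: "((\<lambda>t. ga (x + s *\<^sub>R a + t *\<^sub>R b)) has_vector_derivative gab (x + s *\<^sub>R a + t *\<^sub>R b)) (at t within {0..h})"
          using inS[OF s t] by (intro directional_derivative_shift[OF gab]) auto
        show "(v has_vector_derivative (gab (x + s *\<^sub>R a + t *\<^sub>R b) - gab x)) (at t within {0..h})"
          unfolding v_def
          by (intro has_vector_derivative_diff 3) (auto simp: has_vector_derivative_def intro!: derivative_eq_intros)
        show "norm (gab (x + s *\<^sub>R a + t *\<^sub>R b) - gab x) \<le> e"
          using r2(2)[OF inS[OF s t]] near[OF s t] by (simp add: r_def dist_norm)
      qed (use h in auto)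
      then show "norm (ga (x + h *\<^sub>R b + s *\<^sub>R a) - ga (x + s *\<^sub>R a) - h *\<^sub>R gab x) \<le> e * h"
        by (simp add: v_def algebra_simps)
    qed (use h in auto)
    then show ?thesis by (simp add: u_def algebra_simps)
  qed
  with d show ?thesis by blast
qed

text \<open>The second difference is symmetric in \<open>a\<close> and \<open>b\<close>; divided by
  \<open>h * h\<close> it approximates both mixed derivatives.\<close>

lemma mixed_derivatives_commute:
  fixes g :: "'a::real_normed_vector \<Rightarrow> 'b::real_normed_vector"
  assumes S: "open S" "x \<in> S"
    and ga: "\<And>y. y \<in> S \<Longrightarrow> ((\<lambda>t. g (y + t *\<^sub>R a)) has_vector_derivative ga y) (at 0)"
    and gb: "\<And>y. y \<in> S \<Longrightarrow> ((\<lambda>t. g (y + t *\<^sub>R b)) has_vector_derivative gb y) (at 0)"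
    and gab: "\<And>y. y \<in> S \<Longrightarrow> ((\<lambda>t. ga (y + t *\<^sub>R b)) has_vector_derivative gab y) (at 0)"
    and gba: "\<And>y. y \<in> S \<Longrightarrow> ((\<lambda>t. gb (y + t *\<^sub>R a)) has_vector_derivative gba y) (at 0)"
    and cont: "continuous_on S gab" "continuous_on S gba"
  shows "gab x = gba x"
proof (rule ccontr)
  assume "gab x \<noteq> gba x"
  \<comment> \<open>A quarter: the two approximations together allow a deviation of
    \<open>2 * e\<close>, while the assumed one is \<open>4 * e\<close>.\<close>
  define e where "e = norm (gab x - gba x) / 4"
  have e: "0 < e" using \<open>gab x \<noteq> gba x\<close> by (simp add: e_def)
  obtain d1 where d1: "0 < d1" "\<And>h. 0 < h \<Longrightarrow> h < d1 \<Longrightarrow>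
    norm (g (x + h *\<^sub>R a + h *\<^sub>R b) - g (x + h *\<^sub>R a) - g (x + h *\<^sub>R b) + g x - (h * h) *\<^sub>R gab x) \<le> e * h * h"
    using mixed_difference_estimate[OF S ga gab cont(1) e] by blast
  obtain d2 where d2: "0 < d2" "\<And>h. 0 < h \<Longrightarrow> h < d2 \<Longrightarrow>
    norm (g (x + h *\<^sub>R b + h *\<^sub>R a) - g (x + h *\<^sub>R b) - g (x + h *\<^sub>R a) + g x - (h * h) *\<^sub>R gba x) \<le> e * h * h"
    using mixed_difference_estimate[OF S gb gba cont(2) e] by blast
  define h where "h = min d1 d2 / 2"
  have h: "0 < h" "h < d1" "h < d2" using d1(1) d2(1) by (auto simp: h_def)
  let ?D = "g (x + h *\<^sub>R a + h *\<^sub>R b) - g (x + h *\<^sub>R a) - g (x + h *\<^sub>R b) + g x"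
  have 1: "norm (?D - (h * h) *\<^sub>R gab x) \<le> e * h * h" using d1(2) h by blast
  have 2: "norm (?D - (h * h) *\<^sub>R gba x) \<le> e * h * h" using d2(2)[of h] h by (simp add: algebra_simps)
  have "(h * h) *\<^sub>R (gab x - gba x) = (?D - (h * h) *\<^sub>R gba x) - (?D - (h * h) *\<^sub>R gab x)"
    by (simp add: algebra_simps)
  then have "norm ((h * h) *\<^sub>R (gab x - gba x)) \<le> e * h * h + e * h * h"
    using norm_triangle_ineq4[of "?D - (h * h) *\<^sub>R gba x" "?D - (h * h) *\<^sub>R gab x"] 1 2 by simp
  then have "(h * h) * norm (gab x - gba x) \<le> (h * h) * (2 * e)"
    unfolding norm_scaleR using h by (simp add: abs_mult mult_ac)
  then have "norm (gab x - gba x) \<le> 2 * e" by (rule mult_left_le_imp_le) (use h in simp)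
  then show False using e by (simp add: e_def)
qed

lemma partial_cong_open:
  assumes "open U" "x \<in> U" "\<And>y. y \<in> U \<Longrightarrow> g y = g' y"
  shows "partial i g x = partial i g' x"
proof -
  have "((\<lambda>t::real. x + t *\<^sub>R axis i 1) \<longlongrightarrow> x + 0 *\<^sub>R axis i 1) (nhds 0)"
    by (intro tendsto_intros filterlim_ident)
  then have "eventually (\<lambda>t::real. x + t *\<^sub>R axis i 1 \<in> U) (nhds 0)"
    using assms(1,2) by (simp add: topological_tendstoD)
  then show ?thesis
    unfolding partial_def
    by (intro vector_derivative_cong_eq) (auto elim!: eventually_mono simp: assms(3))
qed

lemma partials_swap:
  assumes "smooth_on U f" "open U" "x \<in> U"
  shows "partials (i # j # is) f x = partials (j # i # is) f x"
proof -
  have d: "((\<lambda>t. partials ks f (y + t *\<^sub>R axis k 1)) has_vector_derivative partials (k # ks) f y) (at 0)"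
    if "y \<in> U" for y k ks using assms(1) that unfolding smooth_on_def by blast
  have c: "continuous_on U (partials ks f)" for ks using assms(1) unfolding smooth_on_def by blast
  show ?thesis
    by (rule mixed_derivatives_commute[OF assms(2,3) d d d d c c])
qed

lemma partials_move:
  assumes "smooth_on U f" "open U" "x \<in> U"
  shows "partials (i # ks @ js) f x = partials (ks @ i # js) f x"
  using assms(3)
proof (induction ks arbitrary: x)
  case (Cons k ks)
  have "partials (i # (k # ks) @ js) f x = partials (k # i # ks @ js) f x"
    using partials_swap[OF assms(1,2) Cons.prems, of i k "ks @ js"] by simp
  also have "\<dots> = partials (k # ks @ i # js) f x"
    unfolding partials.simps(2)[of k] by (rule partial_cong_open[OF assms(2) Cons.prems Cons.IH])
  finally show ?case by simp
qed simp

text \<open>The head of one list is moved to its place in the other. The induction hypothesis holds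
  on all of the open set \<open>U\<close> and therefore survives one more partial
  derivative.\<close>

lemma partials_perm:
  assumes "smooth_on U f" "open U" "x \<in> U" "mset is = mset is'"
  shows "partials is f x = partials is' f x"
  using assms(3,4)
proof (induction "is" arbitrary: is' x)
  case (Cons i "is")
  then have "i \<in> set is'" by (metis list.set_intros(1) set_mset_mset)
  then obtain ks js where is': "is' = ks @ i # js" by (meson split_list)
  with Cons.prems have m: "mset is = mset (ks @ js)" by simp
  have "partials (i # is) f x = partials (i # ks @ js) f x"
    unfolding partials.simps(2)[of i]
    by (rule partial_cong_open[OF assms(2) Cons.prems(1) Cons.IH]) (use m in auto)
  then show ?case using partials_move[OF assms(1,2) Cons.prems(1)] is' by simp
qed simp

text \<open>\<open>dalpha\<close> picks an arbitrary list with the prescribed counts; permutation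
  invariance allows it to be replaced by any list at hand.\<close>

lemma dalpha_count:
  fixes f :: "real ^ 'n::finite \<Rightarrow> complex"
  assumes "smooth_on U f" "open U" "x \<in> U"
  shows "dalpha (count (mset is)) f x = partials is f x"
proof -
  let ?is = "SOME is'. \<forall>i. count (mset is') i = count (mset is) i"
  have "\<forall>i. count (mset ?is) i = count (mset is) i" by (rule someI[of _ "is"]) simp
  then have "mset ?is = mset is" by (intro multiset_eqI) auto
  then show ?thesis unfolding dalpha_def using partials_perm[OF assms] by blast
qed

lemma mi_abs_count: "mi_abs (count (mset is)) = length (is :: 'n::finite list)"
proof -
  have "mi_abs (count (mset is)) = (\<Sum>i\<in>set_mset (mset is). count (mset is) i)"
    unfolding mi_abs_def by (rule sum.mono_neutral_right) (auto simp: count_eq_zero_iff)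
  also have "\<dots> = size (mset is)" by (simp add: size_multiset_overloaded_eq)
  finally show ?thesis by simp
qed

section \<open>Lipschitz bounds from coordinate derivatives on quasiconvex sets\<close>

lemma coordinatewise_lipschitz:
  fixes g :: "real ^ 'n \<Rightarrow> 'b::real_normed_vector"
  assumes hd: "\<And>y i. y \<in> cball a (dist a b) \<Longrightarrow> ((\<lambda>t. g (y + t *\<^sub>R axis i 1)) has_vector_derivative g' i y) (at 0)"
    and B: "\<And>y i. y \<in> cball a (dist a b) \<Longrightarrow> norm (g' i y) \<le> B"
  shows "norm (g b - g a) \<le> real CARD('n) * B * dist a b"
proof -
  \<comment> \<open>Coordinates are switched from \<open>a\<close> to \<open>b\<close> one at a
    time. The intermediate points lie coordinatewise between \<open>a\<close> and \<open>b\<close>,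
    hence in the ball where the derivatives are controlled.\<close>
  define c where "c J = (\<chi> k. if k \<in> J then b $ k else a $ k)" for J
  have in_ball: "y \<in> cball a (dist a b)" if "\<And>k. \<bar>(y - a) $ k\<bar> \<le> \<bar>(b - a) $ k\<bar>" for y
    using norm_le_componentwise_cart[of "y - a" "b - a"] that by (simp add: dist_norm norm_minus_commute)
  have B0: "0 \<le> B" using B[of a] norm_ge_zero order_trans by (metis centre_in_cball zero_le_dist)
  have "norm (g (c J) - g a) \<le> real (card J) * (B * dist a b)" if "finite J" for J
    using that
  proof (induction J)
    case empty
    then show ?case by (simp add: c_def)
  next
    case (insert j J)
    define s where "s = (b - a) $ j"
    have cins: "c (insert j J) = c J + s *\<^sub>R axis j 1"
      using insert.hyps by (auto simp: c_def s_def vec_eq_iff axis_def)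
    have in_ball': "c J + (r * s) *\<^sub>R axis j 1 \<in> cball a (dist a b)" if "r \<in> {0..1}" for r
    proof (rule in_ball)
      fix k
      have "\<bar>r * s\<bar> \<le> \<bar>s\<bar>" using that by (simp add: abs_mult mult_left_le_one_le)
      then show "\<bar>(c J + (r * s) *\<^sub>R axis j 1 - a) $ k\<bar> \<le> \<bar>(b - a) $ k\<bar>"
        using insert.hyps by (auto simp: c_def axis_def s_def)
    qed
    have "norm (g (c J + (1 * s) *\<^sub>R axis j 1) - g (c J + (0 * s) *\<^sub>R axis j 1)) \<le> (B * dist a b) * (1 - 0)"
    proof (rule vector_mvt_bound)
      fix r :: real assume r: "r \<in> {0..1}"
      have "((\<lambda>t. g (c J + t *\<^sub>R axis j 1)) has_vector_derivative g' j (c J + (r * s) *\<^sub>R axis j 1)) (at (r * s))"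
        by (rule directional_derivative_shift[OF hd[OF in_ball'[OF r]]])
      then have "(((\<lambda>t. g (c J + t *\<^sub>R axis j 1)) \<circ> (\<lambda>r. r * s)) has_vector_derivative s *\<^sub>R g' j (c J + (r * s) *\<^sub>R axis j 1)) (at r)"
        by (intro vector_diff_chain_at) (auto intro!: derivative_eq_intros)
      then show "((\<lambda>r. g (c J + (r * s) *\<^sub>R axis j 1)) has_vector_derivative s *\<^sub>R g' j (c J + (r * s) *\<^sub>R axis j 1)) (at r within {0..1})"
        by (simp add: o_def has_vector_derivative_at_within)
      have "\<bar>s\<bar> \<le> dist a b" unfolding s_def by (metis component_le_norm_cart dist_commute dist_norm)
      then show "norm (s *\<^sub>R g' j (c J + (r * s) *\<^sub>R axis j 1)) \<le> B * dist a b"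
        using B[OF in_ball'[OF r], of j] by (simp add: mult.commute[of B] mult_mono)
    qed simp
    then have "norm (g (c (insert j J)) - g (c J)) \<le> B * dist a b" by (simp add: cins)
    moreover have "norm (g (c (insert j J)) - g a) \<le> norm (g (c (insert j J)) - g (c J)) + norm (g (c J) - g a)"
      using norm_triangle_ineq[of "g (c (insert j J)) - g (c J)" "g (c J) - g a"] by simp
    ultimately show ?case using insert by (simp add: algebra_simps)
  qed
  from this[of UNIV] show ?thesis by (simp add: c_def mult.assoc)
qed

text \<open>The variation over the partition 0, \<open>t\<close>, 1 is already at least this
  distance.\<close>

lemma dist_pathstart_le_path_length:
  assumes "rectifiable_path g" "t \<in> {0..1}"
  shows "dist (g t) (pathstart g) \<le> path_length g"
proof -
  define \<tau> where "\<tau> i = (if i = 0 then 0 else if i = 1 then t else 1)" for i :: nat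
  have "(\<Sum>i<2. dist (g (\<tau> (Suc i))) (g (\<tau> i))) \<in> variation_sums g"
    unfolding variation_sums_def using assms(2)
    by (intro CollectI exI[of _ \<tau>] exI[of _ 2]) (auto simp: \<tau>_def)
  then have "(\<Sum>i<2. dist (g (\<tau> (Suc i))) (g (\<tau> i))) \<le> path_length g"
    unfolding path_length_def by (rule cSup_upper) (use assms in \<open>simp add: rectifiable_path_def\<close>)
  moreover have "(\<Sum>i<2. dist (g (\<tau> (Suc i))) (g (\<tau> i))) = dist (g t) (g 0) + dist (g 1) (g t)"
    by (simp add: numeral_2_eq_2 \<tau>_def)
  ultimately show ?thesis using zero_le_dist[of "g 1" "g t"] unfolding pathstart_def by linarith
qed

text \<open>A rectifiable path need not be differentiable, so \<open>\<phi>\<close> is not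
  differentiated along it. The path is cut so finely that each chord stays in a ball inside
  \<open>V\<close>, and the chord lengths add up to at most the length of the path.\<close>

lemma lipschitz_along_path:
  fixes \<phi> :: "real ^ 'n \<Rightarrow> 'b::real_normed_vector"
  assumes V: "open V" "path_image g \<subseteq> V" and g: "rectifiable_path g"
    and hd: "\<And>y i. y \<in> V \<Longrightarrow> ((\<lambda>t. \<phi> (y + t *\<^sub>R axis i 1)) has_vector_derivative \<phi>' i y) (at 0)"
    and B: "\<And>y i. y \<in> V \<Longrightarrow> norm (\<phi>' i y) \<le> B"
  shows "norm (\<phi> (pathfinish g) - \<phi> (pathstart g)) \<le> real CARD('n) * B * path_length g"
proof -
  have path: "path g" using g by (simp add: rectifiable_path_def)
  have "g 0 \<in> V" using V(2) by (auto simp: path_image_def)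
  then have B0: "0 \<le> B" using B norm_ge_zero order_trans by blast
  obtain r where r: "0 < r" "(\<Union>y\<in>path_image g. ball y r) \<subseteq> V"
    using compact_subset_open_imp_ball_epsilon_subset[OF compact_path_image[OF path] V] by blast
  have "uniformly_continuous_on {0..1} g"
    using path compact_uniformly_continuous[of "{0..1}" g] by (simp add: path_def)
  then obtain d where d: "0 < d" "\<And>s t. s \<in> {0..1} \<Longrightarrow> t \<in> {0..1} \<Longrightarrow> dist t s < d \<Longrightarrow> dist (g t) (g s) < r"
    using r(1) unfolding uniformly_continuous_on_def by metis
  obtain N :: nat where N: "1 / d < real N" using reals_Archimedean2 by blast
  have Npos: "0 < N" using N d(1) by (metis gr0I of_nat_0 not_less_iff_gr_or_eq zero_less_divide_1_iff)
  define \<tau> where "\<tau> i = real i / real N" for i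
  have \<tau>: "\<tau> i \<in> {0..1}" if "i \<le> N" for i using that Npos by (simp add: \<tau>_def)
  have step: "norm (\<phi> (g (\<tau> (Suc i))) - \<phi> (g (\<tau> i))) \<le> real CARD('n) * B * dist (g (\<tau> (Suc i))) (g (\<tau> i))" if "i < N" for i
  proof -
    have "dist (\<tau> (Suc i)) (\<tau> i) = 1 / real N" by (simp add: \<tau>_def dist_real_def diff_divide_distrib[symmetric])
    also have "\<dots> < d" using N d(1) Npos by (simp add: field_simps)
    finally have "dist (g (\<tau> (Suc i))) (g (\<tau> i)) < r" using d(2) \<tau>[of i] \<tau>[of "Suc i"] that by simp
    then have "cball (g (\<tau> i)) (dist (g (\<tau> i)) (g (\<tau> (Suc i)))) \<subseteq> ball (g (\<tau> i)) r" by (auto simp: dist_commute)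
    also have "\<dots> \<subseteq> V" using r(2) \<tau>[of i] that unfolding path_image_def by (intro order_trans[OF _ r(2)] UN_upper) (auto simp: path_image_def)
    finally have sub: "cball (g (\<tau> i)) (dist (g (\<tau> i)) (g (\<tau> (Suc i)))) \<subseteq> V" .
    show ?thesis
      using coordinatewise_lipschitz[of "g (\<tau> i)" "g (\<tau> (Suc i))" \<phi> \<phi>' B] hd B sub
      by (simp add: dist_commute subset_eq)
  qed
  have "\<phi> (pathfinish g) - \<phi> (pathstart g) = (\<Sum>i<N. \<phi> (g (\<tau> (Suc i))) - \<phi> (g (\<tau> i)))"
    using sum_lessThan_telescope[of "\<lambda>i. \<phi> (g (\<tau> i))" N] Npos by (simp add: \<tau>_def pathfinish_def pathstart_def)
  also have "norm \<dots> \<le> (\<Sum>i<N. real CARD('n) * B * dist (g (\<tau> (Suc i))) (g (\<tau> i)))"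
    by (rule sum_norm_le) (use step in auto)
  also have "\<dots> = real CARD('n) * B * (\<Sum>i<N. dist (g (\<tau> (Suc i))) (g (\<tau> i)))" by (simp add: sum_distrib_left)
  also have "\<dots> \<le> real CARD('n) * B * path_length g"
  proof (intro mult_left_mono)
    show "(\<Sum>i<N. dist (g (\<tau> (Suc i))) (g (\<tau> i))) \<le> path_length g"
      unfolding path_length_def
    proof (rule cSup_upper)
      show "(\<Sum>i<N. dist (g (\<tau> (Suc i))) (g (\<tau> i))) \<in> variation_sums g"
        unfolding variation_sums_def using Npos
        by (intro CollectI exI[of _ \<tau>] exI[of _ N]) (auto simp: \<tau>_def divide_right_mono)
    qed (use g in \<open>simp add: rectifiable_path_def\<close>)
  qed (use B0 in simp)
  finally show ?thesis .
qed

text \<open>The hypotheses on \<open>\<phi>\<close> are required only within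
  \<open>K * dist x y\<close> of \<open>x\<close>: the connecting path cannot leave this ball, and
  the bounds available for Taylor polynomials deteriorate with the distance from
  \<open>x\<close>.\<close>

lemma quasiconvex_lipschitz:
  fixes U :: "(real ^ 'n) set"
  assumes U: "open U" "quasiconvex U"
  obtains K where "1 \<le> K" "\<And>(\<phi> :: real ^ 'n \<Rightarrow> 'b::real_normed_vector) \<phi>' B x y. x \<in> U \<Longrightarrow> y \<in> U \<Longrightarrow>
    (\<And>u i. u \<in> U \<Longrightarrow> dist u x \<le> K * dist x y \<Longrightarrow>
       ((\<lambda>t. \<phi> (u + t *\<^sub>R axis i 1)) has_vector_derivative \<phi>' i u) (at 0)) \<Longrightarrow>
    (\<And>u i. u \<in> U \<Longrightarrow> dist u x \<le> K * dist x y \<Longrightarrow> norm (\<phi>' i u) \<le> B) \<Longrightarrow>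
    norm (\<phi> y - \<phi> x) \<le> K * B * dist x y"
proof -
  obtain C where C: "\<And>x y. x \<in> U \<Longrightarrow> y \<in> U \<Longrightarrow> \<exists>g. rectifiable_path g \<and> path_image g \<subseteq> U \<and>
      pathstart g = x \<and> pathfinish g = y \<and> path_length g \<le> C * dist x y"
    using U(2) unfolding quasiconvex_def by blast
  \<comment> \<open>\<open>C\<close> may be negative, hence the maximum. The added 1 leaves room for
    an open ball that contains the whole path when \<open>x \<noteq> y\<close>.\<close>
  define K where "K = real CARD('n) * (max C 0 + 1)"
  have K': "max C 0 + 1 \<le> K"
    unfolding K_def using mult_right_mono[of 1 "real CARD('n)" "max C 0 + 1"] by simp
  then have K1: "1 \<le> K" by linarith
  have main: "norm (\<phi> y - \<phi> x) \<le> K * B * dist x y"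
    if xy: "x \<in> U" "y \<in> U"
      and hd: "\<And>u i. u \<in> U \<Longrightarrow> dist u x \<le> K * dist x y \<Longrightarrow> ((\<lambda>t. \<phi> (u + t *\<^sub>R axis i 1)) has_vector_derivative \<phi>' i u) (at 0)"
      and B: "\<And>u i. u \<in> U \<Longrightarrow> dist u x \<le> K * dist x y \<Longrightarrow> norm (\<phi>' i u) \<le> B"
    for \<phi> :: "real ^ 'n \<Rightarrow> 'b" and \<phi>' B x y
  proof (cases "x = y")
    case False
    have B0: "0 \<le> B" using B[of x undefined] xy K1 norm_ge_zero order_trans by (metis dist_self mult_nonneg_nonneg zero_le_dist zero_le_one)
    obtain g where g: "rectifiable_path g" "path_image g \<subseteq> U" "pathstart g = x" "pathfinish g = y"
      "path_length g \<le> C * dist x y" using C xy by blast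
    have len: "path_length g \<le> max C 0 * dist x y"
      using g(5) mult_right_mono[of C "max C 0" "dist x y"] by simp
    define V where "V = U \<inter> ball x ((max C 0 + 1) * dist x y)"
    have V: "u \<in> U" "dist u x \<le> K * dist x y" if "u \<in> V" for u
    proof -
      show "u \<in> U" using that by (simp add: V_def)
      have "dist u x < (max C 0 + 1) * dist x y" using that by (simp add: V_def dist_commute)
      also have "\<dots> \<le> K * dist x y" by (intro mult_right_mono K') simp
      finally show "dist u x \<le> K * dist x y" by simp
    qed
    have "path_image g \<subseteq> V"
    proof
      fix u assume u: "u \<in> path_image g"
      then obtain t where "t \<in> {0..1}" "u = g t" by (auto simp: path_image_def)
      then have "dist u x \<le> max C 0 * dist x y" using dist_pathstart_le_path_length[OF g(1)] g(3) len by fastforce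
      also have "\<dots> < (max C 0 + 1) * dist x y" using False by (intro mult_strict_right_mono) auto
      finally show "u \<in> V" using u g(2) by (auto simp: V_def dist_commute)
    qed
    then have "norm (\<phi> (pathfinish g) - \<phi> (pathstart g)) \<le> real CARD('n) * B * path_length g"
      by (intro lipschitz_along_path[of V g \<phi> \<phi>'] g(1) hd B V) (auto simp: V_def U(1))
    also have "\<dots> \<le> real CARD('n) * B * ((max C 0 + 1) * dist x y)"
      using len B0 mult_right_mono[of "max C 0" "max C 0 + 1" "dist x y"] by (intro mult_left_mono) auto
    finally show ?thesis using g by (simp add: K_def algebra_simps)
  qed simp
  show ?thesis by (rule that[OF K1]) (rule main)
qed

section \<open>Taylor polynomials with complex argument\<close>

text \<open>Up to the factor \<open>1 / fact k\<close> this is the homogeneous part of degree \<open>k\<close> of the Taylor expansion of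
  \<open>partials is f\<close> at \<open>x\<close>. Summing over lists instead of multi-indices avoids multinomial coefficients.\<close>

fun form_term :: "(real ^ 'n \<Rightarrow> complex) \<Rightarrow> nat \<Rightarrow> 'n::finite list \<Rightarrow> real ^ 'n \<Rightarrow> complex ^ 'n \<Rightarrow> complex" where
  "form_term f 0 is x w = partials is f x"
| "form_term f (Suc k) is x w = (\<Sum>j\<in>UNIV. w $ j * form_term f k (j # is) x w)"

definition taylor :: "(real ^ 'n \<Rightarrow> complex) \<Rightarrow> nat \<Rightarrow> 'n::finite list \<Rightarrow> real ^ 'n \<Rightarrow> complex ^ 'n \<Rightarrow> complex" where
  "taylor f p is x z = (\<Sum>k<p. form_term f k is x (z - cemb x) / fact k)"

lemma form_term_perm:
  assumes "smooth_on U f" "open U" "x \<in> U" "mset is = mset is'"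
  shows "form_term f k is x w = form_term f k is' x w"
  using assms(4)
proof (induction k arbitrary: "is" is')
  case 0 then show ?case unfolding form_term.simps by (rule partials_perm[OF assms(1-3)])
next
  case (Suc k)
  then have "form_term f k (j # is) x w = form_term f k (j # is') x w" for j by (intro Suc.IH) simp
  then show ?case by simp
qed

lemma form_term_bound:
  assumes "\<And>is'. length is' = k + length is \<Longrightarrow> norm (partials is' f x) \<le> B"
  shows "norm (form_term f k is x w) \<le> (\<Sum>j\<in>UNIV. norm (w $ j)) ^ k * B"
  using assms
proof (induction k arbitrary: "is")
  case (Suc k)
  have "norm (form_term f (Suc k) is x w) \<le> (\<Sum>j\<in>UNIV. norm (w $ j) * ((\<Sum>j\<in>UNIV. norm (w $ j)) ^ k * B))"
    unfolding form_term.simps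
  proof (rule sum_norm_le)
    fix j
    have "norm (form_term f k (j # is) x w) \<le> (\<Sum>j\<in>UNIV. norm (w $ j)) ^ k * B"
      by (rule Suc.IH) (use Suc.prems in auto)
    then show "norm (w $ j * form_term f k (j # is) x w) \<le> norm (w $ j) * ((\<Sum>j\<in>UNIV. norm (w $ j)) ^ k * B)"
      by (simp add: norm_mult mult_left_mono)
  qed
  then show ?case by (simp add: sum_distrib_right[symmetric] mult.assoc)
qed simp

lemma cemb_shift: "(z - cemb (x + t *\<^sub>R axis i 1)) $ j = (z - cemb x) $ j - of_real t * (if i = j then 1 else 0)"
  by (auto simp: cemb_def axis_def)

text \<open>The base point enters through the coefficients and through the argument. The
  \<open>k\<close> linear factors contribute equally because the order of the partial derivatives is
  irrelevant.\<close>

lemma form_term_derivative_base: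
  assumes sm: "smooth_on U f" "open U" and x: "x \<in> U"
  shows "((\<lambda>t. form_term f k is (x + t *\<^sub>R axis i 1) (z - cemb (x + t *\<^sub>R axis i 1))) has_vector_derivative
     form_term f k (i # is) x (z - cemb x) - of_nat k * form_term f (k - 1) (i # is) x (z - cemb x)) (at 0)"
proof (induction k arbitrary: "is")
  case 0
  then show ?case using sm(1) x unfolding smooth_on_def by simp
next
  case (Suc k)
  let ?w = "z - cemb x"
  have w: "((\<lambda>t. (z - cemb (x + t *\<^sub>R axis i 1)) $ j) has_vector_derivative - (if i = j then 1 else 0)) (at 0)" for j
    unfolding cemb_shift by (auto intro!: derivative_eq_intros simp: has_vector_derivative_def scaleR_conv_of_real)
  have swap: "form_term f l (i # j # is) x ?w = form_term f l (j # i # is) x ?w" for l j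
    by (rule form_term_perm[OF sm x]) simp
  have step: "((\<lambda>t. (z - cemb (x + t *\<^sub>R axis i 1)) $ j * form_term f k (j # is) (x + t *\<^sub>R axis i 1) (z - cemb (x + t *\<^sub>R axis i 1)))
      has_vector_derivative ?w $ j * (form_term f k (i # j # is) x ?w - of_nat k * form_term f (k - 1) (i # j # is) x ?w)
        + - (if i = j then 1 else 0) * form_term f k (j # is) x ?w) (at 0)" for j
    using has_vector_derivative_mult[OF w[of j] Suc.IH[of "j # is"]] by simp
  have "((\<lambda>t. form_term f (Suc k) is (x + t *\<^sub>R axis i 1) (z - cemb (x + t *\<^sub>R axis i 1))) has_vector_derivative
     (\<Sum>j\<in>UNIV. ?w $ j * (form_term f k (i # j # is) x ?w - of_nat k * form_term f (k - 1) (i # j # is) x ?w)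
        + - (if i = j then 1 else 0) * form_term f k (j # is) x ?w)) (at 0)"
    unfolding form_term.simps
    by (intro has_vector_derivative_sum step)
  also have "(\<Sum>j\<in>UNIV. ?w $ j * (form_term f k (i # j # is) x ?w - of_nat k * form_term f (k - 1) (i # j # is) x ?w)
        + - (if i = j then 1 else 0) * form_term f k (j # is) x ?w) =
     form_term f (Suc k) (i # is) x ?w - of_nat k * (\<Sum>j\<in>UNIV. ?w $ j * form_term f (k - 1) (j # i # is) x ?w)
       - form_term f k (i # is) x ?w"
  proof -
    have "(\<Sum>j\<in>UNIV. - (if i = j then 1 else 0) * form_term f k (j # is) x ?w) = - form_term f k (i # is) x ?w"
      by (simp add: if_distrib if_distribR sum.If_cases[of UNIV] cong: if_cong)
    then show ?thesis
      by (simp only: sum.distrib swap right_diff_distrib sum_subtractf sum_distrib_left form_term.simps)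
        (simp add: algebra_simps)
  qed
  \<comment> \<open>For \<open>k = 0\<close> the truncated \<open>k - 1\<close> is harmless because
    of the factor \<open>of_nat k\<close>.\<close>
  also have "of_nat k * (\<Sum>j\<in>UNIV. ?w $ j * form_term f (k - 1) (j # i # is) x ?w) = of_nat k * form_term f k (i # is) x ?w"
    by (cases k) auto
  finally show ?case by (simp add: algebra_simps)
qed

text \<open>The sum telescopes: what the coefficients contribute in degree \<open>k\<close> is
  cancelled by what the argument contributes in degree \<open>k + 1\<close>, and only the top degree
  survives. Hence moving the base point changes the polynomial only by a quantity of highest
  order.\<close>

lemma taylor_derivative_base:
  assumes sm: "smooth_on U f" "open U" and x: "x \<in> U"
  shows "((\<lambda>t. taylor f (Suc p) is (x + t *\<^sub>R axis i 1) z) has_vector_derivative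
     form_term f p (i # is) x (z - cemb x) / fact p) (at 0)"
proof -
  let ?q = "\<lambda>k. form_term f k (i # is) x (z - cemb x)"
  have "((\<lambda>t. taylor f (Suc p) is (x + t *\<^sub>R axis i 1) z) has_vector_derivative
     (\<Sum>k<Suc p. (?q k - of_nat k * ?q (k - 1)) / fact k)) (at 0)"
    unfolding taylor_def
    by (intro has_vector_derivative_sum has_vector_derivative_divide form_term_derivative_base[OF sm x])
  also have "(\<Sum>k<Suc p. (?q k - of_nat k * ?q (k - 1)) / fact k) = ?q p / fact p"
  proof (induction p)
    case (Suc p)
    have e: "of_nat (Suc p) * ?q p / fact (Suc p) = ?q p / fact p" by (simp add: fact_Suc del: of_nat_Suc)
    have "(\<Sum>k<Suc (Suc p). (?q k - of_nat k * ?q (k - 1)) / fact k) =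
        ?q p / fact p + (?q (Suc p) - of_nat (Suc p) * ?q p) / fact (Suc p)"
      by (subst sum.lessThan_Suc) (simp only: Suc.IH diff_Suc_1)
    then show ?case by (simp only: diff_divide_distrib e) simp
  qed simp
  finally show ?thesis .
qed

lemma form_term_derivative_arg:
  fixes x :: "real ^ 'n::finite"
  assumes sm: "smooth_on U f" "open U" and x: "x \<in> U"
  shows "(form_term f k is x has_derivative
    (\<lambda>v. of_nat k * (\<Sum>j\<in>UNIV. v $ j * form_term f (k - 1) (j # is) x w))) (at w)"
proof (induction k arbitrary: "is")
  case 0
  then show ?case by simp
next
  case (Suc k)
  have swap: "form_term f l (i # j # is) x w = form_term f l (j # i # is) x w" for l i j
    by (rule form_term_perm[OF sm x]) simp
  have c: "((\<lambda>w. w $ j) has_derivative (\<lambda>v. v $ j)) (at w)" for j :: 'n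
    by (rule bounded_linear_imp_has_derivative) (rule bounded_linear_vec_nth)
  have D: "(form_term f (Suc k) is x has_derivative (\<lambda>v. \<Sum>j\<in>UNIV.
      w $ j * (of_nat k * (\<Sum>i\<in>UNIV. v $ i * form_term f (k - 1) (i # j # is) x w)) + v $ j * form_term f k (j # is) x w)) (at w)"
  proof -
    have step: "((\<lambda>w. w $ j * form_term f k (j # is) x w) has_derivative
      (\<lambda>v. w $ j * (of_nat k * (\<Sum>i\<in>UNIV. v $ i * form_term f (k - 1) (i # j # is) x w)) + v $ j * form_term f k (j # is) x w)) (at w)" for j
      by (rule has_derivative_mult[OF c Suc.IH])
    have eq: "form_term f (Suc k) is x = (\<lambda>w. \<Sum>j\<in>UNIV. w $ j * form_term f k (j # is) x w)" by (rule ext) simp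
    show ?thesis unfolding eq by (rule has_derivative_sum) (rule step)
  qed
  have "(\<Sum>j\<in>UNIV. w $ j * (of_nat k * (\<Sum>i\<in>UNIV. v $ i * form_term f (k - 1) (i # j # is) x w)) + v $ j * form_term f k (j # is) x w)
     = of_nat (Suc k) * (\<Sum>j\<in>UNIV. v $ j * form_term f (Suc k - 1) (j # is) x w)" for v
  proof -
    have "(\<Sum>j\<in>UNIV. w $ j * (of_nat k * (\<Sum>i\<in>UNIV. v $ i * form_term f (k - 1) (i # j # is) x w)))
        = (\<Sum>j\<in>UNIV. \<Sum>i\<in>UNIV. of_nat k * (v $ i * (w $ j * form_term f (k - 1) (j # i # is) x w)))"
    proof (rule sum.cong[OF refl])
      fix j
      have "(\<Sum>i\<in>UNIV. v $ i * form_term f (k - 1) (i # j # is) x w) = (\<Sum>i\<in>UNIV. v $ i * form_term f (k - 1) (j # i # is) x w)"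
        by (intro sum.cong refl arg_cong2[where f="(*)"] swap)
      then show "w $ j * (of_nat k * (\<Sum>i\<in>UNIV. v $ i * form_term f (k - 1) (i # j # is) x w)) =
        (\<Sum>i\<in>UNIV. of_nat k * (v $ i * (w $ j * form_term f (k - 1) (j # i # is) x w)))"
        by (simp add: sum_distrib_left mult_ac)
    qed
    also have "\<dots> = (\<Sum>i\<in>UNIV. v $ i * (of_nat k * (\<Sum>j\<in>UNIV. w $ j * form_term f (k - 1) (j # i # is) x w)))"
      by (subst sum.swap) (simp add: sum_distrib_left mult_ac)
    also have "\<dots> = (\<Sum>i\<in>UNIV. v $ i * (of_nat k * form_term f k (i # is) x w))" by (cases k) auto
    finally show ?thesis by (simp add: sum.distrib sum_distrib_left algebra_simps)
  qed
  then show ?case by (intro has_derivative_eq_rhs[OF D] ext)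
qed

text \<open>The derivative is complex linear in \<open>v\<close>, which is the form of holomorphy
  used later. Its coefficients are Taylor polynomials of the first partial derivatives, one degree
  lower, so derivatives are estimated by the same means as values.\<close>

lemma taylor_derivative_arg:
  fixes x :: "real ^ 'n::finite"
  assumes sm: "smooth_on U f" "open U" and x: "x \<in> U"
  shows "(taylor f (Suc p) is x has_derivative (\<lambda>v. \<Sum>j\<in>UNIV. v $ j * taylor f p (j # is) x z)) (at z)"
proof -
  let ?w = "z - cemb x"
  have "(form_term f k is x \<circ> (\<lambda>z. z - cemb x) has_derivative
    (\<lambda>v. of_nat k * (\<Sum>j\<in>UNIV. v $ j * form_term f (k - 1) (j # is) x ?w)) \<circ> (\<lambda>v. v)) (at z)" for k
    by (rule diff_chain_at[OF _ form_term_derivative_arg[OF sm x]]) (auto intro!: derivative_eq_intros)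
  then have "((\<lambda>z. \<Sum>k<Suc p. form_term f k is x (z - cemb x) / fact k) has_derivative
     (\<lambda>v. \<Sum>k<Suc p. of_nat k * (\<Sum>j\<in>UNIV. v $ j * form_term f (k - 1) (j # is) x ?w) / fact k)) (at z)"
    by (intro has_derivative_sum bounded_linear.has_derivative[OF bounded_linear_divide]) (simp add: o_def)
  moreover have "(\<Sum>k<Suc p. of_nat k * (\<Sum>j\<in>UNIV. v $ j * form_term f (k - 1) (j # is) x ?w) / fact k) =
    (\<Sum>j\<in>UNIV. v $ j * taylor f p (j # is) x z)" for v
  proof -
    have "(\<Sum>k<Suc p. of_nat k * (\<Sum>j\<in>UNIV. v $ j * form_term f (k - 1) (j # is) x ?w) / fact k)
        = (\<Sum>k<p. (\<Sum>j\<in>UNIV. v $ j * form_term f k (j # is) x ?w) / fact k)"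
      by (subst sum.lessThan_Suc_shift) (simp add: field_simps del: of_nat_Suc)
    also have "\<dots> = (\<Sum>j\<in>UNIV. v $ j * taylor f p (j # is) x z)"
      unfolding taylor_def sum_distrib_left sum_divide_distrib by (subst sum.swap) (simp add: mult_ac)
    finally show ?thesis .
  qed
  ultimately show ?thesis unfolding taylor_def[abs_def] by simp
qed

section \<open>Gluing local approximants\<close>

definition smoothstep :: "real \<Rightarrow> real" where
  "smoothstep u = 2 * (max 0 u)\<^sup>2 - 4 * (max 0 (u - 1/2))\<^sup>2 + 2 * (max 0 (u - 1))\<^sup>2"

text \<open>A tent over the unit interval with height 2 at 1/2 and integral 1, so
  \<open>smoothstep\<close> is a piecewise quadratic C1 transition from 0 to 1. Positive parts
  encode it in one formula without cases.\<close>

definition smoothstep' :: "real \<Rightarrow> real" where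
  "smoothstep' u = 4 * max 0 u - 8 * max 0 (u - 1/2) + 4 * max 0 (u - 1)"

lemma DERIV_positive_part_square: "((\<lambda>u::real. (max 0 u)\<^sup>2) has_real_derivative 2 * max 0 u) (at u)"
proof -
  consider "u < 0" | "u > 0" | "u = 0" by linarith
  then show ?thesis
  proof cases
    case 1
    have "((\<lambda>u::real. 0) has_real_derivative 0) (at u)" by simp
    then show ?thesis
      by (rule has_field_derivative_transform_within_open[of _ _ _ "{..<0}", THEN DERIV_cong]) (use 1 in auto)
  next
    case 2
    have "((\<lambda>u::real. u\<^sup>2) has_real_derivative 2 * u) (at u)" by (auto intro!: derivative_eq_intros)
    then show ?thesis
      by (rule has_field_derivative_transform_within_open[of _ _ _ "{0<..}", THEN DERIV_cong]) (use 2 in auto)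
  next
    case 3
    have "(\<lambda>h::real. max 0 h) \<midarrow>0\<rightarrow> max 0 0" by (intro tendsto_intros)
    moreover have "(\<lambda>h::real. ((max 0 (0 + h))\<^sup>2 - (max 0 0)\<^sup>2) / h) = max 0"
      by (auto simp: max_def power2_eq_square)
    ultimately show ?thesis unfolding 3 DERIV_def by simp
  qed
qed

lemma DERIV_smoothstep: "(smoothstep has_real_derivative smoothstep' u) (at u)"
proof -
  have s: "((\<lambda>u::real. (max 0 (u - c))\<^sup>2) has_real_derivative 2 * max 0 (u - c)) (at u)" for c
  proof -
    have "((\<lambda>u. u - c) has_real_derivative 1) (at u)" by (auto intro!: derivative_eq_intros)
    from DERIV_chain2[OF DERIV_positive_part_square this] show ?thesis by simp
  qed
  have "((\<lambda>u. 2 * (max 0 u)\<^sup>2 - 4 * (max 0 (u - 1/2))\<^sup>2 + 2 * (max 0 (u - 1))\<^sup>2) has_real_derivative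
    2 * (2 * max 0 u) - 4 * (2 * max 0 (u - 1/2)) + 2 * (2 * max 0 (u - 1))) (at u)"
    by (intro DERIV_add DERIV_diff DERIV_cmult s DERIV_positive_part_square)
  then show ?thesis by (simp add: smoothstep_def[abs_def] smoothstep'_def)
qed

lemma smoothstep'_bounds: "0 \<le> smoothstep' u" "smoothstep' u \<le> 2"
  by (auto simp: smoothstep'_def max_def)

lemma smoothstep'_outside: "u \<le> 0 \<or> 1 \<le> u \<Longrightarrow> smoothstep' u = 0"
  by (auto simp: smoothstep'_def max_def)

lemma smoothstep_le_0 [simp]: "u \<le> 0 \<Longrightarrow> smoothstep u = 0"
  by (auto simp: smoothstep_def max_def)

lemma smoothstep_ge_1 [simp]: "1 \<le> u \<Longrightarrow> smoothstep u = 1"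
  by (auto simp: smoothstep_def max_def power2_eq_square algebra_simps)

lemma smoothstep_mono: "u \<le> v \<Longrightarrow> smoothstep u \<le> smoothstep v"
  by (rule DERIV_nonneg_imp_nondecreasing[of u v smoothstep]) (use DERIV_smoothstep smoothstep'_bounds in blast)+

lemma smoothstep_bounds: "0 \<le> smoothstep u" "smoothstep u \<le> 1"
proof -
  show "0 \<le> smoothstep u" using smoothstep_mono[of "min u 0" u] by simp
  show "smoothstep u \<le> 1" using smoothstep_mono[of u "max u 1"] by simp
qed

text \<open>A difference of shifted steps, so that sums over consecutive integer translates
  telescope and equal 1 away from the ends.\<close>

definition hat :: "real \<Rightarrow> real" where "hat u = smoothstep (u + 1) - smoothstep u"
definition hat' :: "real \<Rightarrow> real" where "hat' u = smoothstep' (u + 1) - smoothstep' u"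

lemma DERIV_hat: "(hat has_real_derivative hat' u) (at u)"
proof -
  have "((\<lambda>u. smoothstep (u + 1)) has_real_derivative smoothstep' (u + 1)) (at u)"
  proof -
    have "((\<lambda>u. u + 1) has_real_derivative 1) (at u)" by (auto intro!: derivative_eq_intros)
    from DERIV_chain2[OF DERIV_smoothstep this] show ?thesis by simp
  qed
  then show ?thesis unfolding hat_def[abs_def] hat'_def by (intro DERIV_diff DERIV_smoothstep)
qed

lemma continuous_on_hat': "continuous_on A hat'"
  unfolding hat'_def smoothstep'_def by (intro continuous_intros)

lemma hat_nonneg: "0 \<le> hat u" using smoothstep_mono[of u "u + 1"] by (simp add: hat_def)

lemma hat'_bound: "\<bar>hat' u\<bar> \<le> 2"
  unfolding hat'_def using smoothstep'_bounds[of "u + 1"] smoothstep'_bounds[of u] by (simp add: abs_le_iff)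

lemma hat_outside: "1 \<le> \<bar>u\<bar> \<Longrightarrow> hat u = 0 \<and> hat' u = 0"
  unfolding hat_def hat'_def by (auto simp: abs_if smoothstep'_outside split: if_splits)

lemma sum_hat: "(\<Sum>m\<in>{- int N..int N}. hat (t - of_int m)) = smoothstep (t + N + 1) - smoothstep (t - N)"
proof (induction N)
  case (Suc N)
  have "{- int (Suc N)..int (Suc N)} = insert (int (Suc N)) (insert (- int (Suc N)) {- int N..int N})" by auto
  then show ?case using Suc by (simp add: hat_def algebra_simps)
qed (simp add: hat_def)

lemma sum_hat_le_1: "(\<Sum>m\<in>{- int N..int N}. hat (t - of_int m)) \<le> 1"
  unfolding sum_hat using smoothstep_bounds[of "t + N + 1"] smoothstep_bounds[of "t - N"] by linarith

lemma sum_hat_eq_1: "\<bar>t\<bar> \<le> real N \<Longrightarrow> (\<Sum>m\<in>{- int N..int N}. hat (t - of_int m)) = 1"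
  unfolding sum_hat by simp

text \<open>At a given point at most two translates have nonzero derivative, and each is at most 2
  in absolute value; so the bound is independent of \<open>N\<close>.\<close>

lemma sum_hat'_le: "(\<Sum>m\<in>{- int N..int N}. \<bar>hat' (t - of_int m)\<bar>) \<le> 4"
proof -
  let ?A = "{m\<in>{- int N..int N}. \<bar>t - of_int m\<bar> < 1}"
  have "?A \<subseteq> {\<lfloor>t\<rfloor>, \<lfloor>t\<rfloor> + 1}" by (auto simp: abs_less_iff) linarith
  then have "card ?A \<le> 2" using card_mono[of "{\<lfloor>t\<rfloor>, \<lfloor>t\<rfloor> + 1}" ?A] by simp
  have "(\<Sum>m\<in>{- int N..int N}. \<bar>hat' (t - of_int m)\<bar>) = (\<Sum>m\<in>?A. \<bar>hat' (t - of_int m)\<bar>)"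
    by (rule sum.mono_neutral_right) (use hat_outside in \<open>auto simp: not_less\<close>)
  also have "\<dots> \<le> of_nat (card ?A) * 2" by (rule sum_bounded_above) (rule hat'_bound)
  also have "\<dots> \<le> 4" using \<open>card ?A \<le> 2\<close> by simp
  finally show ?thesis .
qed

text \<open>Products of one-dimensional hats on a cubic grid. The essential point is a gradient
  bound for the whole sum that depends neither on \<open>S\<close> nor on the number of grid points,
  because it is used on all scales at once.\<close>

lemma C1_partition_of_unity:
  fixes S :: "'e::euclidean_space set"
  assumes r: "0 < r" and S: "bounded S"
  obtains \<Lambda> :: "('e \<Rightarrow> int) set" and pt \<phi> \<phi>' where "finite \<Lambda>"
    "\<And>l z. (\<phi> l has_derivative \<phi>' l z) (at z)" "\<And>l v. continuous_on UNIV (\<lambda>z. \<phi>' l z v)"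
    "\<And>l z. 0 \<le> (\<phi> l z :: real)"
    "\<And>l z v. r \<le> dist z (pt l) \<Longrightarrow> \<phi> l z = 0 \<and> \<phi>' l z v = 0"
    "\<And>z. z \<in> S \<Longrightarrow> (\<Sum>l\<in>\<Lambda>. \<phi> l z) = 1"
    "\<And>z v. (\<Sum>l\<in>\<Lambda>. \<bar>\<phi>' l z v\<bar>) \<le> 4 * real DIM('e) ^ 2 / r * norm v"
proof -
  \<comment> \<open>With this mesh, coordinate distances below \<open>\<eta>\<close> add up to a
    distance below \<open>r\<close>.\<close>
  define \<eta> where "\<eta> = r / DIM('e)"
  have \<eta>: "0 < \<eta>" using r by (simp add: \<eta>_def)
  obtain R where R: "\<And>z. z \<in> S \<Longrightarrow> norm z \<le> R" using S bounded_iff by blast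
  obtain N :: nat where N: "R / \<eta> \<le> real N" using real_arch_simple by blast
  define \<Lambda> where "\<Lambda> = PiE (Basis :: 'e set) (\<lambda>_. {- int N..int N})"
  define pt where "pt l = (\<Sum>b\<in>Basis. (\<eta> * of_int (l b)) *\<^sub>R b :: 'e)" for l :: "'e \<Rightarrow> int"
  define c where "c l b z = (z \<bullet> b) / \<eta> - of_int (l b)" for l :: "'e \<Rightarrow> int" and b z
  define \<phi> where "\<phi> l z = (\<Prod>b\<in>Basis. hat (c l b z))" for l z
  define \<phi>' where "\<phi>' l z v = (\<Sum>b\<in>Basis. (hat' (c l b z) * ((v \<bullet> b) / \<eta>)) * (\<Prod>j\<in>Basis - {b}. hat (c l j z)))" for l z v
  have fin: "finite \<Lambda>" unfolding \<Lambda>_def by (intro finite_PiE) auto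
  have dhat: "((\<lambda>z. hat (c l b z)) has_derivative (\<lambda>v. hat' (c l b z) * ((v \<bullet> b) / \<eta>))) (at z)" for l b z
  proof -
    have "(hat \<circ> c l b has_derivative (\<lambda>x. hat' (c l b z) * x) \<circ> (\<lambda>v. (v \<bullet> b) / \<eta>)) (at z)"
    proof (rule diff_chain_at)
      show "(c l b has_derivative (\<lambda>v. (v \<bullet> b) / \<eta>)) (at z)"
        unfolding c_def using \<eta> by (auto intro!: derivative_eq_intros)
      show "(hat has_derivative (\<lambda>x. hat' (c l b z) * x)) (at (c l b z))"
        using DERIV_hat by (simp add: has_field_derivative_def)
    qed
    then show ?thesis by (simp add: o_def)
  qed
  have d\<phi>: "(\<phi> l has_derivative \<phi>' l z) (at z)" for l z
    unfolding \<phi>_def[abs_def] \<phi>'_def[abs_def] by (rule has_derivative_prod) (rule dhat)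
  have conthat: "continuous_on UNIV hat" using DERIV_hat by (meson DERIV_continuous_on has_field_derivative_at_within)
  have contc: "continuous_on UNIV (c l b)" for l b unfolding c_def using \<eta> by (intro continuous_intros) auto
  have cont: "continuous_on UNIV (\<lambda>z. \<phi>' l z v)" for l v
    unfolding \<phi>'_def
    by (intro continuous_intros continuous_on_compose2[OF continuous_on_hat'[of UNIV] contc] continuous_on_compose2[OF conthat contc]) auto
  have nn: "0 \<le> \<phi> l z" for l z unfolding \<phi>_def by (intro prod_nonneg) (simp add: hat_nonneg)
  have outside: "\<phi> l z = 0 \<and> \<phi>' l z v = 0" if "r \<le> dist z (pt l)" for l z v
  proof -
    have "\<exists>b\<in>Basis. 1 \<le> \<bar>c l b z\<bar>"
    proof (rule ccontr)
      assume "\<not> ?thesis"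
      then have lt: "\<bar>c l b z\<bar> < 1" if "b \<in> Basis" for b using that by (auto simp: not_le)
      have "dist z (pt l) \<le> (\<Sum>b\<in>Basis. \<bar>(z - pt l) \<bullet> b\<bar>)" unfolding dist_norm by (rule norm_le_l1)
      also have "\<dots> < (\<Sum>b\<in>(Basis::'e set). \<eta>)"
      proof (rule sum_strict_mono)
        fix b :: 'e assume b: "b \<in> Basis"
        have "(z - pt l) \<bullet> b = \<eta> * c l b z"
          using b \<eta> by (simp add: pt_def c_def inner_diff_left inner_sum_left inner_Basis if_distrib sum.If_cases field_simps cong: if_cong)
        then show "\<bar>(z - pt l) \<bullet> b\<bar> < \<eta>" using lt[OF b] \<eta> by (simp add: abs_mult)
      qed auto
      also have "\<dots> = r" by (simp add: \<eta>_def)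
      finally show False using that by simp
    qed
    then obtain b where b: "b \<in> Basis" "hat (c l b z) = 0" "hat' (c l b z) = 0" using hat_outside by blast
    have "\<phi> l z = 0" unfolding \<phi>_def using b by (intro prod_zero) auto
    moreover have "\<phi>' l z v = 0" unfolding \<phi>'_def
    proof (rule sum.neutral, rule ballI)
      fix b' :: 'e assume b': "b' \<in> Basis"
      show "(hat' (c l b' z) * ((v \<bullet> b') / \<eta>)) * (\<Prod>j\<in>Basis - {b'}. hat (c l j z)) = 0"
      proof (cases "b' = b")
        case False
        then have "(\<Prod>j\<in>Basis - {b'}. hat (c l j z)) = 0" using b by (intro prod_zero) auto
        then show ?thesis by simp
      qed (use b in simp)
    qed
    ultimately show ?thesis by blast
  qed
  have one: "(\<Sum>l\<in>\<Lambda>. \<phi> l z) = 1" if "z \<in> S" for z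
  proof -
    have "(\<Sum>l\<in>\<Lambda>. \<phi> l z) = (\<Prod>b\<in>Basis. \<Sum>m\<in>{- int N..int N}. hat ((z \<bullet> b) / \<eta> - of_int m))"
      unfolding \<phi>_def \<Lambda>_def c_def by (rule prod_sum_PiE[symmetric]) auto
    also have "\<dots> = 1"
    proof (rule prod.neutral, rule ballI, rule sum_hat_eq_1)
      fix b :: 'e assume "b \<in> Basis"
      then have "\<bar>z \<bullet> b\<bar> \<le> R" using R[OF that] Basis_le_norm order_trans by blast
      then have "\<bar>(z \<bullet> b) / \<eta>\<bar> \<le> R / \<eta>" using \<eta> by (simp add: divide_right_mono)
      then show "\<bar>(z \<bullet> b) / \<eta>\<bar> \<le> real N" using N by linarith
    qed
    finally show ?thesis .
  qed
  have grad: "(\<Sum>l\<in>\<Lambda>. \<bar>\<phi>' l z v\<bar>) \<le> 4 * real DIM('e) ^ 2 / r * norm v" for z v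
  proof -
    \<comment> \<open>A grid sum of products is a product of one-dimensional sums: the
      differentiated coordinate contributes at most 4 and every other one at most 1.\<close>
    define g where "g b j m = (if j = b then \<bar>hat' ((z \<bullet> j) / \<eta> - of_int m)\<bar> else hat ((z \<bullet> j) / \<eta> - of_int m))" for b j and m :: int
    have prod_eq: "\<bar>hat' (c l b z)\<bar> * (\<Prod>j\<in>Basis - {b}. hat (c l j z)) = (\<Prod>j\<in>Basis. g b j (l j))" if "b \<in> Basis" for l b
      using that by (simp add: prod.remove[of Basis b] g_def c_def)
    have "(\<Sum>l\<in>\<Lambda>. \<bar>\<phi>' l z v\<bar>) \<le> (\<Sum>l\<in>\<Lambda>. \<Sum>b\<in>Basis. (norm v / \<eta>) * (\<Prod>j\<in>Basis. g b j (l j)))"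
    proof (rule sum_mono)
      fix l assume "l \<in> \<Lambda>"
      have "\<bar>\<phi>' l z v\<bar> \<le> (\<Sum>b\<in>Basis. \<bar>(hat' (c l b z) * ((v \<bullet> b) / \<eta>)) * (\<Prod>j\<in>Basis - {b}. hat (c l j z))\<bar>)"
        unfolding \<phi>'_def by (rule sum_abs)
      also have "\<dots> \<le> (\<Sum>b\<in>Basis. (norm v / \<eta>) * (\<Prod>j\<in>Basis. g b j (l j)))"
      proof (rule sum_mono)
        fix b :: 'e assume b: "b \<in> Basis"
        have P: "0 \<le> (\<Prod>j\<in>Basis - {b}. hat (c l j z))" by (intro prod_nonneg) (simp add: hat_nonneg)
        have "\<bar>(hat' (c l b z) * ((v \<bullet> b) / \<eta>)) * (\<Prod>j\<in>Basis - {b}. hat (c l j z))\<bar>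
          = (\<bar>v \<bullet> b\<bar> / \<eta>) * (\<bar>hat' (c l b z)\<bar> * (\<Prod>j\<in>Basis - {b}. hat (c l j z)))"
          using P \<eta> by (simp add: abs_mult)
        also have "\<dots> \<le> (norm v / \<eta>) * (\<bar>hat' (c l b z)\<bar> * (\<Prod>j\<in>Basis - {b}. hat (c l j z)))"
          using P \<eta> Basis_le_norm[OF b] by (intro mult_right_mono divide_right_mono) auto
        finally show "\<bar>(hat' (c l b z) * ((v \<bullet> b) / \<eta>)) * (\<Prod>j\<in>Basis - {b}. hat (c l j z))\<bar>
            \<le> (norm v / \<eta>) * (\<Prod>j\<in>Basis. g b j (l j))" by (simp only: prod_eq[OF b])
      qed
      finally show "\<bar>\<phi>' l z v\<bar> \<le> (\<Sum>b\<in>Basis. (norm v / \<eta>) * (\<Prod>j\<in>Basis. g b j (l j)))" .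
    qed
    also have "\<dots> = (\<Sum>b\<in>Basis. (norm v / \<eta>) * (\<Sum>l\<in>\<Lambda>. \<Prod>j\<in>Basis. g b j (l j)))"
      by (subst sum.swap) (simp add: sum_distrib_left)
    also have "\<dots> \<le> (\<Sum>b\<in>(Basis::'e set). (norm v / \<eta>) * 4)"
    proof (intro sum_mono mult_left_mono)
      fix b :: 'e assume b: "b \<in> Basis"
      have "(\<Sum>l\<in>\<Lambda>. \<Prod>j\<in>Basis. g b j (l j)) = (\<Prod>j\<in>Basis. \<Sum>m\<in>{- int N..int N}. g b j m)"
        unfolding \<Lambda>_def by (rule prod_sum_PiE[symmetric]) auto
      also have "\<dots> = (\<Sum>m\<in>{- int N..int N}. g b b m) * (\<Prod>j\<in>Basis - {b}. \<Sum>m\<in>{- int N..int N}. g b j m)"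
        using b by (simp add: prod.remove)
      also have "\<dots> \<le> 4 * 1"
      proof (intro mult_mono prod_le_1 conjI)
        show "(\<Sum>m\<in>{- int N..int N}. g b b m) \<le> 4" unfolding g_def using sum_hat'_le by simp
        show "(\<Sum>m\<in>{- int N..int N}. g b j m) \<le> 1" if "j \<in> Basis - {b}" for j
          unfolding g_def using that sum_hat_le_1 by auto
      qed (auto intro!: prod_nonneg sum_nonneg simp: g_def hat_nonneg)
      finally show "(\<Sum>l\<in>\<Lambda>. \<Prod>j\<in>Basis. g b j (l j)) \<le> 4" by simp
    qed (use \<eta> in auto)
    also have "\<dots> = 4 * real DIM('e) ^ 2 / r * norm v" by (simp add: \<eta>_def power2_eq_square)
    finally show ?thesis .
  qed
  show ?thesis by (rule that[OF fin d\<phi> cont nn outside one grad])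
qed

lemma nearby_point:
  assumes "X \<noteq> {}" "0 < e"
  obtains x where "x \<in> X" "dist z x < infdist z X + e"
proof -
  have "(INF x\<in>X. dist z x) < infdist z X + e" using assms by (simp add: infdist_def)
  then show ?thesis using that cINF_less_iff[of X "dist z"] assms(1) by (auto simp: bdd_below_image_antimono intro: bdd_belowI2[of _ 0])
qed

text \<open>Local approximants \<open>\<tau> k x\<close> attached to points \<open>x \<in> X\<close> at the dyadic scales \<open>d k\<close> are
  averaged at each scale with a partition of unity; the averages of consecutive scales are then
  joined by cutoffs supported in \<open>{z. infdist z X < d k}\<close>.\<close>

lemma glue_local_approximants:
  fixes X :: "'e::euclidean_space set" and \<tau> :: "nat \<Rightarrow> 'e \<Rightarrow> 'e \<Rightarrow> 'b::banach"
  assumes X: "X \<noteq> {}" "bounded X" and \<delta>: "0 < \<delta>" and d_def: "d = (\<lambda>k. \<delta> / 2 ^ k)"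
    and \<tau>: "\<And>k x z. x \<in> X \<Longrightarrow> (\<tau> k x has_derivative \<tau>' k x z) (at z)"
    and \<tau>': "\<And>k x v. x \<in> X \<Longrightarrow> continuous_on UNIV (\<lambda>z. \<tau>' k x z v)"
    and near: "\<And>k x y z. \<lbrakk>x \<in> X; y \<in> X; dist z x \<le> 4 * d k; dist z y \<le> 4 * d k\<rbrakk> \<Longrightarrow> norm (\<tau> k x z - \<tau> k y z) \<le> \<epsilon> k * d k"
    and near': "\<And>k x y z v. \<lbrakk>x \<in> X; y \<in> X; dist z x \<le> 4 * d k; dist z y \<le> 4 * d k\<rbrakk> \<Longrightarrow> norm (\<tau>' k x z v - \<tau>' k y z v) \<le> \<epsilon> k * norm v"
    and step: "\<And>k x z. \<lbrakk>x \<in> X; dist z x \<le> 4 * d k\<rbrakk> \<Longrightarrow> norm (\<tau> (Suc k) x z - \<tau> k x z) \<le> \<epsilon> k * d k"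
    and step': "\<And>k x z v. \<lbrakk>x \<in> X; dist z x \<le> 4 * d k\<rbrakk> \<Longrightarrow> norm (\<tau>' (Suc k) x z v - \<tau>' k x z v) \<le> \<epsilon> k * norm v"
    and \<epsilon>: "\<And>k. 0 \<le> \<epsilon> k" "\<And>k. \<epsilon> (Suc k) \<le> \<epsilon> k / 2"
  obtains F F' C where "\<And>z. (F has_derivative F' z) (at z)" "\<And>v. continuous_on UNIV (\<lambda>z. F' z v)"
    "compact (closure {z. F z \<noteq> 0})" "\<And>x. x \<in> X \<Longrightarrow> (\<lambda>k. \<tau> k x x) \<longlonglongrightarrow> F x"
    "0 \<le> C" "\<And>k z. infdist z X < d (Suc k) \<Longrightarrow> \<exists>x\<in>X. \<forall>v. norm (F' z v - \<tau>' (Suc k) x z v) \<le> C * \<epsilon> (Suc k) * norm v"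
proof -
  have d0: "0 < d k" for k using \<delta> by (simp add: d_def)
  have dSuc: "d k = 2 * d (Suc k)" for k by (simp add: d_def)
  have dmono: "d j \<le> d i" if "i \<le> j" for i j
    unfolding d_def using \<delta> that by (simp add: divide_left_mono power_increasing)
  have dle: "d k \<le> \<delta>" for k using dmono[of 0 k] by (simp add: d_def)
  \<comment> \<open>A bounded region on which all partitions sum to 1; it contains every set where
    one of the cutoffs is nonzero.\<close>
  define S where "S = {z. infdist z X \<le> 2 * \<delta>}"
  have bS: "bounded S"
  proof -
    obtain a R where R: "\<And>x. x \<in> X \<Longrightarrow> dist a x \<le> R" using X(2) unfolding bounded_def by blast
    have "dist a z \<le> R + 2 * \<delta> + 1" if "z \<in> S" for z
    proof -
      obtain x where "x \<in> X" "dist z x < infdist z X + 1" using nearby_point[OF X(1), of 1 z] by auto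
      then show ?thesis using R[of x] dist_triangle[of a z x] that by (auto simp: S_def dist_commute)
    qed
    then show ?thesis unfolding bounded_def by blast
  qed
  \<comment> \<open>The gradient bound of the partition of unity with radius \<open>d k / 8\<close>
    is \<open>K / d k\<close>.\<close>
  define K where "K = 32 * real DIM('e) ^ 2"
  have K0: "0 \<le> K" by (simp add: K_def)
  \<comment> \<open>The conclusions are bundled in one predicate so that the partitions for all
    scales can be obtained by repeated choice.\<close>
  define P where "P k \<Lambda> pt \<phi> \<phi>' \<longleftrightarrow> finite \<Lambda> \<and>
    (\<forall>l z. (\<phi> l has_derivative \<phi>' l z) (at z)) \<and> (\<forall>l v. continuous_on UNIV (\<lambda>z. \<phi>' l z v)) \<and>
    (\<forall>l z. 0 \<le> \<phi> l z) \<and>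
    (\<forall>l z v. d k / 8 \<le> dist z (pt l) \<longrightarrow> \<phi> l z = 0 \<and> \<phi>' l z v = 0) \<and>
    (\<forall>z\<in>S. (\<Sum>l\<in>\<Lambda>. \<phi> l z) = 1) \<and>
    (\<forall>z v. (\<Sum>l\<in>\<Lambda>. \<bar>\<phi>' l z v\<bar>) \<le> K / d k * norm v)"
    for k and \<Lambda> :: "('e \<Rightarrow> int) set" and pt and \<phi> :: "('e \<Rightarrow> int) \<Rightarrow> 'e \<Rightarrow> real" and \<phi>'
  have ex: "\<forall>k. \<exists>\<Lambda> pt \<phi> \<phi>'. P k \<Lambda> pt \<phi> \<phi>'"
  proof
    fix k
    have r: "0 < d k / 8" using d0 by simp
    show "\<exists>\<Lambda> pt \<phi> \<phi>'. P k \<Lambda> pt \<phi> \<phi>'"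
    proof (rule C1_partition_of_unity[OF r bS], goal_cases)
      case (1 \<Lambda> pt \<phi> \<phi>')
      then show ?case
        by (intro exI[of _ \<Lambda>] exI[of _ pt] exI[of _ \<phi>] exI[of _ \<phi>']) (simp add: P_def K_def)
    qed
  qed
  obtain \<Lambda> where "\<forall>k. \<exists>pt \<phi> \<phi>'. P k (\<Lambda> k) pt \<phi> \<phi>'" using choice[OF ex] by blast
  from choice[OF this] obtain pt where "\<forall>k. \<exists>\<phi> \<phi>'. P k (\<Lambda> k) (pt k) \<phi> \<phi>'" by blast
  from choice[OF this] obtain \<phi> where "\<forall>k. \<exists>\<phi>'. P k (\<Lambda> k) (pt k) (\<phi> k) \<phi>'" by blast
  from choice[OF this] obtain \<phi>' where P: "\<And>k. P k (\<Lambda> k) (pt k) (\<phi> k) (\<phi>' k)" by blast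
  have fin: "\<And>k. finite (\<Lambda> k)"
    and \<phi>: "\<And>k l z. (\<phi> k l has_derivative \<phi>' k l z) (at z)" and \<phi>'c: "\<And>k l v. continuous_on UNIV (\<lambda>z. \<phi>' k l z v)"
    and \<phi>0: "\<And>k l z. 0 \<le> \<phi> k l z"
    and out: "\<And>k l z v. d k / 8 \<le> dist z (pt k l) \<Longrightarrow> \<phi> k l z = 0 \<and> \<phi>' k l z v = 0"
    and one: "\<And>k z. z \<in> S \<Longrightarrow> (\<Sum>l\<in>\<Lambda> k. \<phi> k l z) = 1"
    and grad: "\<And>k z v. (\<Sum>l\<in>\<Lambda> k. \<bar>\<phi>' k l z v\<bar>) \<le> K / d k * norm v"
    using P unfolding P_def by blast+
  have \<phi>c: "continuous_on UNIV (\<phi> k l)" for k l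
    using \<phi> has_derivative_continuous_on by (metis has_derivative_at_withinI)
  have \<tau>c: "continuous_on UNIV (\<tau> k x)" if "x \<in> X" for k x
    using \<tau>[OF that] has_derivative_continuous_on by (metis has_derivative_at_withinI)
  \<comment> \<open>Differentiating the constant sum 1 on an open set. This allows a common value to
    be subtracted from all local approximants in the derivative of an average.\<close>
  have grad0: "(\<Sum>l\<in>\<Lambda> k. \<phi>' k l z v) = 0" if z: "infdist z X < 2 * \<delta>" for k z v
  proof -
    have op: "open {z. infdist z X < 2 * \<delta>}"
      by (intro open_Collect_less continuous_intros)
    have "((\<lambda>z. \<Sum>l\<in>\<Lambda> k. \<phi> k l z) has_derivative (\<lambda>v. \<Sum>l\<in>\<Lambda> k. \<phi>' k l z v)) (at z)"
      by (intro has_derivative_sum \<phi>)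
    moreover have "((\<lambda>z. \<Sum>l\<in>\<Lambda> k. \<phi> k l z) has_derivative (\<lambda>v. 0)) (at z)"
      by (rule has_derivative_transform_within_open[OF has_derivative_const[of 1] op]) (use z one in \<open>auto simp: S_def\<close>)
    ultimately show ?thesis by (metis has_derivative_unique)
  qed
  \<comment> \<open>Grid centres need not lie in \<open>X\<close>, and a nearest point of
    \<open>X\<close> need not exist, so each centre is replaced by a point of \<open>X\<close> that
    is nearest up to \<open>d k\<close>.\<close>
  have "\<forall>k l. \<exists>a\<in>X. dist (pt k l) a < infdist (pt k l) X + d k"
    using nearby_point[OF X(1) d0] by metis
  then obtain a where aX: "\<And>k l. a k l \<in> X" and a: "\<And>k l. dist (pt k l) (a k l) < infdist (pt k l) X + d k" by metis
  define G where "G k z = (\<Sum>l\<in>\<Lambda> k. \<phi> k l z *\<^sub>R \<tau> k (a k l) z)" for k z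
  define G' where "G' k z v = (\<Sum>l\<in>\<Lambda> k. \<phi> k l z *\<^sub>R \<tau>' k (a k l) z v + \<phi>' k l z v *\<^sub>R \<tau> k (a k l) z)" for k z v
  \<comment> \<open>A threshold between 1/2 and 1: as the supports have radius
    \<open>d k / 8\<close>, the selected functions sum to 1 within \<open>d k / 2\<close> of
    \<open>X\<close> and to 0 at distance \<open>d k\<close> or more.\<close>
  define A where "A k = {l\<in>\<Lambda> k. infdist (pt k l) X < 3/4 * d k}" for k
  define \<psi> where "\<psi> k z = (\<Sum>l\<in>A k. \<phi> k l z)" for k z
  define \<psi>' where "\<psi>' k z v = (\<Sum>l\<in>A k. \<phi>' k l z v)" for k z v
  have finA: "finite (A k)" for k using fin by (simp add: A_def)
  have dG: "(G k has_derivative G' k z) (at z)" for k z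
    unfolding G_def[abs_def] G'_def[abs_def] by (intro has_derivative_sum has_derivative_scaleR \<phi> \<tau> aX)
  have d\<psi>: "(\<psi> k has_derivative \<psi>' k z) (at z)" for k z
    unfolding \<psi>_def[abs_def] \<psi>'_def[abs_def] by (intro has_derivative_sum \<phi>)
  have cG: "continuous_on UNIV (G k)" "continuous_on UNIV (\<lambda>z. G' k z v)" "continuous_on UNIV (\<psi> k)" "continuous_on UNIV (\<lambda>z. \<psi>' k z v)" for k v
    unfolding G_def G'_def \<psi>_def \<psi>'_def by (intro continuous_intros \<phi>c \<phi>'c \<tau>c[OF aX] \<tau>'[OF aX])+
  \<comment> \<open>The distances add up to less than \<open>(1/8 + 2 + 1/8 + 1) * d k\<close>,
    which explains the radius \<open>4 * d k\<close> in the hypotheses.\<close>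
  have near_a: "dist z (a k l) \<le> 4 * d k" if "infdist z X < 2 * d k" "dist z (pt k l) < d k / 8" for k l z
  proof -
    have "infdist (pt k l) X \<le> infdist z X + dist (pt k l) z" by (rule infdist_triangle)
    moreover have "dist z (a k l) \<le> dist z (pt k l) + dist (pt k l) (a k l)" by (rule dist_triangle)
    ultimately show ?thesis using a[of k l] that d0[of k] by (simp add: dist_commute)
  qed
  have G_near: "norm (G k z - \<tau> k x z) \<le> \<epsilon> k * d k"
    and G'_near: "norm (G' k z v - \<tau>' k x z v) \<le> (1 + K) * \<epsilon> k * norm v"
    if z: "infdist z X < 2 * d k" and x: "x \<in> X" "dist z x \<le> 4 * d k" for k z x v
  proof -
    have z2: "infdist z X < 2 * \<delta>" using z dle[of k] by simp
    then have zS: "z \<in> S" by (simp add: S_def)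
    have t: "norm (\<phi> k l z *\<^sub>R (\<tau> k (a k l) z - \<tau> k x z)) \<le> \<phi> k l z * (\<epsilon> k * d k)"
      "norm (\<phi> k l z *\<^sub>R (\<tau>' k (a k l) z v - \<tau>' k x z v)) \<le> \<phi> k l z * (\<epsilon> k * norm v)"
      "norm (\<phi>' k l z v *\<^sub>R (\<tau> k (a k l) z - \<tau> k x z)) \<le> \<bar>\<phi>' k l z v\<bar> * (\<epsilon> k * d k)" for l
    proof -
      have "norm (\<phi> k l z *\<^sub>R (\<tau> k (a k l) z - \<tau> k x z)) \<le> \<phi> k l z * (\<epsilon> k * d k) \<and>
      norm (\<phi> k l z *\<^sub>R (\<tau>' k (a k l) z v - \<tau>' k x z v)) \<le> \<phi> k l z * (\<epsilon> k * norm v) \<and>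
      norm (\<phi>' k l z v *\<^sub>R (\<tau> k (a k l) z - \<tau> k x z)) \<le> \<bar>\<phi>' k l z v\<bar> * (\<epsilon> k * d k)"
      proof (cases "d k / 8 \<le> dist z (pt k l)")
        case True
        then show ?thesis using out by simp
      next
        case False
        then have "dist z (a k l) \<le> 4 * d k" using near_a[OF z] by simp
        then have "norm (\<tau> k (a k l) z - \<tau> k x z) \<le> \<epsilon> k * d k" "norm (\<tau>' k (a k l) z v - \<tau>' k x z v) \<le> \<epsilon> k * norm v"
          using near near' aX x by blast+
        then show ?thesis using \<phi>0 by (simp add: mult_left_mono)
      qed
      then show "norm (\<phi> k l z *\<^sub>R (\<tau> k (a k l) z - \<tau> k x z)) \<le> \<phi> k l z * (\<epsilon> k * d k)"
        "norm (\<phi> k l z *\<^sub>R (\<tau>' k (a k l) z v - \<tau>' k x z v)) \<le> \<phi> k l z * (\<epsilon> k * norm v)"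
        "norm (\<phi>' k l z v *\<^sub>R (\<tau> k (a k l) z - \<tau> k x z)) \<le> \<bar>\<phi>' k l z v\<bar> * (\<epsilon> k * d k)" by blast+
    qed
    have "G k z - \<tau> k x z = G k z - (\<Sum>l\<in>\<Lambda> k. \<phi> k l z) *\<^sub>R \<tau> k x z" using one[OF zS] by simp
    also have "\<dots> = (\<Sum>l\<in>\<Lambda> k. \<phi> k l z *\<^sub>R (\<tau> k (a k l) z - \<tau> k x z))"
      by (simp add: G_def scaleR_left.sum scaleR_diff_right sum_subtractf)
    also have "norm \<dots> \<le> (\<Sum>l\<in>\<Lambda> k. \<phi> k l z * (\<epsilon> k * d k))" by (rule sum_norm_le) (rule t)
    also have "\<dots> = \<epsilon> k * d k" using one[OF zS, of k] by (simp add: sum_distrib_right[symmetric])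
    finally show "norm (G k z - \<tau> k x z) \<le> \<epsilon> k * d k" .
    \<comment> \<open>The gradients of the partition have size \<open>K / d k\<close>, but after the
      subtraction they multiply differences of size \<open>\<epsilon> k * d k\<close>; so both sums
      are of order \<open>\<epsilon> k\<close>.\<close>
    have "G' k z v - \<tau>' k x z v = G' k z v - (\<Sum>l\<in>\<Lambda> k. \<phi> k l z) *\<^sub>R \<tau>' k x z v - (\<Sum>l\<in>\<Lambda> k. \<phi>' k l z v) *\<^sub>R \<tau> k x z"
      using one[OF zS, of k] grad0[OF z2] by simp
    also have "\<dots> = (\<Sum>l\<in>\<Lambda> k. \<phi> k l z *\<^sub>R (\<tau>' k (a k l) z v - \<tau>' k x z v)) + (\<Sum>l\<in>\<Lambda> k. \<phi>' k l z v *\<^sub>R (\<tau> k (a k l) z - \<tau> k x z))"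
      by (simp add: G'_def scaleR_left.sum scaleR_diff_right sum_subtractf sum.distrib)
    finally have eq: "G' k z v - \<tau>' k x z v = (\<Sum>l\<in>\<Lambda> k. \<phi> k l z *\<^sub>R (\<tau>' k (a k l) z v - \<tau>' k x z v)) + (\<Sum>l\<in>\<Lambda> k. \<phi>' k l z v *\<^sub>R (\<tau> k (a k l) z - \<tau> k x z))" .
    have "norm (G' k z v - \<tau>' k x z v) \<le> (\<Sum>l\<in>\<Lambda> k. \<phi> k l z * (\<epsilon> k * norm v)) + (\<Sum>l\<in>\<Lambda> k. \<bar>\<phi>' k l z v\<bar> * (\<epsilon> k * d k))"
      unfolding eq by (intro norm_triangle_mono sum_norm_le t)
    also have "\<dots> = \<epsilon> k * norm v + (\<Sum>l\<in>\<Lambda> k. \<bar>\<phi>' k l z v\<bar>) * (\<epsilon> k * d k)"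
      using one[OF zS, of k] by (simp add: sum_distrib_right[symmetric])
    also have "\<dots> \<le> \<epsilon> k * norm v + (K / d k * norm v) * (\<epsilon> k * d k)"
      using \<epsilon>(1)[of k] d0[of k] by (intro add_left_mono mult_right_mono grad) auto
    also have "\<dots> = (1 + K) * \<epsilon> k * norm v" using d0[of k] by (simp add: field_simps)
    finally show "norm (G' k z v - \<tau>' k x z v) \<le> (1 + K) * \<epsilon> k * norm v" .
  qed
  \<comment> \<open>Both averages are compared with the local approximants at one point
    \<open>x\<close> of \<open>X\<close> that is close to \<open>z\<close> on either scale.\<close>
  have consec: "norm (G (Suc k) z - G k z) \<le> 3 * \<epsilon> k * d k"
    and consec': "norm (G' (Suc k) z v - G' k z v) \<le> 3 * (1 + K) * \<epsilon> k * norm v"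
    if z: "infdist z X < d k" for k z v
  proof -
    obtain x where x: "x \<in> X" "dist z x < infdist z X + d k" using nearby_point[OF X(1) d0] .
    have xs: "dist z x \<le> 4 * d k" "dist z x \<le> 4 * d (Suc k)" using x(2) z dSuc[of k] d0[of k] by auto
    have z': "infdist z X < 2 * d (Suc k)" "infdist z X < 2 * d k" using z dSuc[of k] d0[of k] by auto
    have es: "\<epsilon> (Suc k) \<le> \<epsilon> k" using \<epsilon>(1)[of k] \<epsilon>(2)[of k] by simp
    have "norm (G (Suc k) z - G k z) \<le> norm (G (Suc k) z - \<tau> (Suc k) x z) + norm (\<tau> (Suc k) x z - \<tau> k x z) + norm (G k z - \<tau> k x z)"
      using norm_triangle_ineq4[of "G (Suc k) z - \<tau> (Suc k) x z + (\<tau> (Suc k) x z - \<tau> k x z)" "G k z - \<tau> k x z"]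
        norm_triangle_ineq[of "G (Suc k) z - \<tau> (Suc k) x z" "\<tau> (Suc k) x z - \<tau> k x z"] by simp
    also have "\<dots> \<le> \<epsilon> (Suc k) * d (Suc k) + \<epsilon> k * d k + \<epsilon> k * d k"
      by (intro add_mono G_near z' x xs step)
    also have "\<dots> \<le> \<epsilon> k * d k + \<epsilon> k * d k + \<epsilon> k * d k"
      using es \<epsilon>(1) d0[of "Suc k"] dmono[of k "Suc k"] by (intro add_mono mult_mono) auto
    finally show "norm (G (Suc k) z - G k z) \<le> 3 * \<epsilon> k * d k" by simp
    have "norm (G' (Suc k) z v - G' k z v) \<le> norm (G' (Suc k) z v - \<tau>' (Suc k) x z v) + norm (\<tau>' (Suc k) x z v - \<tau>' k x z v) + norm (G' k z v - \<tau>' k x z v)"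
      using norm_triangle_ineq4[of "G' (Suc k) z v - \<tau>' (Suc k) x z v + (\<tau>' (Suc k) x z v - \<tau>' k x z v)" "G' k z v - \<tau>' k x z v"]
        norm_triangle_ineq[of "G' (Suc k) z v - \<tau>' (Suc k) x z v" "\<tau>' (Suc k) x z v - \<tau>' k x z v"] by simp
    also have "\<dots> \<le> (1 + K) * \<epsilon> (Suc k) * norm v + \<epsilon> k * norm v + (1 + K) * \<epsilon> k * norm v"
      by (intro add_mono G'_near z' x xs step')
    also have "\<dots> \<le> (1 + K) * \<epsilon> k * norm v + (1 + K) * \<epsilon> k * norm v + (1 + K) * \<epsilon> k * norm v"
      using es \<epsilon>(1)[of k] K0 mult_right_mono[of 1 "1 + K" "\<epsilon> k"] by (intro add_mono mult_right_mono mult_left_mono) auto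
    finally show "norm (G' (Suc k) z v - G' k z v) \<le> 3 * (1 + K) * \<epsilon> k * norm v" by (simp add: algebra_simps)
  qed
  have \<psi>out: "\<psi> k z = 0 \<and> \<psi>' k z v = 0" if "d k \<le> infdist z X" for k z v
  proof -
    have "\<phi> k l z = 0 \<and> \<phi>' k l z v = 0" if "l \<in> A k" for l
    proof (rule out)
      have "infdist z X \<le> infdist (pt k l) X + dist z (pt k l)" by (rule infdist_triangle)
      then show "d k / 8 \<le> dist z (pt k l)" using \<open>d k \<le> infdist z X\<close> that d0[of k] by (simp add: A_def)
    qed
    then show ?thesis by (simp add: \<psi>_def \<psi>'_def)
  qed
  have \<psi>in: "\<psi> k z = 1 \<and> \<psi>' k z v = 0" if z: "infdist z X < d (Suc k)" for k z v
  proof -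
    have z2: "infdist z X < 2 * \<delta>" using z dle[of "Suc k"] \<delta> by simp
    have "\<phi> k l z = 0 \<and> \<phi>' k l z v = 0" if "l \<in> \<Lambda> k - A k" for l
    proof (rule out)
      have "infdist (pt k l) X \<le> infdist z X + dist (pt k l) z" by (rule infdist_triangle)
      then show "d k / 8 \<le> dist z (pt k l)" using z that d0[of k] dSuc[of k] by (auto simp: A_def dist_commute)
    qed
    then have "(\<Sum>l\<in>\<Lambda> k. \<phi> k l z) = \<psi> k z" "(\<Sum>l\<in>\<Lambda> k. \<phi>' k l z v) = \<psi>' k z v"
      unfolding \<psi>_def \<psi>'_def by (intro sum.mono_neutral_right fin; auto simp: A_def)+
    then show ?thesis using one[of z k] grad0[OF z2, of k v] z2 by (simp add: S_def)
  qed
  have \<psi>1: "0 \<le> \<psi> k z \<and> \<psi> k z \<le> 1" if "infdist z X < d k" for k z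
  proof -
    have "\<psi> k z \<le> (\<Sum>l\<in>\<Lambda> k. \<phi> k l z)" unfolding \<psi>_def by (rule sum_mono2) (auto simp: A_def fin \<phi>0)
    also have "\<dots> = 1" using that dle[of k] \<delta> by (intro one) (simp add: S_def)
    finally show ?thesis unfolding \<psi>_def by (auto intro!: sum_nonneg simp: \<phi>0)
  qed
  have \<psi>grad: "\<bar>\<psi>' k z v\<bar> \<le> K / d k * norm v" for k z v
  proof -
    have "\<bar>\<psi>' k z v\<bar> \<le> (\<Sum>l\<in>A k. \<bar>\<phi>' k l z v\<bar>)" unfolding \<psi>'_def by (rule sum_abs)
    also have "\<dots> \<le> (\<Sum>l\<in>\<Lambda> k. \<bar>\<phi>' k l z v\<bar>)" by (rule sum_mono2) (auto simp: A_def fin)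
    finally show ?thesis using grad[of k z v] by linarith
  qed
  \<comment> \<open>The correction from scale \<open>k\<close> to scale \<open>k + 1\<close>,
    switched on only near \<open>X\<close>.\<close>
  define T where "T k z = \<psi> k z *\<^sub>R (G (Suc k) z - G k z)" for k z
  define T' where "T' k z v = \<psi> k z *\<^sub>R (G' (Suc k) z v - G' k z v) + \<psi>' k z v *\<^sub>R (G (Suc k) z - G k z)" for k z v
  \<comment> \<open>\<open>3 * (1 + K)\<close> comes from the derivative of the difference of
    averages and \<open>3 * K\<close> from the gradient of the cutoff.\<close>
  define B where "B = 3 + 6 * K"
  have B0: "0 \<le> B" using K0 by (simp add: B_def)
  have dT: "(T k has_derivative T' k z) (at z)" for k z
    unfolding T_def[abs_def] T'_def[abs_def] by (intro has_derivative_scaleR has_derivative_diff dG d\<psi>)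
  have cT': "continuous_on UNIV (\<lambda>z. T' k z v)" for k v
    unfolding T'_def by (intro continuous_intros cG)
  have Tb: "norm (T k z) \<le> B * \<epsilon> k * d k" and T'b: "norm (T' k z v) \<le> B * \<epsilon> k * norm v" for k z v
  proof -
    have "norm (T k z) \<le> B * \<epsilon> k * d k \<and> norm (T' k z v) \<le> B * \<epsilon> k * norm v"
    proof (cases "infdist z X < d k")
      case False
      then show ?thesis using \<psi>out[of k z v] B0 \<epsilon>(1)[of k] d0[of k] by (simp add: T_def T'_def)
    next
      case True
      have "norm (T k z) \<le> 1 * (3 * \<epsilon> k * d k)"
        unfolding T_def norm_scaleR using \<psi>1[OF True] consec[OF True] by (intro mult_mono) auto
      also have "\<dots> \<le> B * \<epsilon> k * d k" using K0 \<epsilon>(1)[of k] d0[of k] by (simp add: B_def mult_right_mono)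
      finally have 1: "norm (T k z) \<le> B * \<epsilon> k * d k" .
      have "norm (T' k z v) \<le> \<bar>\<psi> k z\<bar> * norm (G' (Suc k) z v - G' k z v) + \<bar>\<psi>' k z v\<bar> * norm (G (Suc k) z - G k z)"
        unfolding T'_def by (metis norm_scaleR norm_triangle_ineq)
      also have "\<dots> \<le> 1 * (3 * (1 + K) * \<epsilon> k * norm v) + (K / d k * norm v) * (3 * \<epsilon> k * d k)"
        using \<psi>1[OF True] consec[OF True] consec'[OF True] \<psi>grad K0 d0[of k]
        by (intro add_mono mult_mono) auto
      also have "\<dots> = B * \<epsilon> k * norm v" using d0[of k] by (simp add: B_def field_simps)
      finally show ?thesis using 1 by blast
    qed
    then show "norm (T k z) \<le> B * \<epsilon> k * d k" "norm (T' k z v) \<le> B * \<epsilon> k * norm v" by blast+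
  qed
  have \<epsilon>geo: "\<epsilon> (i + k) \<le> \<epsilon> k * (1/2) ^ i" for i k
    by (induction i) (use \<epsilon>(2) in \<open>auto intro: order_trans\<close>)
  have summ: "summable (\<lambda>i. c * \<epsilon> (i + k))" and tail: "(\<Sum>i. c * \<epsilon> (i + k)) \<le> 2 * c * \<epsilon> k" if "0 \<le> c" for c k
  proof -
    have geo: "(\<lambda>i. c * (\<epsilon> k * (1/2) ^ i)) sums (c * (\<epsilon> k * 2))"
      using geometric_sums[of "1/2 :: real"] by (intro sums_mult) auto
    have le: "c * \<epsilon> (i + k) \<le> c * (\<epsilon> k * (1/2) ^ i)" for i using \<epsilon>geo that by (intro mult_left_mono)
    show s: "summable (\<lambda>i. c * \<epsilon> (i + k))"
      by (rule summable_comparison_test[OF _ sums_summable[OF geo]])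
        (use le \<epsilon>(1) that in \<open>auto intro!: exI[of _ 0]\<close>)
    show "(\<Sum>i. c * \<epsilon> (i + k)) \<le> 2 * c * \<epsilon> k"
      using suminf_le[OF le s sums_summable[OF geo]] sums_unique[OF geo] by simp
  qed
  have sT: "summable (\<lambda>i. T (i + k) z)" and sT': "summable (\<lambda>i. T' (i + k) z v)"
    and tT: "norm (\<Sum>i. T (i + k) z) \<le> 2 * (B * \<delta>) * \<epsilon> k" and tT': "norm (\<Sum>i. T' (i + k) z v) \<le> 2 * B * \<epsilon> k * norm v" for k z v
  proof -
    have b1: "norm (T (i + k) z) \<le> (B * \<delta>) * \<epsilon> (i + k)" for i
      using Tb[of "i + k" z] mult_left_mono[OF dle[of "i + k"], of "B * \<epsilon> (i + k)"] B0 \<epsilon>(1)[of "i + k"] by (simp add: mult_ac)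
    have b2: "norm (T' (i + k) z v) \<le> (B * norm v) * \<epsilon> (i + k)" for i
      using T'b[of "i + k" z v] by (simp add: mult_ac)
    have c: "0 \<le> B * \<delta>" "0 \<le> B * norm v" using B0 \<delta> by auto
    show "summable (\<lambda>i. T (i + k) z)" "summable (\<lambda>i. T' (i + k) z v)"
      using summable_comparison_test'[OF summ[OF c(1)] b1] summable_comparison_test'[OF summ[OF c(2)] b2] by blast+
    have "norm (\<Sum>i. T (i + k) z) \<le> (\<Sum>i. (B * \<delta>) * \<epsilon> (i + k))" by (rule norm_suminf_le[OF b1 summ[OF c(1)]])
    then show "norm (\<Sum>i. T (i + k) z) \<le> 2 * (B * \<delta>) * \<epsilon> k" using tail[OF c(1), of k] by simp
    have "norm (\<Sum>i. T' (i + k) z v) \<le> (\<Sum>i. (B * norm v) * \<epsilon> (i + k))" by (rule norm_suminf_le[OF b2 summ[OF c(2)]])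
    then show "norm (\<Sum>i. T' (i + k) z v) \<le> 2 * B * \<epsilon> k * norm v" using tail[OF c(2), of k] by (simp add: mult_ac)
  qed
  have \<epsilon>lim: "\<epsilon> \<longlonglongrightarrow> 0" using summable_LIMSEQ_zero[OF summ[of 1 0]] by simp
  \<comment> \<open>A telescoping series: for \<open>0 < k\<close>, within \<open>d k\<close> of
    \<open>X\<close> the first \<open>k\<close> cutoffs equal 1, so the partial sum is
    \<open>G k\<close> and the tail is of order \<open>\<epsilon> k\<close>.\<close>
  define F where "F z = \<psi> 0 z *\<^sub>R G 0 z + (\<Sum>i. T i z)" for z
  define F' where "F' z v = (\<psi> 0 z *\<^sub>R G' 0 z v + \<psi>' 0 z v *\<^sub>R G 0 z) + (\<Sum>i. T' i z v)" for z v
  have split: "(\<Sum>i. T i z) = (\<Sum>i<k. T i z) + (\<Sum>i. T (i + k) z)" "(\<Sum>i. T' i z v) = (\<Sum>i<k. T' i z v) + (\<Sum>i. T' (i + k) z v)" for k z v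
    using suminf_split_initial_segment[of "\<lambda>i. T i z" k] suminf_split_initial_segment[of "\<lambda>i. T' i z v" k] sT[of 0 z] sT'[of 0 z v]
    by (simp_all add: add.commute)
  have dF: "(F has_derivative F' z) (at z)" for z
  proof -
    have "\<exists>g. \<forall>x\<in>UNIV. (\<lambda>n. T n x) sums (g x) \<and> (g has_derivative (\<lambda>v. \<Sum>i. T' i x v)) (at x within UNIV)"
    proof (rule has_derivative_series[where f'="T'" and x="z" and l="\<Sum>i. T i z"])
      show "\<forall>\<^sub>F n in sequentially. \<forall>x\<in>UNIV. \<forall>h. norm ((\<Sum>i<n. T' i x h) - (\<Sum>i. T' i x h)) \<le> e * norm h"
        if e: "0 < e" for e
      proof -
        have "(\<lambda>n. 2 * B * \<epsilon> n) \<longlonglongrightarrow> 2 * B * 0" by (intro tendsto_intros \<epsilon>lim)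
        then have "\<forall>\<^sub>F n in sequentially. 2 * B * \<epsilon> n < e" using e by (intro order_tendstoD) auto
        then show ?thesis
        proof eventually_elim
          case (elim n)
          show ?case
          proof (intro ballI allI)
            fix x h
            have "norm ((\<Sum>i<n. T' i x h) - (\<Sum>i. T' i x h)) = norm (\<Sum>i. T' (i + n) x h)"
              by (simp add: split(2)[of x h n])
            also have "\<dots> \<le> 2 * B * \<epsilon> n * norm h" by (rule tT')
            also have "\<dots> \<le> e * norm h" using elim by (intro mult_right_mono) auto
            finally show "norm ((\<Sum>i<n. T' i x h) - (\<Sum>i. T' i x h)) \<le> e * norm h" .
          qed
        qed
      qed
    qed (use dT sT[of 0] in \<open>auto simp: summable_sums\<close>)
    then obtain g where g: "\<And>x. (\<lambda>n. T n x) sums g x" "\<And>x. (g has_derivative (\<lambda>v. \<Sum>i. T' i x v)) (at x)" by auto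
    then have "g = (\<lambda>z. \<Sum>i. T i z)" using sums_unique by blast
    then show ?thesis
      unfolding F_def[abs_def] F'_def[abs_def] using g(2) by (intro has_derivative_add has_derivative_scaleR d\<psi> dG) auto
  qed
  have cF': "continuous_on UNIV (\<lambda>z. F' z v)" for v
  proof -
    have "uniform_limit UNIV (\<lambda>n z. \<Sum>i<n. T' i z v) (\<lambda>z. \<Sum>i. T' i z v) sequentially"
    proof (rule Weierstrass_m_test)
      show "norm (T' n z v) \<le> (B * norm v) * \<epsilon> (n + 0)" for n z using T'b[of n z v] by (simp add: mult_ac)
      show "summable (\<lambda>n. (B * norm v) * \<epsilon> (n + 0))" by (rule summ) (use B0 in simp)
    qed
    then have "continuous_on UNIV (\<lambda>z. \<Sum>i. T' i z v)"
      by (rule uniform_limit_theorem[rotated]) (auto intro!: always_eventually continuous_on_sum cT')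
    then show ?thesis unfolding F'_def by (intro continuous_intros cG)
  qed
  have cpt: "compact (closure {z. F z \<noteq> 0})"
  proof -
    have "{z. F z \<noteq> 0} \<subseteq> S"
    proof (rule subsetI, rule ccontr)
      fix z assume z: "z \<in> {z. F z \<noteq> 0}" "z \<notin> S"
      then have "d k \<le> infdist z X" for k using dle[of k] \<delta> by (simp add: S_def)
      then have "F z = 0" using \<psi>out by (simp add: F_def T_def)
      then show False using z by simp
    qed
    then show ?thesis using bS by (meson bounded_closure bounded_subset closed_closure compact_eq_bounded_closed)
  qed
  \<comment> \<open>The case \<open>k = 0\<close> is excluded because \<open>\<psi> 0\<close> need
    not be 1 within \<open>d 0\<close> of \<open>X\<close>; hence the shifted index in the last
    conclusion.\<close>
  have partial_sum: "\<psi> 0 z *\<^sub>R G 0 z + (\<Sum>i<k. T i z) = G k z \<and>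
      (\<psi> 0 z *\<^sub>R G' 0 z v + \<psi>' 0 z v *\<^sub>R G 0 z) + (\<Sum>i<k. T' i z v) = G' k z v" if z: "infdist z X < d k" "0 < k" for k z v
  proof -
    have in': "\<psi> i z = 1 \<and> \<psi>' i z v = 0" if "i < k" for i
      using \<psi>in[of z i v] z dmono[of "Suc i" k] that by simp
    have "(\<Sum>i<k. T i z) = (\<Sum>i<k. G (Suc i) z - G i z)" "(\<Sum>i<k. T' i z v) = (\<Sum>i<k. G' (Suc i) z v - G' i z v)"
      using in' by (auto simp: T_def T'_def intro!: sum.cong)
    then show ?thesis using in'[OF z(2)] sum_lessThan_telescope[of "\<lambda>i. G i z" k] sum_lessThan_telescope[of "\<lambda>i. G' i z v" k] by simp
  qed
  have lim: "(\<lambda>k. \<tau> k x x) \<longlonglongrightarrow> F x" if x: "x \<in> X" for x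
  proof -
    have "norm (\<tau> k x x - F x) \<le> (\<delta> + 2 * (B * \<delta>)) * \<epsilon> k" if "0 < k" for k
    proof -
      have z: "infdist x X < d k" using x d0[of k] by simp
      have "F x - \<tau> k x x = (G k x - \<tau> k x x) + (\<Sum>i. T (i + k) x)"
        unfolding F_def split(1)[of x k] using partial_sum[OF z that] by (simp add: add.assoc[symmetric])
      then have "norm (F x - \<tau> k x x) \<le> norm (G k x - \<tau> k x x) + norm (\<Sum>i. T (i + k) x)"
        by (simp only: norm_triangle_ineq)
      also have "\<dots> \<le> \<epsilon> k * d k + 2 * (B * \<delta>) * \<epsilon> k"
        using z d0[of k] x by (intro add_mono G_near tT) auto
      also have "\<dots> \<le> \<epsilon> k * \<delta> + 2 * (B * \<delta>) * \<epsilon> k" using dle \<epsilon>(1) by (intro add_right_mono mult_left_mono)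
      finally show ?thesis by (simp add: norm_minus_commute algebra_simps)
    qed
    then have "\<forall>\<^sub>F k in sequentially. norm (\<tau> k x x - F x) \<le> (\<delta> + 2 * (B * \<delta>)) * \<epsilon> k"
      using eventually_gt_at_top[of 0] by (rule eventually_mono[rotated])
    moreover have "(\<lambda>k. (\<delta> + 2 * (B * \<delta>)) * \<epsilon> k) \<longlonglongrightarrow> 0" using tendsto_mult_right[OF \<epsilon>lim] by (auto intro: tendsto_eq_intros \<epsilon>lim)
    ultimately have "(\<lambda>k. \<tau> k x x - F x) \<longlonglongrightarrow> 0" by (rule Lim_null_comparison)
    then show ?thesis by (simp add: LIM_zero_iff)
  qed
  have approx: "\<exists>x\<in>X. \<forall>v. norm (F' z v - \<tau>' (Suc k) x z v) \<le> (1 + K + 2 * B) * \<epsilon> (Suc k) * norm v"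
    if z: "infdist z X < d (Suc k)" for k z
  proof -
    obtain x where x: "x \<in> X" "dist z x < infdist z X + d (Suc k)" using nearby_point[OF X(1) d0] .
    have "norm (F' z v - \<tau>' (Suc k) x z v) \<le> (1 + K + 2 * B) * \<epsilon> (Suc k) * norm v" for v
    proof -
      have "F' z v - \<tau>' (Suc k) x z v = (G' (Suc k) z v - \<tau>' (Suc k) x z v) + (\<Sum>i. T' (i + Suc k) z v)"
        unfolding F'_def split(2)[of z v "Suc k"] using partial_sum[OF z, of v] by (simp add: add.assoc[symmetric])
      then have "norm (F' z v - \<tau>' (Suc k) x z v) \<le> norm (G' (Suc k) z v - \<tau>' (Suc k) x z v) + norm (\<Sum>i. T' (i + Suc k) z v)"
        by (metis norm_triangle_ineq)
      also have "\<dots> \<le> (1 + K) * \<epsilon> (Suc k) * norm v + 2 * B * \<epsilon> (Suc k) * norm v"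
        using z x d0[of "Suc k"] by (intro add_mono G'_near tT') auto
      finally show ?thesis by (simp add: algebra_simps)
    qed
    then show ?thesis using x(1) by blast
  qed
  show ?thesis
  proof (rule that[OF dF cF' cpt lim _ approx])
    show "0 \<le> 1 + K + 2 * B" using K0 B0 by linarith
  qed
qed

section \<open>Extensions of Beurling functions\<close>

lemma weight_sequence_pos:
  assumes "weight_sequence M"
  shows "0 < M k"
proof -
  have mu: "1 \<le> mu M (Suc k)" for k
    by (induction k) (use assms in \<open>auto simp: weight_sequence_def intro: order_trans\<close>)
  show "0 < M k"
  proof (induction k)
    case 0 then show ?case using assms by (simp add: weight_sequence_def)
  next
    case (Suc k)
    then show ?case using mu[of k] by (simp add: mu_def)
  qed
qed

lemma small_m_pos: "weight_sequence M \<Longrightarrow> 0 < small_m M k"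
  by (simp add: small_m_def weight_sequence_pos)

lemma incseq_small_m_quotient:
  assumes "weight_sequence M" "strongly_log_convex M"
  shows "incseq (\<lambda>k. small_m M (Suc k) / small_m M k)"
proof (rule incseq_SucI)
  fix k
  have eq: "small_m M (Suc k) / small_m M k = mu M (Suc k) / real (Suc k)" for k
    by (simp add: small_m_def mu_def fact_Suc del: of_nat_Suc)
  show "small_m M (Suc k) / small_m M k \<le> small_m M (Suc (Suc k)) / small_m M (Suc k)"
    unfolding eq using assms(2) unfolding strongly_log_convex_def by (metis le_add1 plus_1_eq_Suc)
qed

lemma h_fun_le:
  assumes "\<And>k. 0 < m k" "0 < t"
  shows "h_fun m t \<le> m k * t ^ k"
proof -
  have "(INF k. m k * t ^ k) \<le> m k * t ^ k"
    by (rule cINF_lower[OF bdd_belowI2[of _ 0]]) (use assms in \<open>auto simp: less_imp_le\<close>)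
  then show ?thesis using assms(2) by (simp add: h_fun_def)
qed

lemma h_fun_ge:
  assumes "0 < t" "\<And>k. c \<le> m k * t ^ k"
  shows "c \<le> h_fun m t"
  using assms unfolding h_fun_def by (auto intro!: cINF_greatest)

lemma h_fun_nonneg:
  assumes "\<And>k. 0 < m k" "0 \<le> t"
  shows "0 \<le> h_fun m t"
proof (cases "t = 0")
  case False
  then show ?thesis using assms by (intro h_fun_ge mult_nonneg_nonneg) (auto intro: less_imp_le)
qed (simp add: h_fun_def)

lemma h_fun_mono:
  assumes "\<And>k. 0 < m k" "0 < t" "t \<le> u"
  shows "h_fun m t \<le> h_fun m u"
proof (rule h_fun_ge)
  fix k
  have "h_fun m t \<le> m k * t ^ k" by (rule h_fun_le[OF assms(1,2)])
  also have "\<dots> \<le> m k * u ^ k" using assms by (intro mult_left_mono power_mono) (auto intro: less_imp_le)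
  finally show "h_fun m t \<le> m k * u ^ k" .
qed (use assms in auto)

text \<open>From some index on the terms are at least 1, and the finitely many others are positive.
  This later allows bounded quantities to be absorbed into \<open>h_fun\<close>.\<close>

lemma h_fun_pos:
  assumes pos: "\<And>k. 0 < m k" and root: "filterlim (\<lambda>k. root k (m k)) at_top sequentially" and t: "0 < t"
  shows "0 < h_fun m t"
proof -
  have "eventually (\<lambda>k. 1 / t \<le> root k (m k)) sequentially" using root unfolding filterlim_at_top by blast
  then obtain N where N: "\<And>k. k \<ge> N \<Longrightarrow> 1 / t \<le> root k (m k)" unfolding eventually_sequentially by blast
  define c where "c = Min (insert 1 ((\<lambda>k. m k * t ^ k) ` {..N}))"
  have "0 < c" unfolding c_def using pos t by (subst Min_gr_iff) auto
  moreover have "c \<le> m k * t ^ k" for k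
  proof (cases "k \<le> N")
    case True then show ?thesis unfolding c_def by (intro Min_le) auto
  next
    case False
    have "(1 / t) ^ k \<le> root k (m k) ^ k" using N[of k] False t by (intro power_mono) auto
    also have "\<dots> = m k" using False pos[of k] by (intro real_root_pow_pos) auto
    finally have "1 \<le> m k * t ^ k" using t by (simp add: field_simps)
    moreover have "c \<le> 1" unfolding c_def by (intro Min_le) auto
    ultimately show ?thesis by linarith
  qed
  ultimately show ?thesis using h_fun_ge[OF t] by fastforce
qed

section \<open>The real subspace and the antiholomorphic derivative\<close>

lemma cemb_norm [simp]: "norm (cemb x) = norm x"
  by (simp add: norm_vec_def cemb_def L2_set_def)

lemma linear_cemb: "linear cemb"
  by (rule linearI) (auto simp: cemb_def vec_eq_iff scaleR_conv_of_real[where 'a=complex])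

lemma inj_cemb: "inj cemb"
  by (auto simp: inj_def cemb_def vec_eq_iff)

lemma cemb_dist [simp]: "dist (cemb x) (cemb y) = dist x y"
  by (metis cemb_norm dist_norm linear_cemb linear_diff)

lemma infdist_cemb_closure: "infdist z (cemb ` closure U) = infdist z (cemb ` U)"
  by (simp add: closure_injective_linear_image[OF linear_cemb inj_cemb] infdist_eq_setdist setdist_closure_2)

lemma sum_norm_components_le: "(\<Sum>j\<in>UNIV. norm (w $ j)) \<le> real CARD('n) * norm (w :: complex ^ 'n)"
  using sum_bounded_above[of UNIV "\<lambda>j. norm (w $ j)" "norm w"] by (simp add: Finite_Cartesian_Product.norm_nth_le)

text \<open>A complex linear map has no antiholomorphic part, so only the deviation of
  \<open>F'\<close> from such a map counts.\<close>

lemma dbar_norm_le: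
  fixes F :: "complex ^ 'n \<Rightarrow> complex" and c :: "'n \<Rightarrow> complex"
  assumes F: "(F has_derivative F') (at z)"
    and L: "\<And>v. norm (F' v - (\<Sum>j\<in>UNIV. v $ j * c j)) \<le> e * norm v"
  shows "norm (dbar F z) \<le> real CARD('n) * e"
proof -
  have fd: "frechet_derivative F (at z) = F'" using frechet_derivative_at[OF F] by simp
  have ax: "(\<Sum>k\<in>UNIV. axis j a $ k * c k) = a * c j" for j :: 'n and a
    by (simp add: axis_def if_distrib if_distribR sum.If_cases[of UNIV] cong: if_cong)
  have norm_axis: "norm (axis j a :: complex ^ 'n) = norm a" for j a
  proof -
    have "(norm (axis j a $ i))\<^sup>2 = (if i = j then (norm a)\<^sup>2 else 0)" for i by (simp add: axis_def)
    then show ?thesis by (simp add: norm_vec_def L2_set_def)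
  qed
  have "norm (dbar_j F j z) \<le> e" for j
  proof -
    have 1: "norm (F' (axis j 1) - c j) \<le> e" using L[of "axis j 1"] by (simp add: ax norm_axis)
    have 2: "norm (F' (axis j \<i>) - \<i> * c j) \<le> e" using L[of "axis j \<i>"] by (simp add: ax norm_axis)
    have "2 * dbar_j F j z = (F' (axis j 1) - c j) + \<i> * (F' (axis j \<i>) - \<i> * c j)"
      by (simp add: dbar_j_def fd algebra_simps)
    then have "norm (2 * dbar_j F j z) \<le> norm (F' (axis j 1) - c j) + norm (\<i> * (F' (axis j \<i>) - \<i> * c j))"
      by (metis norm_triangle_ineq)
    then show ?thesis using 1 2 by (simp add: norm_mult)
  qed
  then have "(\<Sum>j\<in>UNIV. norm (dbar F z $ j)) \<le> real CARD('n) * e"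
    using sum_bounded_above[of UNIV "\<lambda>j. norm (dbar F z $ j)" e] by (simp add: dbar_def)
  moreover have "norm (dbar F z) \<le> (\<Sum>j\<in>UNIV. norm (dbar F z $ j))"
    unfolding norm_vec_def by (rule L2_set_le_sum) simp
  ultimately show ?thesis by linarith
qed

text \<open>Used at points far from \<open>U\<close>, where \<open>h_fun\<close> is bounded below
  and a uniform bound is all that is required.\<close>

lemma dbar_bounded:
  fixes F :: "complex ^ 'n \<Rightarrow> complex"
  assumes F: "\<And>z. (F has_derivative F' z) (at z)" and c: "\<And>v. continuous_on UNIV (\<lambda>z. F' z v)"
    and cpt: "compact (closure {z. F z \<noteq> 0})"
  shows "bounded (range (dbar F))"
proof -
  have d: "dbar F z = (\<chi> j. (F' z (axis j 1) + \<i> * F' z (axis j \<i>)) / 2)" for z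
    unfolding dbar_def dbar_j_def using frechet_derivative_at[OF F[of z]] by simp
  have "continuous_on (closure {z. F z \<noteq> 0}) (dbar F)"
    unfolding d[abs_def] by (intro continuous_intros continuous_on_subset[OF c]) auto
  then have "bounded (dbar F ` closure {z. F z \<noteq> 0})"
    using cpt compact_continuous_image compact_imp_bounded by blast
  moreover have "dbar F z = 0" if "z \<notin> closure {z. F z \<noteq> 0}" for z
  proof -
    have "(F has_derivative (\<lambda>v. 0)) (at z)"
      by (rule has_derivative_transform_within_open[OF has_derivative_const[of 0], of "- closure {z. F z \<noteq> 0}"])
        (use that closure_subset[of "{z. F z \<noteq> 0}"] in \<open>auto simp: open_Compl\<close>)
    then have "F' z = (\<lambda>v. 0)" using F has_derivative_unique by blast
    then show ?thesis by (simp add: d vec_eq_iff)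
  qed
  then have "range (dbar F) \<subseteq> insert 0 (dbar F ` closure {z. F z \<noteq> 0})" by auto
  ultimately show ?thesis by (meson bounded_insert bounded_subset)
qed

section \<open>Comparison of Taylor polynomials\<close>

lemma taylor_at_base:
  "0 < p \<Longrightarrow> taylor f p is x (cemb x) = partials is f x"
proof (induction p)
  case (Suc p)
  show ?case
  proof (cases p)
    case 0 then show ?thesis by (simp add: taylor_def)
  next
    case (Suc q)
    then have "form_term f p is x (cemb x - cemb x) = 0" by simp
    then show ?thesis using Suc.IH Suc by (simp add: taylor_def)
  qed
qed simp

text \<open>Suprema over all points and all lists of a given length yield one sequence that is
  independent of \<open>\<rho>\<close> and yet satisfies the bounds for every
  \<open>\<rho>\<close>.\<close>

lemma partials_sup_bound:
  fixes U :: "(real ^ 'n::finite) set"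
  assumes f: "f \<in> beurling_class M U" and U: "open U" "U \<noteq> {}" and M: "\<And>k. 0 < M k"
  obtains S where "\<And>k. 0 \<le> S k" "\<And>is x. x \<in> U \<Longrightarrow> norm (partials is f x) \<le> S (length is)"
    "\<And>\<rho>. 0 < \<rho> \<Longrightarrow> \<exists>C. \<forall>k. S k \<le> C * \<rho> ^ k * M k"
proof -
  have sm: "smooth_on U f" using f by (simp add: beurling_class_def)
  define A where "A k = {norm (partials is f x) | is x. length is = k \<and> x \<in> U}" for k
  have b: "\<exists>C. \<forall>k. \<forall>a\<in>A k. a \<le> C * \<rho> ^ k * M k" if \<rho>: "0 < \<rho>" for \<rho>
  proof -
    obtain C where C: "\<And>x \<alpha>. x \<in> U \<Longrightarrow> norm (dalpha \<alpha> f x) / (\<rho> ^ mi_abs \<alpha> * M (mi_abs \<alpha>)) \<le> C"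
      using f \<rho> unfolding beurling_class_def by blast
    have "norm (partials is f x) \<le> C * \<rho> ^ length is * M (length is)" if "x \<in> U" for "is" x
      using C[OF that, of "count (mset is)"] dalpha_count[OF sm U(1) that, of "is"] \<rho> M[of "length is"]
      by (simp add: mi_abs_count pos_divide_le_eq mult.assoc)
    then show ?thesis by (auto simp: A_def)
  qed
  have ne: "A k \<noteq> {}" for k
  proof -
    obtain x where "x \<in> U" using U(2) by blast
    \<comment> \<open>\<open>undefined\<close> stands for any index; it only provides a list of
      length \<open>k\<close>.\<close>
    then have "norm (partials (replicate k undefined) f x) \<in> A k" unfolding A_def by force
    then show ?thesis by blast
  qed
  obtain C1 where C1: "\<And>k a. a \<in> A k \<Longrightarrow> a \<le> C1 * 1 ^ k * M k" using b[of 1] by auto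
  have bdd: "bdd_above (A k)" for k by (rule bdd_aboveI) (rule C1)
  show ?thesis
  proof (rule that[of "\<lambda>k. Sup (A k)"])
    show le: "norm (partials is f x) \<le> Sup (A (length is))" if "x \<in> U" for "is" x
      by (rule cSup_upper[OF _ bdd]) (use that in \<open>auto simp: A_def\<close>)
    show "0 \<le> Sup (A k)" for k
    proof -
      obtain x where "x \<in> U" using U(2) by blast
      then show ?thesis using order_trans[OF norm_ge_zero le[of x "replicate k undefined"]] by simp
    qed
    show "\<exists>C. \<forall>k. Sup (A k) \<le> C * \<rho> ^ k * M k" if "0 < \<rho>" for \<rho>
      using b[OF that] ne by (meson cSup_least)
  qed
qed

text \<open>Along a path from \<open>x\<close> to \<open>y\<close> only the top-degree term of the
  derivative in the base point is left. It carries \<open>p\<close> factors of size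
  \<open>d\<close>, and the distance of \<open>x\<close> and \<open>y\<close> supplies one
  more.\<close>

lemma taylor_base_change:
  fixes U :: "(real ^ 'n::finite) set"
  assumes U: "open U" "quasiconvex U"
  obtains W where "real CARD('n) * 4 \<le> W" "1 \<le> W" "\<And>f S p is x y z d. \<lbrakk>smooth_on U f; \<And>is x. x \<in> U \<Longrightarrow> norm (partials is f x) \<le> S (length is);
    x \<in> U; y \<in> U; dist z (cemb x) \<le> 4 * d; dist z (cemb y) \<le> 4 * d\<rbrakk> \<Longrightarrow>
    norm (taylor f (Suc p) is x z - taylor f (Suc p) is y z) \<le> (W * d) ^ Suc p * S (Suc p + length is) / fact p"
proof -
  obtain K where K: "1 \<le> K" and lip: "\<And>(\<phi> :: real ^ 'n \<Rightarrow> complex) \<phi>' B x y. x \<in> U \<Longrightarrow> y \<in> U \<Longrightarrow>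
    (\<And>u i. u \<in> U \<Longrightarrow> dist u x \<le> K * dist x y \<Longrightarrow>
       ((\<lambda>t. \<phi> (u + t *\<^sub>R axis i 1)) has_vector_derivative \<phi>' i u) (at 0)) \<Longrightarrow>
    (\<And>u i. u \<in> U \<Longrightarrow> dist u x \<le> K * dist x y \<Longrightarrow> norm (\<phi>' i u) \<le> B) \<Longrightarrow>
    norm (\<phi> y - \<phi> x) \<le> K * B * dist x y"
    using quasiconvex_lipschitz[OF U] by metis
  define n where "n = real CARD('n)"
  have n: "1 \<le> n" by (simp add: n_def Suc_leI)
  \<comment> \<open>Both base points lie within \<open>4 * d\<close> of \<open>z\<close>, so
    \<open>dist x y \<le> 8 * d\<close>; the relevant points \<open>u\<close> are within
    \<open>8 * K * d\<close> of \<open>x\<close>, hence within \<open>12 * K * d\<close> of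
    \<open>z\<close>. The factor \<open>n\<close> comes from summing the norms of the
    coordinates.\<close>
  define W where "W = 12 * n * K"
  have nK: "n \<le> n * K" "K \<le> n * K" using n K by auto
  have main: "norm (taylor f (Suc p) is x z - taylor f (Suc p) is y z) \<le> (W * d) ^ Suc p * S (Suc p + length is) / fact p"
    if sm: "smooth_on U f" and S: "\<And>is x. x \<in> U \<Longrightarrow> norm (partials is f x) \<le> S (length is)"
      and xy: "x \<in> U" "y \<in> U" and z: "dist z (cemb x) \<le> 4 * d" "dist z (cemb y) \<le> 4 * d"
    for f S p "is" x y z d
  proof -
    have d0: "0 \<le> d" using z(1) zero_le_dist[of z "cemb x"] by linarith
    have S0: "0 \<le> S k" for k using order_trans[OF norm_ge_zero S[OF xy(1), of "replicate k undefined"]] by simp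
    have dxy: "dist x y \<le> 8 * d"
    proof -
      have "dist (cemb x) (cemb y) \<le> 8 * d" using dist_triangle3[of "cemb x" "cemb y" z] z by simp
      then show ?thesis by simp
    qed
    define B where "B = (W * d) ^ p * S (Suc p + length is) / fact p"
    have B0: "0 \<le> B" using d0 S0 n K by (simp add: B_def W_def)
    have "norm (taylor f (Suc p) is y z - taylor f (Suc p) is x z) \<le> K * B * dist x y"
    proof (rule lip[OF xy])
      fix u i assume u: "u \<in> U" "dist u x \<le> K * dist x y"
      show "((\<lambda>t. taylor f (Suc p) is (u + t *\<^sub>R axis i 1) z) has_vector_derivative
         form_term f p (i # is) u (z - cemb u) / fact p) (at 0)"
        by (rule taylor_derivative_base[OF sm U(1) u(1)])
      have "dist z (cemb u) \<le> dist z (cemb x) + dist (cemb x) (cemb u)" by (rule dist_triangle)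
      also have "\<dots> \<le> 4 * d + K * (8 * d)"
      proof (rule add_mono[OF z(1)])
        have "K * dist x y \<le> K * (8 * d)" using dxy K by (intro mult_left_mono) auto
        then show "dist (cemb x) (cemb u) \<le> K * (8 * d)" using u(2) by (simp add: dist_commute)
      qed
      also have "\<dots> \<le> 12 * K * d" using K d0 mult_right_mono[of 1 K d] by simp
      finally have zu: "norm (z - cemb u) \<le> 12 * K * d" by (simp add: dist_norm)
      have "(\<Sum>j\<in>UNIV. norm ((z - cemb u) $ j)) \<le> n * norm (z - cemb u)"
        unfolding n_def by (rule sum_norm_components_le)
      also have "\<dots> \<le> n * (12 * K * d)" using zu n by (intro mult_left_mono) auto
      finally have wW: "(\<Sum>j\<in>UNIV. norm ((z - cemb u) $ j)) \<le> W * d" by (simp add: W_def mult_ac)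
      have "norm (form_term f p (i # is) u (z - cemb u)) \<le> (\<Sum>j\<in>UNIV. norm ((z - cemb u) $ j)) ^ p * S (Suc p + length is)"
        by (rule form_term_bound) (metis S[OF u(1)] add_Suc add_Suc_right length_Cons)
      also have "\<dots> \<le> (W * d) ^ p * S (Suc p + length is)"
        using wW S0 by (intro mult_right_mono power_mono) (auto intro: sum_nonneg)
      finally show "norm (form_term f p (i # is) u (z - cemb u) / fact p) \<le> B"
        by (simp add: B_def norm_divide divide_right_mono)
    qed
    also have "\<dots> \<le> K * B * (8 * d)" using dxy K B0 by (intro mult_left_mono) auto
    also have "\<dots> = (8 * K) * (d * B)" by simp
    also have "\<dots> \<le> W * (d * B)" using B0 d0 n K nK by (intro mult_right_mono) (auto simp: W_def)
    also have "\<dots> = (W * d) ^ Suc p * S (Suc p + length is) / fact p" by (simp add: B_def)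
    finally show ?thesis by (simp add: norm_minus_commute)
  qed
  show ?thesis
  proof (rule that[of W])
    show "real CARD('n) * 4 \<le> W" using nK n by (simp add: W_def n_def[symmetric])
    show "1 \<le> W" using nK n unfolding W_def by linarith
  qed (rule main)
qed

lemma taylor_degree_change:
  fixes x :: "real ^ 'n::finite"
  assumes S: "\<And>is. norm (partials is f x) \<le> S (length is)" and W: "real CARD('n) * 4 \<le> W"
    and z: "dist z (cemb x) \<le> 4 * d" and pq: "p \<le> q"
  shows "norm (taylor f q is x z - taylor f p is x z) \<le> (\<Sum>k\<in>{p..<q}. (W * d) ^ k * S (k + length is) / fact k)"
proof -
  have d0: "0 \<le> d" using z zero_le_dist[of z "cemb x"] by linarith
  have w: "(\<Sum>j\<in>UNIV. norm ((z - cemb x) $ j)) \<le> W * d"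
  proof -
    have "(\<Sum>j\<in>UNIV. norm ((z - cemb x) $ j)) \<le> real CARD('n) * norm (z - cemb x)" by (rule sum_norm_components_le)
    also have "\<dots> \<le> real CARD('n) * (4 * d)" using z by (intro mult_left_mono) (auto simp: dist_norm)
    also have "\<dots> \<le> W * d" using mult_right_mono[OF W d0] by simp
    finally show ?thesis .
  qed
  have S0: "0 \<le> S k" for k using order_trans[OF norm_ge_zero S[of "replicate k undefined"]] by simp
  have "taylor f q is x z - taylor f p is x z = (\<Sum>k\<in>{p..<q}. form_term f k is x (z - cemb x) / fact k)"
    unfolding taylor_def using pq by (simp add: sum_diff_nat_ivl[of 0 p q] lessThan_atLeast0)
  also have "norm \<dots> \<le> (\<Sum>k\<in>{p..<q}. (W * d) ^ k * S (k + length is) / fact k)"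
  proof (rule sum_norm_le)
    fix k
    have "norm (form_term f k is x (z - cemb x)) \<le> (\<Sum>j\<in>UNIV. norm ((z - cemb x) $ j)) ^ k * S (k + length is)"
      by (rule form_term_bound) (metis S)
    also have "\<dots> \<le> (W * d) ^ k * S (k + length is)"
      using w S0 by (intro mult_right_mono power_mono) (auto intro: sum_nonneg)
    finally show "norm (form_term f k is x (z - cemb x) / fact k) \<le> (W * d) ^ k * S (k + length is) / fact k"
      by (simp add: norm_divide divide_right_mono)
  qed
  finally show ?thesis .
qed

lemma taylor_continuous:
  assumes "smooth_on U f" "open U" "x \<in> U"
  shows "continuous_on A (taylor f p is x)"
proof (cases p)
  case 0
  then show ?thesis by (simp add: taylor_def[abs_def])
next
  case (Suc q)
  show ?thesis unfolding Suc
    by (rule has_derivative_continuous_on) (rule has_derivative_at_withinI[OF taylor_derivative_arg[OF assms]])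
qed

lemma sum_half_powers_le: "(\<Sum>j\<in>{a..<b}. (1/2 :: real) ^ j) \<le> 2"
proof -
  have "(\<Sum>j\<in>{a..<b}. (1/2 :: real) ^ j) \<le> (\<Sum>j. (1/2) ^ j)"
    by (rule sum_le_suminf) (auto simp: summable_geometric)
  then show ?thesis by (simp add: suminf_geometric)
qed

lemma index_over_4_power: "real j / 4 ^ j \<le> (1/2) ^ j"
proof -
  have "real j \<le> 2 ^ j" using of_nat_less_two_power[of j, where 'a=real] by simp
  then have "real j / 4 ^ j \<le> 2 ^ j / 4 ^ j" by (intro divide_right_mono) auto
  also have "\<dots> = (1/2) ^ j" by (simp add: power_divide[symmetric])
  finally show ?thesis .
qed

text \<open>The degree of the Taylor polynomials at scale \<open>d k\<close> is the index at which the minimum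
  \<open>h\<close> of \<open>l j * t ^ j\<close> is attained for \<open>t = 8 * W * d k\<close>, where \<open>l\<close> is an intermediate
  log-convex weight between the derivatives of \<open>f\<close> and \<open>small_m M\<close>.\<close>

lemma taylor_extension:
  fixes U :: "(real ^ 'n::finite) set"
  assumes U: "U \<noteq> {}" "bounded U" "open U" "quasiconvex U"
    and sm: "smooth_on U f" and S0: "\<And>k. 0 \<le> S k"
    and S: "\<And>is x. x \<in> U \<Longrightarrow> norm (partials is f x) \<le> S (length is)"
    and \<sigma>: "incseq \<sigma>" "\<And>k. 0 < \<sigma> k" "filterlim \<sigma> at_top sequentially"
    and C1: "\<And>k. S k / fact k \<le> C1 * (\<Prod>j<k. \<sigma> j)" "0 \<le> C1"
  obtains F F' \<delta> W C where
    "\<And>z. (F has_derivative F' z) (at z)" "\<And>v. continuous_on UNIV (\<lambda>z. F' z v)"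
    "compact (closure {z. F z \<noteq> 0})" "\<And>x. x \<in> U \<Longrightarrow> F (cemb x) = f x" "0 < \<delta>" "0 < W" "0 \<le> C"
    "\<And>k q z. infdist z (cemb ` U) < \<delta> / 2 ^ Suc k \<Longrightarrow>
      norm (dbar F z) \<le> C * ((\<Prod>j<q. \<sigma> j) * (W * (\<delta> / 2 ^ Suc k)) ^ q) / (\<delta> / 2 ^ Suc k)"
    "\<And>z. infdist z (cemb ` U) = 0 \<Longrightarrow> dbar F z = 0"
proof -
  obtain W where W4: "real CARD('n) * 4 \<le> W" and W1: "1 \<le> W"
    and base: "\<And>p is x y z d. \<lbrakk>x \<in> U; y \<in> U; dist z (cemb x) \<le> 4 * d; dist z (cemb y) \<le> 4 * d\<rbrakk> \<Longrightarrow>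
      norm (taylor f (Suc p) is x z - taylor f (Suc p) is y z) \<le> (W * d) ^ Suc p * S (Suc p + length is) / fact p"
    using taylor_base_change[OF U(3,4)] sm S by metis
  have nW: "real CARD('n) \<le> W" using W4 by simp
  define l where "l k = (\<Prod>j<k. \<sigma> j)" for k
  have l0: "0 \<le> l k" for k unfolding l_def by (intro prod_nonneg) (simp add: \<sigma> less_imp_le)
  \<comment> \<open>This makes \<open>\<sigma> 1 * t k\<close> at most 1/2 at every scale, so that
    the degree \<open>P k\<close> is at least 2.\<close>
  define \<delta> where "\<delta> = 1 / (16 * W * \<sigma> 1)"
  have \<delta>: "0 < \<delta>" using W1 \<sigma>(2)[of 1] by (simp add: \<delta>_def)
  define d where "d = (\<lambda>k::nat. \<delta> / 2 ^ k)"
  have d0: "0 < d k" for k using \<delta> by (simp add: d_def)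
  have dSuc: "d (Suc k) = d k / 2" for k by (simp add: d_def)
  have ddelta: "d k \<le> \<delta>" for k using \<delta> by (simp add: d_def divide_le_eq mult_left_mono)
  \<comment> \<open>A factor 2 pays for the passage to the next finer scale; the remaining 4 puts
    \<open>4 ^ j\<close> into the denominator, which absorbs factors polynomial in \<open>j\<close>
    and makes the sums over degrees converge.\<close>
  define t where "t k = 8 * W * d k" for k
  have t0: "0 < t k" for k using d0 W1 by (simp add: t_def)
  have tSuc: "t (Suc k) = t k / 2" for k by (simp add: t_def dSuc)
  have t4: "W * d k = t (Suc k) / 4" for k by (simp add: t_def dSuc)
  define P where "P k = opt_index \<sigma> (t k)" for k
  have P2: "2 \<le> P k" for k
  proof (rule ccontr)
    assume "\<not> 2 \<le> P k"
    then have "1 \<le> \<sigma> 1 * t k" using opt_index(3)[OF \<sigma> t0, of k 1] by (simp add: P_def)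
    also have "\<dots> \<le> \<sigma> 1 * (8 * W * \<delta>)" using ddelta[of k] W1 \<sigma>(2)[of 1] by (simp add: t_def)
    also have "\<dots> = 1/2" using W1 \<sigma>(2)[of 1] by (simp add: \<delta>_def)
    finally show False by simp
  qed
  have PSuc: "P k \<le> P (Suc k)" for k
    unfolding P_def by (rule opt_index_antimono[OF \<sigma> t0]) (use t0[of k] in \<open>simp add: tSuc\<close>)
  define H where "H k = l (P k) * t k ^ P k" for k
  have H0: "0 \<le> H k" for k using l0 t0[of k] by (simp add: H_def)
  have Hmin: "H k \<le> l q * t k ^ q" for k q
    unfolding H_def l_def P_def by (rule opt_index_minimal[OF \<sigma> t0])
  \<comment> \<open>As \<open>P k\<close> is at least 2, halving \<open>t\<close> gains a factor 4;
    after division by \<open>d k\<close> a factor 2 is left, as the gluing requires.\<close>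
  have Hhalf: "H (Suc k) \<le> H k / 4" for k
  proof -
    have "H (Suc k) \<le> l (P k) * t (Suc k) ^ P k" by (rule Hmin)
    also have "\<dots> = H k / 2 ^ P k" by (simp add: H_def tSuc power_divide)
    also have "\<dots> \<le> H k / 2 ^ 2" using H0[of k] P2[of k] by (intro divide_left_mono power_increasing) auto
    finally show ?thesis by simp
  qed
  \<comment> \<open>Up to the optimal index of the finer scale the terms at \<open>t (Suc k)\<close>
    decrease. So from degree \<open>P k\<close> on they are bounded by the one of degree
    \<open>P k\<close>, and this by \<open>H k\<close> because
    \<open>t (Suc k) \<le> t k\<close>.\<close>
  have key: "(W * d k) ^ j * (S j / fact j) \<le> C1 * H k / 4 ^ j" if j: "P k \<le> j" "j \<le> P (Suc k)" for j k
  proof -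
    have "l j * t (Suc k) ^ j \<le> l (P k) * t (Suc k) ^ P k"
      unfolding l_def using j by (intro decreasing_below_opt_index[OF \<sigma> t0]) (auto simp: P_def)
    also have "\<dots> \<le> H k" unfolding H_def using t0[of k] l0 by (intro mult_left_mono power_mono) (auto simp: tSuc)
    finally have le: "l j * t (Suc k) ^ j \<le> H k" .
    have "(W * d k) ^ j * (S j / fact j) \<le> (W * d k) ^ j * (C1 * l j)"
      using C1(1)[of j] W1 d0[of k] by (intro mult_left_mono) (auto simp: l_def)
    also have "\<dots> = C1 * (l j * t (Suc k) ^ j) / 4 ^ j" unfolding t4 by (simp add: power_divide)
    also have "\<dots> \<le> C1 * H k / 4 ^ j" using le C1(2) by (intro divide_right_mono mult_left_mono) auto
    finally show ?thesis .
  qed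
  define X where "X = cemb ` U"
  \<comment> \<open>The gluing works with points of complex space; real parts recover the base point
    of the Taylor polynomial.\<close>
  define pr where "pr y = (\<chi> j. Re (y $ j))" for y :: "complex ^ 'n"
  have pr: "pr (cemb x) = x" for x by (simp add: pr_def cemb_def vec_eq_iff)
  define \<tau> where "\<tau> k y z = taylor f (P k) [] (pr y) z" for k y z
  define \<tau>' where "\<tau>' k y z v = (\<Sum>j\<in>UNIV. v $ j * taylor f (P k - 1) [j] (pr y) z)" for k y z and v :: "complex ^ 'n"
  \<comment> \<open>The 2 bounds the geometric sum over the degrees between \<open>P k\<close> and
    \<open>P (Suc k)\<close>; the division by \<open>d k\<close> is the cost of a
    derivative.\<close>
  define \<epsilon> where "\<epsilon> k = 2 * C1 * H k / d k" for k
  have X: "X \<noteq> {}" "bounded X"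
    using U(1,2) by (auto simp: X_def bounded_iff)
  have prX: "y \<in> X \<Longrightarrow> pr y \<in> U \<and> cemb (pr y) = y" for y by (auto simp: X_def pr)
  have d\<tau>: "(\<tau> k y has_derivative \<tau>' k y z) (at z)" if "y \<in> X" for k y z
  proof -
    have "P k = Suc (P k - 1)" using P2[of k] by simp
    then show ?thesis
      unfolding \<tau>_def[abs_def] \<tau>'_def[abs_def] using taylor_derivative_arg[OF sm U(3), of "pr y" "P k - 1" "[]" z] prX[OF that] by simp
  qed
  have c\<tau>': "continuous_on UNIV (\<lambda>z. \<tau>' k y z v)" if "y \<in> X" for k y v
    unfolding \<tau>'_def using prX[OF that] by (intro continuous_intros taylor_continuous[OF sm U(3)]) auto
  have C1H: "0 \<le> C1 * H k" for k using C1(2) H0 by simp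
  have sumv: "norm (\<Sum>j\<in>UNIV. v $ j * a j - v $ j * b j) \<le> c / (W * d k) * (W * norm v)"
    if "\<And>j. norm (a j - b j) \<le> c / (W * d k)" "0 \<le> c" for v :: "complex ^ 'n" and a b c k
  proof -
    have "norm (\<Sum>j\<in>UNIV. v $ j * a j - v $ j * b j) \<le> (\<Sum>j\<in>UNIV. norm (v $ j) * (c / (W * d k)))"
      by (rule sum_norm_le) (simp only: right_diff_distrib[symmetric] norm_mult mult_left_mono[OF that(1) norm_ge_zero])
    also have "\<dots> = c / (W * d k) * (\<Sum>j\<in>UNIV. norm (v $ j))" by (simp only: sum_distrib_right[symmetric] mult.commute)
    also have "\<dots> \<le> c / (W * d k) * (W * norm v)"
      using that(2) W1 d0[of k] order_trans[OF sum_norm_components_le[of v] mult_right_mono[OF nW norm_ge_zero]]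
      by (intro mult_left_mono) auto
    finally show ?thesis .
  qed
  have near: "norm (\<tau> k x z - \<tau> k y z) \<le> \<epsilon> k * d k"
    and near': "norm (\<tau>' k x z v - \<tau>' k y z v) \<le> \<epsilon> k * norm v"
    if "x \<in> X" "y \<in> X" "dist z x \<le> 4 * d k" "dist z y \<le> 4 * d k" for k x y z v
  proof -
    obtain p where p: "P k = Suc (Suc p)" using P2[of k] by (metis add_2_eq_Suc le_Suc_ex)
    have x: "pr x \<in> U" "cemb (pr x) = x" and y: "pr y \<in> U" "cemb (pr y) = y" using prX that by auto
    have kP: "(W * d k) ^ P k * (S (P k) / fact (P k)) \<le> C1 * H k / 4 ^ P k" by (rule key) (auto intro: PSuc)
    have P1: "real (P k) / 4 ^ P k \<le> 1"
      using index_over_4_power[of "P k"] power_le_one[of "1/2::real" "P k"] by simp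
    \<comment> \<open>The estimate for the first derivatives has \<open>fact (P k - 2)\<close> in
      the denominator, which costs \<open>P k * (P k - 1)\<close> against
      \<open>fact (P k)\<close>.\<close>
    have PP: "real (P k) * real (P k - 1) / 4 ^ P k \<le> 1"
    proof -
      have "real (P k) * real (P k - 1) \<le> 2 ^ P k * 2 ^ P k"
      proof -
        have a: "real (P k) \<le> 2 ^ P k" using of_nat_less_two_power[of "P k", where 'a=real] by simp
        moreover have "real (P k - 1) \<le> real (P k)" by simp
        ultimately have "real (P k - 1) \<le> 2 ^ P k" by linarith
        then show ?thesis by (intro mult_mono a) simp_all
      qed
      also have "\<dots> = (4::real) ^ P k" by (simp add: power_mult_distrib[symmetric])
      finally show ?thesis by simp
    qed
    have "norm (\<tau> k x z - \<tau> k y z) \<le> (W * d k) ^ P k * S (P k) / fact (Suc p)"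
      using base[OF x(1) y(1), of z "d k" "Suc p" "[]"] that x y by (simp add: \<tau>_def p)
    also have "\<dots> = real (P k) * ((W * d k) ^ P k * (S (P k) / fact (P k)))"
      unfolding p by (simp add: fact_Suc[of "Suc p"] del: fact_Suc of_nat_Suc power_Suc)
    also have "\<dots> \<le> real (P k) * (C1 * H k / 4 ^ P k)" by (intro mult_left_mono kP) simp
    also have "\<dots> = (C1 * H k) * (real (P k) / 4 ^ P k)" by simp
    also have "\<dots> \<le> (C1 * H k) * 1" by (intro mult_left_mono P1 C1H)
    also have "\<dots> \<le> \<epsilon> k * d k" using C1H[of k] d0[of k] by (simp add: \<epsilon>_def)
    finally show "norm (\<tau> k x z - \<tau> k y z) \<le> \<epsilon> k * d k" .
    have "norm (taylor f (P k - 1) [j] (pr x) z - taylor f (P k - 1) [j] (pr y) z) \<le> (C1 * H k) / (W * d k)" for j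
    proof -
      have Wd: "0 < W * d k" using W1 d0[of k] by simp
      have "norm (taylor f (P k - 1) [j] (pr x) z - taylor f (P k - 1) [j] (pr y) z)
        \<le> (W * d k) ^ Suc p * S (P k) / fact p"
        using base[OF x(1) y(1), of z "d k" p "[j]"] that x y by (simp add: p)
      also have "\<dots> = (real (P k) * real (P k - 1)) * ((W * d k) ^ P k * (S (P k) / fact (P k))) / (W * d k)"
        using Wd unfolding p by (simp add: fact_Suc[of "Suc p"] fact_Suc[of p] power_Suc[of "W * d k" "Suc p"] del: fact_Suc of_nat_Suc power_Suc)
      also have "\<dots> \<le> (real (P k) * real (P k - 1)) * (C1 * H k / 4 ^ P k) / (W * d k)"
        using Wd by (intro divide_right_mono mult_left_mono kP) auto
      also have "\<dots> = (C1 * H k) * (real (P k) * real (P k - 1) / 4 ^ P k) / (W * d k)" by simp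
      also have "\<dots> \<le> (C1 * H k) * 1 / (W * d k)"
        using Wd by (intro divide_right_mono mult_left_mono PP C1H) auto
      finally show ?thesis by simp
    qed
    then have "norm (\<tau>' k x z v - \<tau>' k y z v) \<le> (C1 * H k) / (W * d k) * (W * norm v)"
      unfolding \<tau>'_def sum_subtractf[symmetric] by (rule sumv) (rule C1H)
    also have "\<dots> = (C1 * H k) * norm v / d k" using W1 by simp
    also have "\<dots> \<le> (2 * (C1 * H k)) * norm v / d k"
      using C1H[of k] d0[of k] by (intro divide_right_mono mult_right_mono) auto
    also have "\<dots> = \<epsilon> k * norm v" by (simp add: \<epsilon>_def)
    finally show "norm (\<tau>' k x z v - \<tau>' k y z v) \<le> \<epsilon> k * norm v" .
  qed
  have step: "norm (\<tau> (Suc k) x z - \<tau> k x z) \<le> \<epsilon> k * d k"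
    and step': "norm (\<tau>' (Suc k) x z v - \<tau>' k x z v) \<le> \<epsilon> k * norm v"
    if "x \<in> X" "dist z x \<le> 4 * d k" for k x z v
  proof -
    have x: "pr x \<in> U" "cemb (pr x) = x" using prX that by auto
    have Wd: "0 < W * d k" using W1 d0[of k] by simp
    note chg = taylor_degree_change[of f "pr x" S, OF S[OF x(1)] W4, of z "d k", unfolded x(2), OF that(2)]
    have "norm (\<tau> (Suc k) x z - \<tau> k x z) \<le> (\<Sum>j\<in>{P k..<P (Suc k)}. (W * d k) ^ j * S j / fact j)"
      using chg[OF PSuc[of k], of "[]"] by (simp add: \<tau>_def)
    also have "\<dots> \<le> (\<Sum>j\<in>{P k..<P (Suc k)}. (C1 * H k) * (1/2) ^ j)"
    proof (rule sum_mono)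
      fix j assume j: "j \<in> {P k..<P (Suc k)}"
      have "(W * d k) ^ j * S j / fact j \<le> C1 * H k / 4 ^ j" using key[of k j] j by simp
      also have "\<dots> \<le> C1 * H k / 2 ^ j" by (intro divide_left_mono C1H power_mono) auto
      finally show "(W * d k) ^ j * S j / fact j \<le> (C1 * H k) * (1/2) ^ j" by (simp add: power_divide)
    qed
    also have "\<dots> = (C1 * H k) * (\<Sum>j\<in>{P k..<P (Suc k)}. (1/2) ^ j)" by (simp add: sum_distrib_left)
    also have "\<dots> \<le> (C1 * H k) * 2" by (intro mult_left_mono sum_half_powers_le C1H)
    also have "\<dots> = \<epsilon> k * d k" using d0[of k] by (simp add: \<epsilon>_def)
    finally show "norm (\<tau> (Suc k) x z - \<tau> k x z) \<le> \<epsilon> k * d k" .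
    have "norm (taylor f (P (Suc k) - 1) [i] (pr x) z - taylor f (P k - 1) [i] (pr x) z) \<le> (2 * (C1 * H k)) / (W * d k)" for i
    proof -
      have PSuc': "P k - 1 \<le> P (Suc k) - 1" using PSuc[of k] by simp
      have "norm (taylor f (P (Suc k) - 1) [i] (pr x) z - taylor f (P k - 1) [i] (pr x) z)
        \<le> (\<Sum>q\<in>{P k - 1..<P (Suc k) - 1}. (W * d k) ^ q * S (Suc q) / fact q)"
        using chg[OF PSuc', of "[i]"] by simp
      also have "\<dots> \<le> (\<Sum>q\<in>{P k - 1..<P (Suc k) - 1}. (C1 * H k) / (W * d k) * (1/2) ^ q)"
      proof (rule sum_mono)
        fix q assume q: "q \<in> {P k - 1..<P (Suc k) - 1}"
        \<comment> \<open>Degree \<open>q\<close> for a first derivative is degree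
          \<open>Suc q\<close> for \<open>f\<close>, which lies in the range of \<open>key\<close>;
          the surplus is \<open>Suc q / (W * d k)\<close>.\<close>
        have "(W * d k) ^ q * S (Suc q) / fact q = (real (Suc q) / (W * d k)) * ((W * d k) ^ Suc q * (S (Suc q) / fact (Suc q)))"
          using W1 d0[of k] by (simp add: fact_Suc del: of_nat_Suc)
        also have "\<dots> \<le> (real (Suc q) / (W * d k)) * (C1 * H k / 4 ^ Suc q)"
        proof (rule mult_left_mono)
          show "(W * d k) ^ Suc q * (S (Suc q) / fact (Suc q)) \<le> C1 * H k / 4 ^ Suc q"
            by (rule key) (use q P2[of k] in auto)
        qed (use Wd in simp)
        also have "\<dots> = (C1 * H k) / (W * d k) * (real (Suc q) / 4 ^ Suc q)" by simp
        also have "\<dots> \<le> (C1 * H k) / (W * d k) * (1/2) ^ Suc q"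
          using Wd C1H[of k] by (intro mult_left_mono index_over_4_power divide_nonneg_pos) auto
        also have "\<dots> \<le> (C1 * H k) / (W * d k) * (1/2) ^ q"
          using Wd C1H[of k] by (intro mult_left_mono divide_nonneg_pos) auto
        finally show "(W * d k) ^ q * S (Suc q) / fact q \<le> (C1 * H k) / (W * d k) * (1/2) ^ q" .
      qed
      also have "\<dots> = (C1 * H k) / (W * d k) * (\<Sum>q\<in>{P k - 1..<P (Suc k) - 1}. (1/2) ^ q)" by (simp add: sum_distrib_left)
      also have "\<dots> \<le> (C1 * H k) / (W * d k) * 2"
        using Wd C1H[of k] by (intro mult_left_mono sum_half_powers_le divide_nonneg_pos) auto
      finally show ?thesis by (simp add: mult_ac)
    qed
    then have "norm (\<tau>' (Suc k) x z v - \<tau>' k x z v) \<le> (2 * (C1 * H k)) / (W * d k) * (W * norm v)"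
      unfolding \<tau>'_def sum_subtractf[symmetric] by (rule sumv) (use C1H[of k] in simp)
    also have "\<dots> = \<epsilon> k * norm v" using W1 by (simp add: \<epsilon>_def)
    finally show "norm (\<tau>' (Suc k) x z v - \<tau>' k x z v) \<le> \<epsilon> k * norm v" .
  qed
  have \<epsilon>0: "0 \<le> \<epsilon> k" for k using C1H[of k] d0[of k] by (simp add: \<epsilon>_def)
  have \<epsilon>half: "\<epsilon> (Suc k) \<le> \<epsilon> k / 2" for k
  proof -
    have "\<epsilon> (Suc k) = 4 * C1 * H (Suc k) / d k" using d0[of k] by (simp add: \<epsilon>_def dSuc)
    also have "\<dots> \<le> 4 * C1 * (H k / 4) / d k" using Hhalf[of k] C1(2) d0[of k] by (intro divide_right_mono mult_left_mono) auto
    finally show ?thesis by (simp add: \<epsilon>_def)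
  qed
  obtain F F' C where F: "\<And>z. (F has_derivative F' z) (at z)" "\<And>v. continuous_on UNIV (\<lambda>z. F' z v)"
    "compact (closure {z. F z \<noteq> 0})" and lim: "\<And>y. y \<in> X \<Longrightarrow> (\<lambda>k. \<tau> k y y) \<longlonglongrightarrow> F y"
    and C: "0 \<le> C" and app: "\<And>k z. infdist z X < d (Suc k) \<Longrightarrow>
       \<exists>x\<in>X. \<forall>v. norm (F' z v - \<tau>' (Suc k) x z v) \<le> C * \<epsilon> (Suc k) * norm v"
    by (rule glue_local_approximants[where X=X and \<delta>=\<delta> and d=d and \<tau>=\<tau> and \<tau>'=\<tau>' and \<epsilon>=\<epsilon>])
      (assumption | (erule thin_rl, fact X \<delta> d_def d\<tau> c\<tau>' near near' step step' \<epsilon>0 \<epsilon>half) | rule that)+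
  have Ff: "F (cemb x) = f x" if "x \<in> U" for x
  proof -
    have "\<tau> k (cemb x) (cemb x) = f x" for k
      using taylor_at_base[of "P k" f "[]" x] P2[of k] by (simp add: \<tau>_def pr)
    then have "(\<lambda>k. f x) \<longlonglongrightarrow> F (cemb x)" using lim[of "cemb x"] that by (simp add: X_def)
    then show ?thesis using LIMSEQ_unique tendsto_const by blast
  qed
  have dbar: "norm (dbar F z) \<le> real CARD('n) * (C * \<epsilon> (Suc k))" if z: "infdist z X < d (Suc k)" for k z
  proof -
    obtain x where "\<And>v. norm (F' z v - \<tau>' (Suc k) x z v) \<le> C * \<epsilon> (Suc k) * norm v" using app[OF z] by blast
    then show ?thesis unfolding \<tau>'_def by (rule dbar_norm_le[OF F(1)])
  qed
  define C' where "C' = real CARD('n) * C * 2 * C1"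
  show ?thesis
  proof (rule that[of F F' \<delta> "8 * W" C'])
    show "norm (dbar F z) \<le> C' * ((\<Prod>j<q. \<sigma> j) * (8 * W * (\<delta> / 2 ^ Suc k)) ^ q) / (\<delta> / 2 ^ Suc k)"
      if z: "infdist z (cemb ` U) < \<delta> / 2 ^ Suc k" for k q z
    proof -
      have dk: "\<delta> / 2 ^ Suc k = d (Suc k)" by (simp add: d_def)
      have "norm (dbar F z) \<le> real CARD('n) * (C * \<epsilon> (Suc k))" by (rule dbar) (use z in \<open>simp only: X_def dk\<close>)
      also have "\<dots> = C' * H (Suc k) / d (Suc k)" by (simp add: C'_def \<epsilon>_def)
      also have "\<dots> \<le> C' * (l q * t (Suc k) ^ q) / d (Suc k)"
        using C C1(2) d0[of "Suc k"] by (intro divide_right_mono mult_left_mono Hmin) (auto simp: C'_def)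
      finally show ?thesis unfolding dk by (simp add: l_def t_def)
    qed
    \<comment> \<open>At distance 0 the estimate holds at every scale, and its right-hand side tends
      to 0.\<close>
    show "dbar F z = 0" if z: "infdist z (cemb ` U) = 0" for z
    proof -
      have le: "\<epsilon> k \<le> \<epsilon> 0 * (1/2) ^ k" for k by (induction k) (use \<epsilon>half in \<open>auto intro: order_trans\<close>)
      have "(\<lambda>k. \<epsilon> 0 * (1/2) ^ k) \<longlonglongrightarrow> \<epsilon> 0 * 0" by (intro tendsto_intros) auto
      then have "\<epsilon> \<longlonglongrightarrow> 0"
        using tendsto_sandwich[of "\<lambda>_. 0" \<epsilon> sequentially "\<lambda>k. \<epsilon> 0 * (1/2) ^ k" 0] le \<epsilon>0 by simp
      then have lim0: "(\<lambda>k. real CARD('n) * (C * \<epsilon> (Suc k))) \<longlonglongrightarrow> real CARD('n) * (C * 0)"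
        by (intro tendsto_intros LIMSEQ_Suc)
      have "norm (dbar F z) \<le> real CARD('n) * (C * \<epsilon> (Suc k))" for k
        using dbar[of z k] z d0[of "Suc k"] by (simp add: X_def)
      then have "norm (dbar F z) \<le> real CARD('n) * (C * 0)" by (intro LIMSEQ_le_const[OF lim0]) blast
      then show ?thesis by simp
    qed
    show "0 \<le> C'" using C C1(2) by (simp add: C'_def)
  qed (use F Ff \<delta> W1 in auto)
qed

text \<open>Raising the index by one costs only a geometric factor, which a change of
  \<open>\<rho>\<close> absorbs. The favourable factor \<open>k + 1\<close> from the factorials is
  given away.\<close>

lemma small_m_growth:
  assumes M: "weight_sequence M" and B: "\<And>k. root (Suc k) (M (Suc k) / M k) \<le> B" and B1: "1 \<le> B"
  shows "small_m M (Suc k) \<le> B ^ Suc k * small_m M k"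
proof -
  have pos: "0 < M k" "0 < M (Suc k)" using weight_sequence_pos[OF M] by auto
  have "root (Suc k) (M (Suc k) / M k) ^ Suc k \<le> B ^ Suc k"
    using B[of k] pos by (intro power_mono) auto
  then have "M (Suc k) / M k \<le> B ^ Suc k" using pos by (simp only: real_root_pow_pos2 zero_less_Suc divide_nonneg_nonneg less_imp_le)
  then have "M (Suc k) \<le> B ^ Suc k * M k" using pos by (simp add: pos_divide_le_eq)
  moreover have "M (Suc k) / fact (Suc k) \<le> M (Suc k) / fact k"
    using pos by (intro divide_left_mono fact_mono) auto
  ultimately have "M (Suc k) / fact (Suc k) \<le> B ^ Suc k * M k / fact k"
    by (meson divide_right_mono fact_ge_zero order_trans)
  then show ?thesis by (simp add: small_m_def)
qed

text \<open>The bound from the gluing contains a division by the scale \<open>d\<close>. Applied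
  with exponent \<open>q + 1\<close> it still leaves \<open>d ^ q\<close>, and the growth condition
  replaces the weight of index \<open>q + 1\<close> by the one of index \<open>q\<close>.\<close>

lemma extension_if_beurling:
  fixes M :: "nat \<Rightarrow> real" and U :: "(real ^ 'n::finite) set" and f :: "real ^ 'n \<Rightarrow> complex"
  assumes M: "weight_sequence M" "strongly_log_convex M"
    and lim: "filterlim (\<lambda>k. root k (small_m M k)) at_top sequentially"
    and growth: "\<exists>B. \<forall>k. root (Suc k) (M (Suc k) / M k) \<le> B"
    and U: "D_domain U" and f: "f \<in> beurling_class M U"
  shows "\<exists>F. C1c F \<and> (\<forall>x\<in>U. F (cemb x) = f x) \<and>
      (\<forall>\<rho>>0. \<exists>C\<ge>1. \<forall>z. norm (dbar F z) \<le> C * h_fun (small_m M) (\<rho> * infdist z (cemb ` closure U)))"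
proof -
  have U': "U \<noteq> {}" "bounded U" "open U" "quasiconvex U" using U by (auto simp: D_domain_def)
  have sm: "smooth_on U f" using f by (simp add: beurling_class_def)
  have mpos: "0 < small_m M k" for k by (rule small_m_pos[OF M(1)])
  obtain S where S: "\<And>k. 0 \<le> S k" "\<And>is x. x \<in> U \<Longrightarrow> norm (partials is f x) \<le> S (length is)"
    "\<And>\<rho>. 0 < \<rho> \<Longrightarrow> \<exists>C. \<forall>k. S k \<le> C * \<rho> ^ k * M k"
    using partials_sup_bound[OF f U'(3,1) weight_sequence_pos[OF M(1)]] by blast
  have "\<exists>C. \<forall>k. S k / fact k \<le> C * \<rho> ^ k * small_m M k" if r: "0 < \<rho>" for \<rho>
  proof -
    obtain C where "\<And>k. S k \<le> C * \<rho> ^ k * M k" using S(3)[OF r] by blast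
    then have "S k / fact k \<le> C * \<rho> ^ k * small_m M k" for k
      using divide_right_mono[of "S k" "C * \<rho> ^ k * M k" "fact k"] by (simp add: small_m_def)
    then show ?thesis by blast
  qed
  then obtain \<sigma> C1 where \<sigma>: "incseq \<sigma>" "\<And>k. 0 < \<sigma> k" "filterlim \<sigma> at_top sequentially"
    and C1: "\<And>k. S k / fact k \<le> C1 * (\<Prod>j<k. \<sigma> j)" "0 \<le> C1"
    and l: "\<And>\<rho>. 0 < \<rho> \<Longrightarrow> \<exists>C\<ge>0. \<forall>k. (\<Prod>j<k. \<sigma> j) \<le> C * \<rho> ^ k * small_m M k"
    using intermediate_log_convex_weight[OF mpos incseq_small_m_quotient[OF M] lim, of "\<lambda>k. S k / fact k"] S(1)
    by (metis divide_nonneg_nonneg fact_ge_zero)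
  obtain F F' \<delta> W C where F: "\<And>z. (F has_derivative F' z) (at z)" "\<And>v. continuous_on UNIV (\<lambda>z. F' z v)"
    "compact (closure {z. F z \<noteq> 0})" and Ff: "\<And>x. x \<in> U \<Longrightarrow> F (cemb x) = f x"
    and \<delta>: "0 < \<delta>" and W: "0 < W" and C: "0 \<le> C"
    and near: "\<And>k q z. infdist z (cemb ` U) < \<delta> / 2 ^ Suc k \<Longrightarrow>
      norm (dbar F z) \<le> C * ((\<Prod>j<q. \<sigma> j) * (W * (\<delta> / 2 ^ Suc k)) ^ q) / (\<delta> / 2 ^ Suc k)"
    and zero: "\<And>z. infdist z (cemb ` U) = 0 \<Longrightarrow> dbar F z = 0"
    using taylor_extension[OF U' sm S(1,2) \<sigma> C1] by blast
  obtain R where R: "\<And>z. norm (dbar F z) \<le> R" using dbar_bounded[OF F] by (auto simp: bounded_iff)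
  have R0: "0 \<le> R" using order_trans[OF norm_ge_zero R] .
  obtain B0 where B0: "\<And>k. root (Suc k) (M (Suc k) / M k) \<le> B0" using growth by blast
  define B where "B = max B0 1"
  have B: "1 \<le> B" "root (Suc k) (M (Suc k) / M k) \<le> B" for k using B0[of k] by (auto simp: B_def)
  have main: "\<exists>C'\<ge>1. \<forall>z. norm (dbar F z) \<le> C' * h_fun (small_m M) (\<rho> * infdist z (cemb ` closure U))"
    if \<rho>: "0 < \<rho>" for \<rho>
  proof -
    \<comment> \<open>\<open>W\<close> comes from the extension, \<open>B\<close> from the growth
      condition and 2 from \<open>d \<le> 2 * D\<close>.\<close>
    define \<rho>' where "\<rho>' = \<rho> / (2 * W * B)"
    have \<rho>': "0 < \<rho>'" using \<rho> W B by (simp add: \<rho>'_def)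
    obtain Cl where Cl: "0 \<le> Cl" "\<And>k. (\<Prod>j<k. \<sigma> j) \<le> Cl * \<rho>' ^ k * small_m M k" using l[OF \<rho>'] by blast
    define A where "A = C * Cl * \<rho> + 1"
    have A: "0 < A" using C Cl \<rho> by (simp add: A_def add_nonneg_pos)
    define h0 where "h0 = h_fun (small_m M) (\<rho> * (\<delta> / 2))"
    have h0: "0 < h0" unfolding h0_def by (rule h_fun_pos[OF mpos lim]) (use \<rho> \<delta> in simp)
    have "norm (dbar F z) \<le> (1 + A + R / h0) * h_fun (small_m M) (\<rho> * infdist z (cemb ` closure U))" for z
    proof -
      define D where "D = infdist z (cemb ` U)"
      have D0: "0 \<le> D" by (simp add: D_def infdist_nonneg)
      define h where "h = h_fun (small_m M) (\<rho> * D)"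
      have hn: "0 \<le> h" unfolding h_def by (rule h_fun_nonneg[OF mpos]) (use \<rho> D0 in simp)
      \<comment> \<open>At distance 0 the antiholomorphic derivative vanishes; far away
        \<open>h\<close> is bounded below by \<open>h0\<close> and boundedness suffices; only in
        between is the dyadic estimate used.\<close>
      consider "D = 0" | "0 < D" "D < \<delta> / 2" | "\<delta> / 2 \<le> D" using D0 by linarith
      then have "norm (dbar F z) \<le> A * h \<or> norm (dbar F z) \<le> R / h0 * h"
      proof cases
        case 1
        then show ?thesis using zero[of z] A hn by (simp add: D_def)
      next
        case 3
        have "h0 \<le> h" unfolding h_def h0_def by (rule h_fun_mono[OF mpos]) (use 3 \<rho> \<delta> in auto)
        then have "R / h0 * h0 \<le> R / h0 * h" using R0 h0 by (intro mult_left_mono) auto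
        then show ?thesis using R[of z] h0 by simp
      next
        case 2
        obtain n where "\<delta> / D < 2 ^ n" using real_arch_pow[of 2 "\<delta> / D"] by auto
        then have "\<delta> / 2 ^ n \<le> D" using 2 by (simp add: field_simps)
        then have ex: "\<exists>n. \<delta> / 2 ^ n \<le> D" by blast
        \<comment> \<open>Selects the dyadic scale \<open>d\<close> with
          \<open>D < d \<le> 2 * D\<close>. Since \<open>D < \<delta> / 2\<close>, \<open>N\<close>
          is at least 2, as needed because the estimates start at scale
          \<open>\<delta> / 2\<close>.\<close>
        define N where "N = (LEAST n. \<delta> / 2 ^ n \<le> D)"
        have N: "\<delta> / 2 ^ N \<le> D" unfolding N_def by (rule LeastI_ex[OF ex])
        have "N \<noteq> 0" using N 2 \<delta> by (cases "N = 0") auto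
        moreover have "N \<noteq> 1" using N 2 by (cases "N = 1") auto
        ultimately obtain k where k: "N = Suc (Suc k)" by (metis One_nat_def not0_implies_Suc)
        define d where "d = \<delta> / 2 ^ Suc k"
        have d: "0 < d" using \<delta> by (simp add: d_def)
        have dD: "d \<le> 2 * D" using N by (simp add: k d_def)
        have Dd: "D < d" using not_less_Least[of "Suc k" "\<lambda>n. \<delta> / 2 ^ n \<le> D"] k by (simp add: N_def[symmetric] d_def)
        have "norm (dbar F z) / A \<le> small_m M q * (\<rho> * D) ^ q" for q
        proof -
          have "norm (dbar F z) \<le> C * ((\<Prod>j<Suc q. \<sigma> j) * (W * d) ^ Suc q) / d"
            unfolding d_def by (rule near) (use Dd in \<open>simp add: D_def d_def\<close>)
          also have "\<dots> \<le> C * ((Cl * \<rho>' ^ Suc q * (B ^ Suc q * small_m M q)) * (W * d) ^ Suc q) / d"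
          proof (intro divide_right_mono mult_left_mono mult_right_mono)
            have "(\<Prod>j<Suc q. \<sigma> j) \<le> Cl * \<rho>' ^ Suc q * small_m M (Suc q)" by (rule Cl(2))
            also have "\<dots> \<le> Cl * \<rho>' ^ Suc q * (B ^ Suc q * small_m M q)"
              using Cl(1) \<rho>' by (intro mult_left_mono small_m_growth[OF M(1) B(2,1)]) auto
            finally show "(\<Prod>j<Suc q. \<sigma> j) \<le> Cl * \<rho>' ^ Suc q * (B ^ Suc q * small_m M q)" .
          qed (use C W d in auto)
          also have "\<dots> = C * Cl * small_m M q * (\<rho>' * B * W * d) ^ Suc q / d" by (simp add: power_mult_distrib)
          also have "\<rho>' * B * W * d = \<rho> * (d / 2)" using W B(1) by (simp add: \<rho>'_def)
          also have "C * Cl * small_m M q * (\<rho> * (d / 2)) ^ Suc q / d = C * Cl * \<rho> / 2 * (small_m M q * (\<rho> * (d / 2)) ^ q)"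
            using d by simp
          also have "\<dots> \<le> A * (small_m M q * (\<rho> * D) ^ q)"
          proof (intro mult_mono)
            show "C * Cl * \<rho> / 2 \<le> A" using C Cl(1) \<rho> mult_nonneg_nonneg[of "C * Cl" \<rho>] by (simp add: A_def)
            show "(\<rho> * (d / 2)) ^ q \<le> (\<rho> * D) ^ q" using dD d \<rho> by (intro power_mono mult_left_mono) auto
          qed (use A d \<rho> mpos[of q] in \<open>auto simp: less_imp_le\<close>)
          finally show ?thesis using A by (simp add: pos_divide_le_eq mult.commute)
        qed
        then have "norm (dbar F z) / A \<le> h" unfolding h_def by (intro h_fun_ge) (use \<rho> 2 in auto)
        then show ?thesis using A by (simp add: pos_divide_le_eq mult.commute)
      qed
      moreover have "A * h \<le> (1 + A + R / h0) * h" "R / h0 * h \<le> (1 + A + R / h0) * h"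
        using A R0 h0 hn by (intro mult_right_mono; simp)+
      ultimately have "norm (dbar F z) \<le> (1 + A + R / h0) * h" by linarith
      then show ?thesis by (simp add: h_def D_def infdist_cemb_closure)
    qed
    moreover have "1 \<le> 1 + A + R / h0" using A R0 h0 by simp
    ultimately show ?thesis by blast
  qed
  have "C1c F" unfolding C1c_def using F by blast
  then show ?thesis using Ff main by blast
qed

section \<open>Averages over tori\<close>

definition torus_box :: "(real ^ 'n) set" where
  "torus_box = cbox 0 (\<chi> i. 2 * pi)"

definition torus_point :: "real ^ 'n \<Rightarrow> complex ^ 'n" where
  "torus_point \<theta> = (\<chi> j. cis (\<theta> $ j))"

text \<open>The character with minus the multi-index counted by the list as its frequency, so that
  integration against it extracts a Fourier coefficient.\<close>

definition torus_char :: "'n list \<Rightarrow> real ^ 'n \<Rightarrow> complex" where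
  "torus_char is \<theta> = cis (- (\<Sum>i\<leftarrow>is. \<theta> $ i))"

text \<open>Periodicity makes the integral of a translate independent of the shift; differentiating
  under the integral at shift 0 gives the claim. This is integration by parts on the torus, without
  boundary terms.\<close>

lemma integral_periodic_derivative:
  fixes G :: "real ^ 'n \<Rightarrow> complex"
  assumes d: "\<And>x. ((\<lambda>t. G (x + t *\<^sub>R axis j 1)) has_vector_derivative G' x) (at 0)"
    and c: "continuous_on UNIV G" "continuous_on UNIV G'"
    and per: "\<And>x. G (x + (2 * pi) *\<^sub>R axis j 1) = G x"
  shows "integral torus_box G' = 0"
proof -
  define e :: "real ^ 'n" where "e = axis j 1"
  define b :: "real ^ 'n" where "b = (\<chi> i. 2 * pi)"
  have e: "e \<in> Basis" by (simp add: e_def axis_in_Basis_iff)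
  have ej: "x \<bullet> e = x $ j" for x by (simp add: e_def inner_axis)
  have int: "G integrable_on cbox u v" for u v
    by (rule integrable_continuous) (rule continuous_on_subset[OF c(1)], simp)
  define H where "H s = integral (cbox 0 b) (\<lambda>x. G (x + s *\<^sub>R e))" for s
  have Hconst: "H s = H 0" if s: "s \<in> {0..2 * pi}" for s
  proof -
    have sh: "integral (cbox u v) (\<lambda>x. G (x + s *\<^sub>R e)) = integral (cbox (u + s *\<^sub>R e) (v + s *\<^sub>R e)) G" for u v s
      using integral_shift_cbox[of "u + s *\<^sub>R e" "s *\<^sub>R e" "v + s *\<^sub>R e" G] by simp
    \<comment> \<open>The box is lengthened by \<open>s\<close> in direction \<open>e\<close> and
      cut once at height \<open>2 * pi\<close> and once at height \<open>s\<close>; the two end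
      pieces removed in this way differ by a period.\<close>
    let ?T = "cbox 0 (b + s *\<^sub>R e)"
    have mem: "x \<in> cbox u v \<longleftrightarrow> u $ j \<le> x $ j \<and> x $ j \<le> v $ j \<and> (\<forall>i. i \<noteq> j \<longrightarrow> u $ i \<le> x $ i \<and> x $ i \<le> v $ i)"
      for x u v :: "real ^ 'n"
      unfolding mem_box_cart by metis
    have s1: "?T \<inter> {x. x \<bullet> e \<le> 2 * pi} = cbox 0 b" "?T \<inter> {x. x \<bullet> e \<ge> 2 * pi} = cbox ((2 * pi) *\<^sub>R e) (b + s *\<^sub>R e)"
      "?T \<inter> {x. x \<bullet> e \<le> s} = cbox 0 (b + s *\<^sub>R e - (2 * pi) *\<^sub>R e)" "?T \<inter> {x. x \<bullet> e \<ge> s} = cbox (0 + s *\<^sub>R e) (b + s *\<^sub>R e)"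
      unfolding ej using s by (auto simp: mem b_def e_def axis_def)
    have "integral ?T G = integral (cbox 0 b) G + integral (cbox ((2 * pi) *\<^sub>R e) (b + s *\<^sub>R e)) G"
      using integral_split[OF int e, of 0 "b + s *\<^sub>R e" "2 * pi"] by (simp only: s1)
    moreover have "integral ?T G = integral (cbox 0 (b + s *\<^sub>R e - (2 * pi) *\<^sub>R e)) G + integral (cbox (0 + s *\<^sub>R e) (b + s *\<^sub>R e)) G"
      using integral_split[OF int e, of 0 "b + s *\<^sub>R e" s] by (simp only: s1)
    moreover have "integral (cbox ((2 * pi) *\<^sub>R e) (b + s *\<^sub>R e)) G = integral (cbox 0 (b + s *\<^sub>R e - (2 * pi) *\<^sub>R e)) G"
      using sh[of 0 "b + s *\<^sub>R e - (2 * pi) *\<^sub>R e" "2 * pi"] per by (simp add: e_def)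
    ultimately show ?thesis unfolding H_def sh by simp
  qed
  have "(H has_vector_derivative integral (cbox 0 b) (\<lambda>x. G' (x + 0 *\<^sub>R e))) (at 0 within {0..2 * pi})"
    unfolding H_def[abs_def]
  proof (rule leibniz_rule_vector_derivative[where fx="\<lambda>s x. G' (x + s *\<^sub>R e)"])
    show "((\<lambda>s. G (x + s *\<^sub>R e)) has_vector_derivative G' (x + s *\<^sub>R e)) (at s within {0..2 * pi})" for x s
      unfolding e_def by (rule directional_derivative_shift) (rule d)
    show "(\<lambda>x. G (x + s *\<^sub>R e)) integrable_on cbox 0 b" for s
      by (rule integrable_continuous, rule continuous_on_compose2[OF c(1)]) (auto intro!: continuous_intros)
    show "continuous_on ({0..2 * pi} \<times> cbox 0 b) (\<lambda>(s, x). G' (x + s *\<^sub>R e))"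
      unfolding case_prod_unfold by (rule continuous_on_compose2[OF c(2)]) (auto intro!: continuous_intros)
  qed auto
  moreover have "(H has_vector_derivative 0) (at 0 within {0..2 * pi})"
    by (rule has_vector_derivative_transform[OF _ Hconst has_vector_derivative_const]) auto
  ultimately have "integral (cbox 0 b) (\<lambda>x. G' (x + 0 *\<^sub>R e)) = 0"
    using vector_derivative_unique_within_closed_interval[of 0 "2 * pi" 0 H] by simp
  then show ?thesis by (simp add: torus_box_def b_def)
qed

lemma torus_char_Nil [simp]: "torus_char [] \<theta> = 1"
  by (simp add: torus_char_def)

lemma torus_char_Cons: "torus_char (j # is) \<theta> = cis (- \<theta> $ j) * torus_char is \<theta>"
  by (simp add: torus_char_def cis_mult)

lemma norm_torus_char [simp]: "norm (torus_char is \<theta>) = 1"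
  by (simp add: torus_char_def)

lemma sum_list_shift: "(\<Sum>i\<leftarrow>is. (\<theta> + t *\<^sub>R axis j 1) $ i) = (\<Sum>i\<leftarrow>is. \<theta> $ i) + t * real (count_list is j)"
  by (induction "is") (auto simp: axis_def algebra_simps)

lemma torus_char_derivative:
  "((\<lambda>t. torus_char is (\<theta> + t *\<^sub>R axis j 1)) has_vector_derivative - \<i> * of_nat (count_list is j) * torus_char is \<theta>) (at 0)"
  unfolding torus_char_def sum_list_shift has_vector_derivative_def
  by (auto intro!: derivative_eq_intros simp: scaleR_conv_of_real algebra_simps)

lemma torus_char_periodic: "torus_char is (\<theta> + (2 * pi) *\<^sub>R axis j 1) = torus_char is \<theta>"
proof -
  have "cis (- (a + 2 * pi * real k)) = cis (- a)" for a k
  proof -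
    have "cis (- (a + 2 * pi * real k)) = cis (- a) * cis (2 * pi * of_int (- int k))" by (simp add: cis_mult)
    also have "cis (2 * pi * of_int (- int k)) = 1" by (rule cis_multiple_2pi) simp
    finally show ?thesis by simp
  qed
  then show ?thesis unfolding torus_char_def sum_list_shift by simp
qed

lemma torus_char_continuous [continuous_intros]: "continuous_on A (torus_char is)"
proof (induction "is")
  case (Cons j "is")
  then show ?case unfolding torus_char_Cons[abs_def] by (intro continuous_intros)
qed simp

lemma torus_point_continuous [continuous_intros]: "continuous_on A torus_point"
  unfolding torus_point_def by (intro continuous_intros)

lemma torus_point_shift:
  "torus_point (\<theta> + t *\<^sub>R axis j 1) = torus_point \<theta> + axis j (cis (\<theta> $ j + t) - cis (\<theta> $ j))"
  by (auto simp: torus_point_def axis_def vec_eq_iff)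

lemma torus_point_periodic: "torus_point (\<theta> + (2 * pi) *\<^sub>R axis j 1) = torus_point \<theta>"
  unfolding torus_point_shift by (simp add: cis_mult[symmetric] axis_def vec_eq_iff)

lemma norm_torus_point_le: "norm (torus_point (\<theta> :: real ^ 'n)) \<le> real CARD('n)"
proof -
  have "norm (torus_point \<theta>) \<le> (\<Sum>j\<in>UNIV. norm (torus_point \<theta> $ j))"
    unfolding norm_vec_def by (rule L2_set_le_sum) simp
  then show ?thesis by (simp add: torus_point_def)
qed

lemma bounded_linear_axis: "bounded_linear (axis j :: complex \<Rightarrow> complex ^ 'n)"
  by (rule bounded_linear_intro[of _ 1])
    (auto simp: axis_def vec_eq_iff norm_vec_def L2_set_def if_distrib[of norm] if_distribR if_distrib[of "\<lambda>x. x^2"] cong: if_cong)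

section \<open>Torus averages and their derivatives\<close>

locale wirtinger_derivatives =
  fixes F :: "complex ^ 'n \<Rightarrow> complex" and D Db :: "'n \<Rightarrow> complex ^ 'n \<Rightarrow> complex"
  assumes dF: "\<And>z. (F has_derivative (\<lambda>v. \<Sum>j\<in>UNIV. v $ j * D j z + cnj (v $ j) * Db j z)) (at z)"
    and cD: "\<And>j. continuous_on UNIV (D j)" and cDb: "\<And>j. continuous_on UNIV (Db j)"
begin

lemma cF: "continuous_on UNIV F"
  by (rule has_derivative_continuous_on) (rule has_derivative_at_withinI[OF dF])

lemma F_along_curve:
  assumes "(\<gamma> has_vector_derivative w) (at s within A)"
  shows "((\<lambda>s. F (\<gamma> s)) has_vector_derivative (\<Sum>j\<in>UNIV. w $ j * D j (\<gamma> s) + cnj (w $ j) * Db j (\<gamma> s))) (at s within A)"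
proof -
  have "((\<lambda>s. F (\<gamma> s)) has_derivative (\<lambda>h. \<Sum>j\<in>UNIV. (h *\<^sub>R w) $ j * D j (\<gamma> s) + cnj ((h *\<^sub>R w) $ j) * Db j (\<gamma> s))) (at s within A)"
    using has_derivative_compose[OF assms[unfolded has_vector_derivative_def] dF] .
  then show ?thesis unfolding has_vector_derivative_def
    by (rule has_derivative_eq_rhs) (auto simp: fun_eq_iff scaleR_sum_right algebra_simps)
qed

definition pt :: "real ^ 'n \<Rightarrow> real \<Rightarrow> real ^ 'n \<Rightarrow> complex ^ 'n" where
  "pt x r \<theta> = cemb x + r *\<^sub>R torus_point \<theta>"

text \<open>The unnormalized Fourier coefficient of \<open>F\<close> on the torus of radius
  \<open>r\<close> around \<open>x\<close>. For holomorphic \<open>F\<close> it would be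
  \<open>r ^ length is\<close> times a Taylor coefficient, up to the volume of the torus.\<close>

definition I :: "'n list \<Rightarrow> real ^ 'n \<Rightarrow> real \<Rightarrow> complex" where
  "I is x r = integral torus_box (\<lambda>\<theta>. F (pt x r \<theta>) * torus_char is \<theta>)"

lemma cont_pt [continuous_intros]: "continuous_on A (pt x r)"
  unfolding pt_def by (intro continuous_intros)

lemma axis_sum: "(\<Sum>k\<in>UNIV. axis j a $ k * D k z + cnj (axis j a $ k) * Db k z) = a * D j z + cnj a * Db j z"
  by (simp add: axis_def sum.distrib if_distrib if_distribR sum.If_cases[of UNIV] cong: if_cong)

lemma integrable_torus: "continuous_on UNIV g \<Longrightarrow> (g :: real ^ 'n \<Rightarrow> complex) integrable_on torus_box"
  unfolding torus_box_def by (rule integrable_continuous) (rule continuous_on_subset, auto)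

lemma cont_D_pt: "continuous_on A (\<lambda>\<theta>. D j (pt x r \<theta>))" "continuous_on A (\<lambda>\<theta>. Db j (pt x r \<theta>))" "continuous_on A (\<lambda>\<theta>. F (pt x r \<theta>))"
  by (rule continuous_on_compose2[OF cD cont_pt] continuous_on_compose2[OF cDb cont_pt] continuous_on_compose2[OF cF cont_pt]; simp)+

text \<open>Integration by parts in the angle \<open>\<theta> $ j\<close>; the right-hand side is
  the derivative falling on the character.\<close>

lemma angular_identity:
  "of_real r * integral torus_box (\<lambda>\<theta>. (cis (\<theta> $ j) * D j (pt x r \<theta>) - cis (- \<theta> $ j) * Db j (pt x r \<theta>)) * torus_char is \<theta>)
    = of_nat (count_list is j) * I is x r"
proof -
  let ?Q = "\<lambda>\<theta>. (cis (\<theta> $ j) * D j (pt x r \<theta>) - cis (- \<theta> $ j) * Db j (pt x r \<theta>)) * torus_char is \<theta>"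
  let ?P = "\<lambda>\<theta>. F (pt x r \<theta>) * torus_char is \<theta>"
  let ?G' = "\<lambda>\<theta>. \<i> * of_real r * ?Q \<theta> - \<i> * of_nat (count_list is j) * ?P \<theta>"
  have cQ: "continuous_on UNIV ?Q" and cP: "continuous_on UNIV ?P"
    by (intro continuous_intros cont_D_pt)+
  have "integral torus_box ?G' = 0"
  proof (rule integral_periodic_derivative[where G="?P"])
    fix \<theta> :: "real ^ 'n"
    have "((\<lambda>t. cis (\<theta> $ j + t)) has_vector_derivative \<i> * cis (\<theta> $ j)) (at 0)"
      unfolding has_vector_derivative_def by (auto intro!: derivative_eq_intros)
    then have "((\<lambda>t. cis (\<theta> $ j + t) - cis (\<theta> $ j)) has_vector_derivative \<i> * cis (\<theta> $ j) - 0) (at 0)"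
      by (intro has_vector_derivative_diff has_vector_derivative_const)
    then have "((\<lambda>t. axis j (cis (\<theta> $ j + t) - cis (\<theta> $ j)) :: complex ^ 'n) has_vector_derivative axis j (\<i> * cis (\<theta> $ j))) (at 0)"
      by (intro bounded_linear.has_vector_derivative[OF bounded_linear_axis]) simp
    then have "((\<lambda>t. r *\<^sub>R axis j (cis (\<theta> $ j + t) - cis (\<theta> $ j)) :: complex ^ 'n) has_vector_derivative r *\<^sub>R axis j (\<i> * cis (\<theta> $ j))) (at 0)"
      by (rule bounded_linear.has_vector_derivative[OF bounded_linear_scaleR_right])
    moreover have "r *\<^sub>R axis j (\<i> * cis (\<theta> $ j)) = (axis j (of_real r * \<i> * cis (\<theta> $ j)) :: complex ^ 'n)"
      by (simp add: axis_def vec_eq_iff scaleR_conv_of_real[where 'a=complex])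
    ultimately have "((\<lambda>t. pt x r \<theta> + r *\<^sub>R axis j (cis (\<theta> $ j + t) - cis (\<theta> $ j))) has_vector_derivative 0 + axis j (of_real r * \<i> * cis (\<theta> $ j))) (at 0)"
      by (intro has_vector_derivative_add has_vector_derivative_const) simp
    then have "((\<lambda>t. pt x r (\<theta> + t *\<^sub>R axis j 1)) has_vector_derivative axis j (of_real r * \<i> * cis (\<theta> $ j))) (at 0)"
      by (simp add: pt_def torus_point_shift scaleR_add_right add.assoc)
    from F_along_curve[OF this]
    have dFt: "((\<lambda>t. F (pt x r (\<theta> + t *\<^sub>R axis j 1))) has_vector_derivative
        of_real r * \<i> * cis (\<theta> $ j) * D j (pt x r \<theta>) + cnj (of_real r * \<i> * cis (\<theta> $ j)) * Db j (pt x r \<theta>)) (at 0)"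
      by (simp only: axis_sum) simp
    have "((\<lambda>t. ?P (\<theta> + t *\<^sub>R axis j 1)) has_vector_derivative
        F (pt x r \<theta>) * (- \<i> * of_nat (count_list is j) * torus_char is \<theta>)
        + (of_real r * \<i> * cis (\<theta> $ j) * D j (pt x r \<theta>) + cnj (of_real r * \<i> * cis (\<theta> $ j)) * Db j (pt x r \<theta>)) * torus_char is \<theta>) (at 0)"
      using has_vector_derivative_mult[OF dFt torus_char_derivative[of "is" \<theta> j]] by simp
    moreover have "F (pt x r \<theta>) * (- \<i> * of_nat (count_list is j) * torus_char is \<theta>)
        + (of_real r * \<i> * cis (\<theta> $ j) * D j (pt x r \<theta>) + cnj (of_real r * \<i> * cis (\<theta> $ j)) * Db j (pt x r \<theta>)) * torus_char is \<theta> = ?G' \<theta>"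
      by (simp add: cis_cnj algebra_simps)
    ultimately show "((\<lambda>t. ?P (\<theta> + t *\<^sub>R axis j 1)) has_vector_derivative ?G' \<theta>) (at 0)" by (simp only:)
    show "?P (\<theta> + (2 * pi) *\<^sub>R axis j 1) = ?P \<theta>" by (simp only: pt_def torus_point_periodic torus_char_periodic)
  qed (intro continuous_intros cont_D_pt)+
  also have "integral torus_box ?G' = \<i> * of_real r * integral torus_box ?Q - \<i> * of_nat (count_list is j) * integral torus_box ?P"
    by (subst integral_diff) (auto intro!: integrable_torus continuous_intros cont_D_pt)
  finally show ?thesis by (simp add: I_def mult.assoc)
qed

text \<open>The derivative in \<open>x\<close> produces \<open>D j + Db j\<close>. Here
  \<open>D j\<close> is \<open>cis (- \<theta> $ j)\<close> times the angular expression plus a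
  multiple of \<open>Db j\<close>. Absorbing the exponential into the character raises the
  multi-index by one, and the angular identity then removes \<open>D\<close> altogether.\<close>

lemma I_base_derivative:
  assumes r: "r \<noteq> 0"
  shows "((\<lambda>t. I is (x + t *\<^sub>R axis j 1) r) has_vector_derivative
    of_nat (Suc (count_list is j)) / of_real r * I (j # is) (x + s *\<^sub>R axis j 1) r
    + integral torus_box (\<lambda>\<theta>. (1 + cis (- 2 * \<theta> $ j)) * Db j (pt (x + s *\<^sub>R axis j 1) r \<theta>) * torus_char is \<theta>)) (at s within A)"
proof -
  let ?x = "\<lambda>t. x + t *\<^sub>R axis j 1"
  let ?Q = "\<lambda>t \<theta>. (D j (pt (?x t) r \<theta>) + Db j (pt (?x t) r \<theta>)) * torus_char is \<theta>"
  have ptx: "pt (?x t) r \<theta> = pt x r \<theta> + t *\<^sub>R axis j 1" for t \<theta>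
    by (simp add: pt_def linear_add[OF linear_cemb] linear_scale[OF linear_cemb]) (simp add: cemb_def axis_def vec_eq_iff)
  have "((\<lambda>t. integral torus_box (\<lambda>\<theta>. F (pt (?x t) r \<theta>) * torus_char is \<theta>)) has_vector_derivative integral torus_box (?Q s)) (at s within UNIV)"
    unfolding torus_box_def
  proof (rule leibniz_rule_vector_derivative)
    fix t \<theta>
    have "((\<lambda>t. pt x r \<theta> + t *\<^sub>R axis j 1) has_vector_derivative axis j 1) (at t)"
      by (auto intro!: derivative_eq_intros simp: has_vector_derivative_def)
    from F_along_curve[OF this]
    have "((\<lambda>t. F (pt (?x t) r \<theta>)) has_vector_derivative D j (pt (?x t) r \<theta>) + Db j (pt (?x t) r \<theta>)) (at t)"
      unfolding ptx by (simp only: axis_sum) simp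
    then show "((\<lambda>t. F (pt (?x t) r \<theta>) * torus_char is \<theta>) has_vector_derivative ?Q t \<theta>) (at t within UNIV)"
      by (rule bounded_linear.has_vector_derivative[OF bounded_linear_mult_left])
  next
    show "continuous_on (UNIV \<times> cbox 0 (\<chi> i. 2 * pi)) (\<lambda>(t, \<theta>). ?Q t \<theta>)"
      unfolding case_prod_unfold ptx unfolding pt_def
      by (intro continuous_intros continuous_on_compose2[OF cD] continuous_on_compose2[OF cDb] continuous_on_compose2[OF torus_char_continuous] continuous_on_compose2[OF torus_point_continuous]) auto
  qed (auto intro!: integrable_torus[unfolded torus_box_def] continuous_intros cont_D_pt)
  moreover have "integral torus_box (?Q s) = of_nat (Suc (count_list is j)) / of_real r * I (j # is) (?x s) r
    + integral torus_box (\<lambda>\<theta>. (1 + cis (- 2 * \<theta> $ j)) * Db j (pt (?x s) r \<theta>) * torus_char is \<theta>)"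
  proof -
    have "of_nat (count_list (j # is) j) * I (j # is) (?x s) r / of_real r
      = integral torus_box (\<lambda>\<theta>. (cis (\<theta> $ j) * D j (pt (?x s) r \<theta>) - cis (- \<theta> $ j) * Db j (pt (?x s) r \<theta>)) * torus_char (j # is) \<theta>)"
      using r unfolding angular_identity[symmetric] by simp
    moreover have "integral torus_box (?Q s) = integral torus_box (\<lambda>\<theta>.
        (cis (\<theta> $ j) * D j (pt (?x s) r \<theta>) - cis (- \<theta> $ j) * Db j (pt (?x s) r \<theta>)) * torus_char (j # is) \<theta>
        + (1 + cis (- 2 * \<theta> $ j)) * Db j (pt (?x s) r \<theta>) * torus_char is \<theta>)"
    proof (rule integral_cong)
      fix \<theta> :: "real ^ 'n"
      have c: "cis (\<theta> $ j) * cis (- \<theta> $ j) = 1" "cis (- \<theta> $ j) * cis (- \<theta> $ j) = cis (- 2 * \<theta> $ j)" by (simp_all add: cis_mult)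
      show "?Q s \<theta> = (cis (\<theta> $ j) * D j (pt (?x s) r \<theta>) - cis (- \<theta> $ j) * Db j (pt (?x s) r \<theta>)) * torus_char (j # is) \<theta>
        + (1 + cis (- 2 * \<theta> $ j)) * Db j (pt (?x s) r \<theta>) * torus_char is \<theta>"
        unfolding torus_char_Cons c(2)[symmetric] using c(1) by algebra
    qed
    moreover have "\<dots> = integral torus_box (\<lambda>\<theta>. (cis (\<theta> $ j) * D j (pt (?x s) r \<theta>) - cis (- \<theta> $ j) * Db j (pt (?x s) r \<theta>)) * torus_char (j # is) \<theta>)
       + integral torus_box (\<lambda>\<theta>. (1 + cis (- 2 * \<theta> $ j)) * Db j (pt (?x s) r \<theta>) * torus_char is \<theta>)"
      by (rule integral_add) (auto intro!: integrable_torus continuous_intros cont_D_pt)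
    ultimately show ?thesis by simp
  qed
  ultimately show ?thesis unfolding I_def[symmetric] by (simp add: has_vector_derivative_at_within)
qed

lemma sum_count_list: "(\<Sum>j\<in>UNIV. count_list is j) = length (is :: 'n list)"
  by (rule sum_count_set) auto

text \<open>In each coordinate the radial expression differs from the angular one only by the sign
  of the \<open>Db\<close> term. Summing the angular identities over \<open>j\<close> turns the
  counts into the length of the list.\<close>

lemma I_radial_derivative:
  assumes r: "r \<noteq> 0"
  shows "(I is x has_vector_derivative of_nat (length is) / of_real r * I is x r
    + 2 * (\<Sum>j\<in>UNIV. integral torus_box (\<lambda>\<theta>. cis (- \<theta> $ j) * Db j (pt x r \<theta>) * torus_char is \<theta>))) (at r within A)"
proof -
  let ?Q = "\<lambda>r \<theta>. (\<Sum>j\<in>UNIV. cis (\<theta> $ j) * D j (pt x r \<theta>) + cis (- \<theta> $ j) * Db j (pt x r \<theta>)) * torus_char is \<theta>"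
  let ?R = "\<lambda>j \<theta>. (cis (\<theta> $ j) * D j (pt x r \<theta>) - cis (- \<theta> $ j) * Db j (pt x r \<theta>)) * torus_char is \<theta>"
  let ?T = "\<lambda>j \<theta>. cis (- \<theta> $ j) * Db j (pt x r \<theta>) * torus_char is \<theta>"
  have "((\<lambda>r. integral torus_box (\<lambda>\<theta>. F (pt x r \<theta>) * torus_char is \<theta>)) has_vector_derivative integral torus_box (?Q r)) (at r within UNIV)"
    unfolding torus_box_def
  proof (rule leibniz_rule_vector_derivative)
    fix t \<theta>
    have "((\<lambda>t. pt x t \<theta>) has_vector_derivative torus_point \<theta>) (at t)"
      unfolding pt_def by (auto intro!: derivative_eq_intros simp: has_vector_derivative_def)
    from F_along_curve[OF this]
    have "((\<lambda>t. F (pt x t \<theta>)) has_vector_derivative (\<Sum>j\<in>UNIV. cis (\<theta> $ j) * D j (pt x t \<theta>) + cis (- \<theta> $ j) * Db j (pt x t \<theta>))) (at t)"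
      by (simp add: torus_point_def cis_cnj)
    then show "((\<lambda>t. F (pt x t \<theta>) * torus_char is \<theta>) has_vector_derivative ?Q t \<theta>) (at t within UNIV)"
      by (rule bounded_linear.has_vector_derivative[OF bounded_linear_mult_left, simplified])
  next
    show "continuous_on (UNIV \<times> cbox 0 (\<chi> i. 2 * pi)) (\<lambda>(t, \<theta>). ?Q t \<theta>)"
      unfolding case_prod_unfold pt_def
      by (intro continuous_intros continuous_on_compose2[OF cD] continuous_on_compose2[OF cDb] continuous_on_compose2[OF torus_char_continuous] continuous_on_compose2[OF torus_point_continuous]) auto
  qed (auto intro!: integrable_torus[unfolded torus_box_def] continuous_intros cont_D_pt)
  moreover have "integral torus_box (?Q r) = of_nat (length is) / of_real r * I is x r + 2 * (\<Sum>j\<in>UNIV. integral torus_box (?T j))"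
  proof -
    have "integral torus_box (?Q r) = integral torus_box (\<lambda>\<theta>. \<Sum>j\<in>UNIV. ?R j \<theta> + 2 * ?T j \<theta>)"
      by (rule integral_cong, unfold sum_distrib_right, rule sum.cong) (simp_all add: algebra_simps)
    also have "\<dots> = (\<Sum>j\<in>UNIV. integral torus_box (\<lambda>\<theta>. ?R j \<theta> + 2 * ?T j \<theta>))"
      by (rule integral_sum) (auto intro!: integrable_torus continuous_intros cont_D_pt)
    also have "\<dots> = (\<Sum>j\<in>UNIV. integral torus_box (?R j) + 2 * integral torus_box (?T j))"
    proof (rule sum.cong[OF refl])
      fix j
      show "integral torus_box (\<lambda>\<theta>. ?R j \<theta> + 2 * ?T j \<theta>) = integral torus_box (?R j) + 2 * integral torus_box (?T j)"
        by (subst integral_add) (auto intro!: integrable_torus continuous_intros cont_D_pt)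
    qed
    also have "\<dots> = (\<Sum>j\<in>UNIV. of_nat (count_list is j) * I is x r / of_real r) + 2 * (\<Sum>j\<in>UNIV. integral torus_box (?T j))"
    proof -
      have "integral torus_box (?R j) = of_nat (count_list is j) * I is x r / of_real r" for j
        using r unfolding angular_identity[symmetric] by simp
      then show ?thesis by (simp add: sum.distrib sum_distrib_left)
    qed
    also have "(\<Sum>j\<in>UNIV. of_nat (count_list is j) * I is x r / of_real r) = of_nat (length is) / of_real r * I is x r"
      by (simp add: sum_distrib_right[symmetric] sum_divide_distrib[symmetric] sum_count_list[symmetric])
    finally show ?thesis .
  qed
  ultimately show ?thesis unfolding I_def[abs_def, symmetric] by (simp add: has_vector_derivative_at_within I_def[abs_def])
qed

end

section \<open>Limits of the averages under a flatness condition\<close>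

lemma torus_content: "measure lborel (torus_box :: (real ^ 'n) set) = (2 * pi) ^ CARD('n)"
proof -
  have "(torus_box :: (real ^ 'n) set) \<noteq> {}"
    unfolding torus_box_def by (simp add: interval_ne_empty_cart)
  then show ?thesis unfolding torus_box_def by (simp add: content_cbox_cart)
qed

lemma torus_integral_bound:
  fixes g :: "real ^ 'n \<Rightarrow> complex"
  assumes "continuous_on UNIV g" "\<And>\<theta>. norm (g \<theta>) \<le> B"
  shows "norm (integral torus_box g) \<le> B * (2 * pi) ^ CARD('n)"
proof -
  have "(g has_integral integral torus_box g) torus_box"
    unfolding torus_box_def
    by (intro integrable_integral integrable_continuous continuous_on_subset[OF assms(1)]) simp
  moreover have "0 \<le> B" using order_trans[OF norm_ge_zero assms(2)] .
  ultimately show ?thesis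
    using has_integral_bound[of B g "integral torus_box g" 0 "\<chi> i. 2 * pi"] assms(2)
    by (simp add: torus_box_def[symmetric] torus_content)
qed

text \<open>The factorial \<open>\<alpha>!\<close> of the multi-index \<open>\<alpha>\<close> that counts the entries of the list.\<close>

fun coeff_factor :: "'n list \<Rightarrow> complex" where
  "coeff_factor [] = 1"
| "coeff_factor (j # is) = of_nat (Suc (count_list is j)) * coeff_factor is"

lemma coeff_factor_le: "norm (coeff_factor is) \<le> fact (length is)"
proof (induction "is")
  case (Cons j "is")
  have "norm (coeff_factor (j # is)) = real (Suc (count_list is j)) * norm (coeff_factor is)"
    by (simp only: coeff_factor.simps norm_mult norm_of_nat)
  also have "\<dots> \<le> real (Suc (length is)) * fact (length is)"
    by (intro mult_mono Cons.IH) (auto simp: count_le_length)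
  finally show ?case by simp
qed simp

text \<open>\<open>flat\<close> expresses the decay for each \<open>k\<close> separately instead of
  through \<open>h_fun\<close>, since every estimate below uses a single exponent: the length of a
  list or its successor.\<close>

locale flat_extension = wirtinger_derivatives F D Db
  for F :: "complex ^ 'n \<Rightarrow> complex" and D Db +
  fixes U :: "(real ^ 'n) set" and m :: "nat \<Rightarrow> real"
  assumes U: "open U" and m0: "\<And>k. 0 < m k"
    and flat: "\<And>\<rho>. 0 < \<rho> \<Longrightarrow> \<exists>C\<ge>0. \<forall>x\<in>U. \<forall>r>0. \<forall>\<theta> j k. norm (Db j (pt x r \<theta>)) \<le> C * m k * (\<rho> * r) ^ k"
begin

definition V :: real where "V = (2 * pi) ^ CARD('n)"

definition A :: "'n list \<Rightarrow> real ^ 'n \<Rightarrow> real \<Rightarrow> complex" where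
  "A is x r = inverse r ^ length is *\<^sub>R I is x r"

text \<open>The limit as the radius tends to 0, taken along a fixed sequence of radii; it is the
  candidate for \<open>V\<close> times a Taylor coefficient of \<open>f\<close>.\<close>

definition A0 :: "'n list \<Rightarrow> real ^ 'n \<Rightarrow> complex" where
  "A0 is x = lim (\<lambda>N. A is x (inverse (real (Suc N))))"

lemma V0: "0 < V" by (simp add: V_def)

text \<open>The normalization by a power of \<open>r\<close> cancels the homogeneous part of the
  radial derivative. What is left is an average of \<open>Db\<close>, whose decay makes up exactly
  for the negative power.\<close>

lemma A_lipschitz:
  assumes C: "\<And>x r \<theta> j k. x \<in> U \<Longrightarrow> 0 < r \<Longrightarrow> norm (Db j (pt x r \<theta>)) \<le> C * m k * (\<rho> * r) ^ k"
    and x: "x \<in> U" and r: "0 < a" "a \<le> b"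
  shows "norm (A is x b - A is x a) \<le> 2 * real CARD('n) * V * C * m (length is) * \<rho> ^ length is * (b - a)"
proof (rule vector_mvt_bound[OF r(2)])
  fix t assume t: "t \<in> {a..b}"
  then have t0: "0 < t" using r by simp
  let ?k = "length is"
  let ?T = "\<lambda>j. integral torus_box (\<lambda>\<theta>. cis (- \<theta> $ j) * Db j (pt x t \<theta>) * torus_char is \<theta>)"
  have inv: "((\<lambda>r. inverse r ^ ?k) has_field_derivative - (real ?k * inverse t ^ Suc ?k)) (at t within {a..b})"
  proof -
    have "(inverse has_field_derivative - (inverse t * inverse t)) (at t within {a..b})"
      using DERIV_inverse'[of "\<lambda>r. r" 1 t "{a..b}"] t0 by simp
    from DERIV_power[OF this, of ?k] show ?thesis
      by (rule DERIV_cong) (cases ?k; simp)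
  qed
  have "(A is x has_vector_derivative inverse t ^ ?k *\<^sub>R (of_nat ?k / of_real t * I is x t + 2 * (\<Sum>j\<in>UNIV. ?T j))
     + (- (real ?k * inverse t ^ Suc ?k)) *\<^sub>R I is x t) (at t within {a..b})"
    unfolding A_def[abs_def] by (rule has_vector_derivative_scaleR[OF inv I_radial_derivative]) (use t0 in simp)
  also have "inverse t ^ ?k *\<^sub>R (of_nat ?k / of_real t * I is x t + 2 * (\<Sum>j\<in>UNIV. ?T j))
     + (- (real ?k * inverse t ^ Suc ?k)) *\<^sub>R I is x t = inverse t ^ ?k *\<^sub>R (2 * (\<Sum>j\<in>UNIV. ?T j))"
    using t0 by (simp add: scaleR_conv_of_real field_simps)
  finally show "(A is x has_vector_derivative inverse t ^ ?k *\<^sub>R (2 * (\<Sum>j\<in>UNIV. ?T j))) (at t within {a..b})" .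
  have "norm (?T j) \<le> C * m ?k * (\<rho> * t) ^ ?k * V" for j
    unfolding V_def
  proof (rule torus_integral_bound)
    show "norm (cis (- \<theta> $ j) * Db j (pt x t \<theta>) * torus_char is \<theta>) \<le> C * m ?k * (\<rho> * t) ^ ?k" for \<theta>
      using C[OF x t0] by (simp add: norm_mult)
  qed (intro continuous_intros cont_D_pt)
  then have "norm (\<Sum>j\<in>UNIV. ?T j) \<le> (\<Sum>j\<in>(UNIV :: 'n set). C * m ?k * (\<rho> * t) ^ ?k * V)" by (intro sum_norm_le)
  also have "\<dots> = real CARD('n) * (C * m ?k * (\<rho> * t) ^ ?k * V)" by simp
  finally have T: "norm (\<Sum>j\<in>UNIV. ?T j) \<le> real CARD('n) * (C * m ?k * (\<rho> * t) ^ ?k * V)" .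
  have "norm (inverse t ^ ?k *\<^sub>R (2 * (\<Sum>j\<in>UNIV. ?T j))) = inverse t ^ ?k * (2 * norm (\<Sum>j\<in>UNIV. ?T j))"
    using t0 by (simp add: norm_mult)
  also have "\<dots> \<le> inverse t ^ ?k * (2 * (real CARD('n) * (C * m ?k * (\<rho> * t) ^ ?k * V)))"
    using t0 T by (intro mult_left_mono) auto
  also have "\<dots> = 2 * real CARD('n) * V * C * m ?k * \<rho> ^ ?k * (inverse t ^ ?k * t ^ ?k)" by (simp add: power_mult_distrib)
  also have "inverse t ^ ?k * t ^ ?k = 1" using t0 by (simp add: power_mult_distrib[symmetric])
  finally show "norm (inverse t ^ ?k *\<^sub>R (2 * (\<Sum>j\<in>UNIV. ?T j))) \<le> 2 * real CARD('n) * V * C * m ?k * \<rho> ^ ?k" by simp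
qed

text \<open>The Lipschitz bound in the radius is uniform in \<open>x\<close>, so the averages form a
  Cauchy sequence and the error is linear in \<open>r\<close>.\<close>

lemma A_limit:
  assumes C: "\<And>x r \<theta> j k. x \<in> U \<Longrightarrow> 0 < r \<Longrightarrow> norm (Db j (pt x r \<theta>)) \<le> C * m k * (\<rho> * r) ^ k"
    and C0: "0 \<le> C" "0 < \<rho>" and x: "x \<in> U"
  shows "(\<lambda>N. A is x (inverse (real (Suc N)))) \<longlonglongrightarrow> A0 is x"
    and "0 < r \<Longrightarrow> norm (A is x r - A0 is x) \<le> 2 * real CARD('n) * V * C * m (length is) * \<rho> ^ length is * r"
proof -
  define L where "L = 2 * real CARD('n) * V * C * m (length is) * \<rho> ^ length is"
  have L0: "0 \<le> L" using C0 V0 m0 by (simp add: L_def less_imp_le)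
  define rr where "rr N = inverse (real (Suc N))" for N
  have rr0: "0 < rr N" for N by (simp add: rr_def)
  have rr: "rr \<longlonglongrightarrow> 0" unfolding rr_def by (rule LIMSEQ_inverse_real_of_nat)
  have lip: "norm (A is x b - A is x a) \<le> L * \<bar>b - a\<bar>" if "0 < a" "0 < b" for a b
    using A_lipschitz[OF C x, of a b "is"] A_lipschitz[OF C x, of b a "is"] that
    by (cases "a \<le> b") (auto simp: L_def norm_minus_commute)
  have "Cauchy (\<lambda>N. A is x (rr N))"
  proof (rule CauchyI)
    fix e :: real assume e: "0 < e"
    obtain N where N: "\<And>i j. i \<ge> N \<Longrightarrow> j \<ge> N \<Longrightarrow> norm (rr i - rr j) < e / (L + 1)"
      using CauchyD[OF LIMSEQ_imp_Cauchy[OF rr], of "e / (L + 1)"] e L0 by auto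
    have "norm (A is x (rr i) - A is x (rr j)) < e" if "i \<ge> N" "j \<ge> N" for i j
    proof -
      have "norm (A is x (rr i) - A is x (rr j)) \<le> L * \<bar>rr i - rr j\<bar>" by (intro lip rr0)
      also have "\<dots> \<le> (L + 1) * \<bar>rr i - rr j\<bar>" by (intro mult_right_mono) auto
      also have "\<dots> < (L + 1) * (e / (L + 1))" using N[OF that] L0 by (intro mult_strict_left_mono) auto
      also have "\<dots> = e" using L0 by simp
      finally show ?thesis .
    qed
    then show "\<exists>M. \<forall>m\<ge>M. \<forall>n\<ge>M. norm (A is x (rr m) - A is x (rr n)) < e" by blast
  qed
  then have lim: "(\<lambda>N. A is x (rr N)) \<longlonglongrightarrow> A0 is x"
    unfolding A0_def rr_def[symmetric] by (simp add: Cauchy_convergent_iff convergent_LIMSEQ_iff)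
  then show "(\<lambda>N. A is x (inverse (real (Suc N)))) \<longlonglongrightarrow> A0 is x" by (simp add: rr_def)
  show "norm (A is x r - A0 is x) \<le> 2 * real CARD('n) * V * C * m (length is) * \<rho> ^ length is * r" if "0 < r"
  proof -
    have l1: "(\<lambda>N. norm (A is x r - A is x (rr N))) \<longlonglongrightarrow> norm (A is x r - A0 is x)" by (intro tendsto_intros lim)
    have l2: "(\<lambda>N. L * \<bar>r - rr N\<bar>) \<longlonglongrightarrow> L * \<bar>r - 0\<bar>" by (intro tendsto_intros rr)
    have "norm (A is x r - A0 is x) \<le> L * \<bar>r - 0\<bar>"
      by (rule LIMSEQ_le[OF l1 l2]) (use lip[OF rr0 that] in blast)
    then show ?thesis using that by (simp add: L_def)
  qed
qed

text \<open>For convergence alone \<open>\<rho> = 1\<close> suffices; other values matter only in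
  the final bound.\<close>

lemma A_uniform: "\<exists>L\<ge>0. \<forall>x\<in>U. \<forall>r>0. norm (A is x r - A0 is x) \<le> L * r"
  and A_tendsto: "x \<in> U \<Longrightarrow> (\<lambda>N. A is x (inverse (real (Suc N)))) \<longlonglongrightarrow> A0 is x"
proof -
  obtain C where C0: "0 \<le> C" and C: "\<And>x r \<theta> j k. x \<in> U \<Longrightarrow> 0 < r \<Longrightarrow> norm (Db j (pt x r \<theta>)) \<le> C * m k * (1 * r) ^ k"
    using flat[of 1] by auto
  have "0 \<le> 2 * real CARD('n) * V * C * m (length is) * 1 ^ length is"
    using C0 V0 m0[of "length is"] by simp
  then show "\<exists>L\<ge>0. \<forall>x\<in>U. \<forall>r>0. norm (A is x r - A0 is x) \<le> L * r"
    using A_limit(2)[OF C C0 zero_less_one] by blast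
  show "x \<in> U \<Longrightarrow> (\<lambda>N. A is x (inverse (real (Suc N)))) \<longlonglongrightarrow> A0 is x"
    by (rule A_limit(1)[OF C C0 zero_less_one])
qed

lemma A_base_derivative:
  assumes r: "0 < r"
  shows "((\<lambda>t. A is (x + t *\<^sub>R axis j 1) r) has_vector_derivative
    of_nat (Suc (count_list is j)) * A (j # is) (x + s *\<^sub>R axis j 1) r
    + inverse r ^ length is *\<^sub>R integral torus_box (\<lambda>\<theta>. (1 + cis (- 2 * \<theta> $ j)) * Db j (pt (x + s *\<^sub>R axis j 1) r \<theta>) * torus_char is \<theta>)) (at s within S)"
  unfolding A_def
  by (rule has_vector_derivative_eq_rhs, rule bounded_linear.has_vector_derivative[OF bounded_linear_scaleR_right I_base_derivative])
    (use r in \<open>auto simp: scaleR_add_right scaleR_conv_of_real field_simps\<close>)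

text \<open>Termwise differentiation: near \<open>x\<close> the derivatives of the approximating
  averages converge uniformly. Thus the limit of next higher order really is a derivative, although
  \<open>F\<close> is only C1.\<close>

lemma A0_derivative:
  assumes x: "x \<in> U"
  shows "((\<lambda>t. A0 is (x + t *\<^sub>R axis j 1)) has_vector_derivative of_nat (Suc (count_list is j)) * A0 (j # is) x) (at 0)"
proof -
  let ?x = "\<lambda>t. x + t *\<^sub>R axis j 1" and ?c = "real (Suc (count_list is j))"
  obtain L where L: "0 \<le> L" "\<And>x r. x \<in> U \<Longrightarrow> 0 < r \<Longrightarrow> norm (A (j # is) x r - A0 (j # is) x) \<le> L * r"
    using A_uniform[of "j # is"] by blast
  obtain C where C0: "0 \<le> C" and C: "\<And>x r \<theta> j k. x \<in> U \<Longrightarrow> 0 < r \<Longrightarrow> norm (Db j (pt x r \<theta>)) \<le> C * m k * (1 * r) ^ k"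
    using flat[of 1] by auto
  let ?k = "length is"
  \<comment> \<open>Flatness is used with exponent \<open>Suc ?k\<close>, one more than the power of
    \<open>inverse r\<close> in the remainder, which therefore still tends to 0 linearly.\<close>
  define K where "K = 2 * C * m (Suc ?k) * V"
  have K0: "0 \<le> K" using C0 V0 m0 by (simp add: K_def less_imp_le)
  define Rm where "Rm y r = inverse r ^ ?k *\<^sub>R integral torus_box (\<lambda>\<theta>. (1 + cis (- 2 * \<theta> $ j)) * Db j (pt y r \<theta>) * torus_char is \<theta>)" for y r
  have Rm: "norm (Rm y r) \<le> K * r" if y: "y \<in> U" and r: "0 < r" for y r
  proof -
    have "norm (integral torus_box (\<lambda>\<theta>. (1 + cis (- 2 * \<theta> $ j)) * Db j (pt y r \<theta>) * torus_char is \<theta>)) \<le> (2 * (C * m (Suc ?k) * r ^ Suc ?k)) * V"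
      unfolding V_def
    proof (rule torus_integral_bound)
      fix \<theta> :: "real ^ 'n"
      have "norm (1 + cis (- 2 * \<theta> $ j)) \<le> 2" using norm_triangle_ineq[of 1 "cis (- 2 * \<theta> $ j)"] by simp
      then have "norm (1 + cis (- 2 * \<theta> $ j)) * norm (Db j (pt y r \<theta>)) \<le> 2 * (C * m (Suc ?k) * r ^ Suc ?k)"
        using C[OF y r, of j \<theta> "Suc ?k"] by (intro mult_mono) auto
      then show "norm ((1 + cis (- 2 * \<theta> $ j)) * Db j (pt y r \<theta>) * torus_char is \<theta>) \<le> 2 * (C * m (Suc ?k) * r ^ Suc ?k)"
        by (simp add: norm_mult)
    qed (intro continuous_intros cont_D_pt)
    then have "norm (Rm y r) \<le> inverse r ^ ?k * ((2 * (C * m (Suc ?k) * r ^ Suc ?k)) * V)"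
      unfolding Rm_def using r by (simp add: mult_left_mono)
    also have "\<dots> = K * r * (inverse r ^ ?k * r ^ ?k)" by (simp add: K_def)
    also have "inverse r ^ ?k * r ^ ?k = 1" using r by (simp add: power_mult_distrib[symmetric])
    finally show ?thesis by simp
  qed
  obtain a where a: "0 < a" "ball x a \<subseteq> U" using U x open_contains_ball by blast
  define S where "S = {- a<..<a}"
  have xS: "?x t \<in> U" if "t \<in> S" for t
  proof -
    have "?x t \<in> ball x a" using that by (simp add: S_def dist_norm abs_less_iff)
    then show ?thesis using a by blast
  qed
  define rr where "rr N = inverse (real (Suc N))" for N
  have rr0: "0 < rr N" for N by (simp add: rr_def)
  have rr: "rr \<longlonglongrightarrow> 0" unfolding rr_def by (rule LIMSEQ_inverse_real_of_nat)
  have lim: "(\<lambda>N. A is y (rr N)) \<longlonglongrightarrow> A0 is y" if "y \<in> U" for y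
    using A_tendsto[OF that] unfolding rr_def .
  have "\<exists>g. \<forall>t\<in>S. (\<lambda>N. A is (?x t) (rr N)) \<longlonglongrightarrow> g t \<and>
      (g has_derivative (\<lambda>h. h *\<^sub>R (of_nat (Suc (count_list is j)) * A0 (j # is) (?x t)))) (at t within S)"
  proof (rule has_derivative_sequence)
    show "convex S" by (simp add: S_def)
    show "((\<lambda>t. A is (?x t) (rr N)) has_derivative (\<lambda>h. h *\<^sub>R (of_nat (Suc (count_list is j)) * A (j # is) (?x t) (rr N) + Rm (?x t) (rr N)))) (at t within S)" for N t
      using A_base_derivative[OF rr0, of "is" x j N t S] unfolding has_vector_derivative_def Rm_def .
    show "0 \<in> S" using a by (simp add: S_def)
    show "(\<lambda>N. A is (?x 0) (rr N)) \<longlonglongrightarrow> A0 is x" using lim[OF x] by simp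
    fix e :: real assume e: "0 < e"
    have "(\<lambda>N. (?c * L + K) * rr N) \<longlonglongrightarrow> (?c * L + K) * 0" by (intro tendsto_intros rr)
    then have "\<forall>\<^sub>F N in sequentially. (?c * L + K) * rr N < e" using e by (intro order_tendstoD) auto
    then show "\<forall>\<^sub>F N in sequentially. \<forall>t\<in>S. \<forall>h. norm (h *\<^sub>R (of_nat (Suc (count_list is j)) * A (j # is) (?x t) (rr N) + Rm (?x t) (rr N))
        - h *\<^sub>R (of_nat (Suc (count_list is j)) * A0 (j # is) (?x t))) \<le> e * norm h"
    proof eventually_elim
      case (elim N)
      show ?case
      proof (intro ballI allI)
        fix t h assume t: "t \<in> S"
        have "norm (of_nat (Suc (count_list is j)) * (A (j # is) (?x t) (rr N) - A0 (j # is) (?x t)) + Rm (?x t) (rr N))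
          \<le> ?c * (L * rr N) + K * rr N"
        proof (rule norm_triangle_le, rule add_mono)
          show "norm (of_nat (Suc (count_list is j)) * (A (j # is) (?x t) (rr N) - A0 (j # is) (?x t))) \<le> ?c * (L * rr N)"
            unfolding norm_mult norm_of_nat by (intro mult_left_mono L xS t rr0) simp
        qed (intro Rm xS t rr0)
        also have "\<dots> \<le> e" using elim by (simp add: algebra_simps)
        finally have le: "norm (of_nat (Suc (count_list is j)) * (A (j # is) (?x t) (rr N) - A0 (j # is) (?x t)) + Rm (?x t) (rr N)) \<le> e" .
        have "h *\<^sub>R (of_nat (Suc (count_list is j)) * A (j # is) (?x t) (rr N) + Rm (?x t) (rr N))
        - h *\<^sub>R (of_nat (Suc (count_list is j)) * A0 (j # is) (?x t)) =
          h *\<^sub>R (of_nat (Suc (count_list is j)) * (A (j # is) (?x t) (rr N) - A0 (j # is) (?x t)) + Rm (?x t) (rr N))"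
          by (simp add: algebra_simps del: of_nat_Suc)
        then show "norm (h *\<^sub>R (of_nat (Suc (count_list is j)) * A (j # is) (?x t) (rr N) + Rm (?x t) (rr N))
        - h *\<^sub>R (of_nat (Suc (count_list is j)) * A0 (j # is) (?x t))) \<le> e * norm h"
          using le by (simp only: norm_scaleR real_norm_def) (metis abs_ge_zero mult.commute mult_left_mono)
      qed
    qed
  qed
  then obtain g where g: "\<And>t. t \<in> S \<Longrightarrow> (\<lambda>N. A is (?x t) (rr N)) \<longlonglongrightarrow> g t"
    and dg: "\<And>t. t \<in> S \<Longrightarrow> (g has_derivative (\<lambda>h. h *\<^sub>R (of_nat (Suc (count_list is j)) * A0 (j # is) (?x t)))) (at t within S)"
    by blast
  have geq: "g t = A0 is (?x t)" if "t \<in> S" for t using LIMSEQ_unique[OF g[OF that] lim[OF xS[OF that]]] .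
  have S: "open S" "0 \<in> S" using a by (auto simp: S_def)
  have "(g has_vector_derivative of_nat (Suc (count_list is j)) * A0 (j # is) x) (at 0)"
    using dg[OF S(2)] at_within_open[OF S(2,1)] by (simp add: has_vector_derivative_def)
  then show ?thesis by (rule has_vector_derivative_transform_within_open[OF _ S]) (rule geq)
qed

lemma cont_cemb: "continuous_on S cemb"
  using linear_continuous_on linear_conv_bounded_linear linear_cemb by blast

lemma A0_continuous: "continuous_on U (A0 is)"
proof -
  obtain L where L: "0 \<le> L" "\<And>x r. x \<in> U \<Longrightarrow> 0 < r \<Longrightarrow> norm (A is x r - A0 is x) \<le> L * r"
    using A_uniform[of "is"] by blast
  define rr where "rr N = inverse (real (Suc N))" for N
  have rr0: "0 < rr N" for N by (simp add: rr_def)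
  have rr: "rr \<longlonglongrightarrow> 0" unfolding rr_def by (rule LIMSEQ_inverse_real_of_nat)
  have "continuous_on U (\<lambda>x. A is x r)" for r
    unfolding A_def I_def torus_box_def
  proof (intro continuous_intros integral_continuous_on_param)
    show "continuous_on (U \<times> cbox 0 (\<chi> i. 2 * pi)) (\<lambda>(x, \<theta>). F (pt x r \<theta>) * torus_char is \<theta>)"
      unfolding case_prod_unfold pt_def
      by (intro continuous_intros continuous_on_compose2[OF cF] continuous_on_compose2[OF cont_cemb] continuous_on_compose2[OF torus_char_continuous] continuous_on_compose2[OF torus_point_continuous]) auto
  qed
  moreover have "uniform_limit U (\<lambda>N x. A is x (rr N)) (A0 is) sequentially"
  proof (rule uniform_limitI)
    fix e :: real assume e: "0 < e"
    have "(\<lambda>N. L * rr N) \<longlonglongrightarrow> L * 0" by (intro tendsto_intros rr)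
    then have "\<forall>\<^sub>F N in sequentially. L * rr N < e" using e by (intro order_tendstoD) auto
    then show "\<forall>\<^sub>F N in sequentially. \<forall>x\<in>U. dist (A is x (rr N)) (A0 is x) < e"
      by eventually_elim (use L(2)[OF _ rr0] in \<open>auto simp: dist_norm intro: le_less_trans\<close>)
  qed
  ultimately show ?thesis by (intro uniform_limit_theorem[where F=sequentially and f="\<lambda>N x. A is x (rr N)"]) auto
qed

text \<open>At radius 0 the torus shrinks to its centre, and the integral becomes the volume times a
  value.\<close>

lemma A0_Nil:
  assumes x: "x \<in> U"
  shows "A0 [] x = of_real V * F (cemb x)"
proof -
  have "continuous_on UNIV (\<lambda>r. I [] x r)"
    unfolding I_def torus_box_def
  proof (intro integral_continuous_on_param)
    show "continuous_on (UNIV \<times> cbox 0 (\<chi> i. 2 * pi)) (\<lambda>(r, \<theta>). F (pt x r \<theta>) * torus_char [] \<theta>)"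
      unfolding case_prod_unfold pt_def torus_char_Nil
      by (intro continuous_intros continuous_on_compose2[OF cF] continuous_on_compose2[OF torus_point_continuous]) auto
  qed
  then have "isCont (\<lambda>r. I [] x r) 0" by (simp add: continuous_on_eq_continuous_at)
  then have "(\<lambda>N. I [] x (inverse (real (Suc N)))) \<longlonglongrightarrow> I [] x 0"
    using isCont_tendsto_compose[OF _ LIMSEQ_inverse_real_of_nat] by blast
  moreover have "I [] x 0 = of_real V * F (cemb x)"
  proof -
    have "I [] x 0 = integral (cbox 0 (\<chi> i. 2 * pi)) (\<lambda>\<theta> :: real ^ 'n. F (cemb x))" by (simp add: I_def pt_def torus_box_def)
    also have "\<dots> = measure lborel (torus_box :: (real ^ 'n) set) *\<^sub>R F (cemb x)" unfolding torus_box_def by (rule integral_const)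
    finally show ?thesis by (simp add: torus_content V_def scaleR_conv_of_real)
  qed
  moreover have "(\<lambda>N. I [] x (inverse (real (Suc N)))) \<longlonglongrightarrow> A0 [] x"
    using A_tendsto[OF x, of "[]"] by (simp add: A_def)
  ultimately show ?thesis using LIMSEQ_unique by simp
qed

context
  fixes f :: "real ^ 'n \<Rightarrow> complex"
  assumes f: "\<And>x. x \<in> U \<Longrightarrow> f x = F (cemb x)"
begin

text \<open>Induction on the list for all points of \<open>U\<close> at once, so that the equality
  can be differentiated; the counts that each derivative produces multiply up to
  \<open>coeff_factor\<close>.\<close>

lemma partials_eq_and_derivative:
  assumes x: "x \<in> U"
  shows "partials is f x = coeff_factor is * A0 is x / of_real V"
    and "((\<lambda>t. partials is f (x + t *\<^sub>R axis j 1)) has_vector_derivative partials (j # is) f x) (at 0)"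
proof -
  have step: "((\<lambda>t. partials is f (x + t *\<^sub>R axis j 1)) has_vector_derivative coeff_factor (j # is) * A0 (j # is) x / of_real V) (at 0)"
    if x: "x \<in> U" and eq: "\<And>y. y \<in> U \<Longrightarrow> partials is f y = coeff_factor is * A0 is y / of_real V" for x j "is"
  proof -
    obtain a where a: "0 < a" "ball x a \<subseteq> U" using U x open_contains_ball by blast
    have xS: "x + t *\<^sub>R axis j 1 \<in> U" if "t \<in> {- a<..<a}" for t
    proof -
      have "x + t *\<^sub>R axis j 1 \<in> ball x a" using that by (simp add: dist_norm abs_less_iff)
      then show ?thesis using a by blast
    qed
    have "((\<lambda>t. coeff_factor is / of_real V * A0 is (x + t *\<^sub>R axis j 1)) has_vector_derivative
      coeff_factor is / of_real V * (of_nat (Suc (count_list is j)) * A0 (j # is) x)) (at 0)"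
      by (rule bounded_linear.has_vector_derivative[OF bounded_linear_mult_right A0_derivative[OF x]])
    then have "((\<lambda>t. coeff_factor is / of_real V * A0 is (x + t *\<^sub>R axis j 1)) has_vector_derivative
      coeff_factor (j # is) * A0 (j # is) x / of_real V) (at 0)" by (simp add: mult_ac)
    then show ?thesis
      by (rule has_vector_derivative_transform_within_open[of _ _ _ "{- a<..<a}"]) (use a eq[OF xS] in auto)
  qed
  have eq: "partials is f x = coeff_factor is * A0 is x / of_real V" if "x \<in> U" for x "is"
    using that
  proof (induction "is" arbitrary: x)
    case Nil
    then show ?case using f A0_Nil V0 by simp
  next
    case (Cons j "is")
    then show ?case using vector_derivative_at[OF step[OF Cons.prems Cons.IH, of j]] by (simp add: partial_def)
  qed
  show "partials is f x = coeff_factor is * A0 is x / of_real V" by (rule eq[OF x])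
  show "((\<lambda>t. partials is f (x + t *\<^sub>R axis j 1)) has_vector_derivative partials (j # is) f x) (at 0)"
    using step[OF x eq] eq[OF x, of "j # is"] by simp
qed

lemma smooth_on_restriction: "smooth_on U f"
  unfolding smooth_on_def
proof (intro allI conjI ballI)
  fix "is"
  have "continuous_on U (\<lambda>x. coeff_factor is * A0 is x / of_real V)"
    by (intro continuous_intros A0_continuous) (use V0 in auto)
  then show "continuous_on U (partials is f)"
    by (rule continuous_on_eq) (simp add: partials_eq_and_derivative(1))
qed (rule partials_eq_and_derivative(2))

text \<open>At radius 1 the normalization disappears, so the average is bounded independently of the
  order; the difference from the limit carries the factor \<open>\<rho> ^ length is\<close>.\<close>

lemma partials_restriction_bound:
  assumes BF: "\<And>z. norm (F z) \<le> BF" and \<rho>: "0 < \<rho>"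
  shows "\<exists>C\<ge>0. \<forall>x\<in>U. \<forall>is. norm (partials is f x) \<le> fact (length is) * (BF + C * (m (length is) * \<rho> ^ length is))"
proof -
  obtain C where C0: "0 \<le> C" and C: "\<And>x r \<theta> j k. x \<in> U \<Longrightarrow> 0 < r \<Longrightarrow> norm (Db j (pt x r \<theta>)) \<le> C * m k * (\<rho> * r) ^ k"
    using flat[OF \<rho>] by auto
  have "norm (partials is f x) \<le> fact (length is) * (BF + (2 * real CARD('n) * C) * (m (length is) * \<rho> ^ length is))" if x: "x \<in> U" for x "is"
  proof -
    have "norm (I is x 1) \<le> BF * V"
      unfolding I_def V_def
    proof (rule torus_integral_bound)
      show "norm (F (pt x 1 \<theta>) * torus_char is \<theta>) \<le> BF" for \<theta> using BF by (simp add: norm_mult)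
    qed (intro continuous_intros cont_D_pt)
    then have "norm (A is x 1) \<le> BF * V" by (simp add: A_def)
    moreover have "norm (A is x 1 - A0 is x) \<le> 2 * real CARD('n) * V * C * m (length is) * \<rho> ^ length is * 1"
      by (rule A_limit(2)[OF C C0 \<rho> x]) auto
    ultimately have "norm (A0 is x) \<le> BF * V + 2 * real CARD('n) * V * C * m (length is) * \<rho> ^ length is"
      using norm_triangle_sub[of "A0 is x" "A is x 1"] by (simp add: norm_minus_commute)
    also have "\<dots> = V * (BF + (2 * real CARD('n) * C) * (m (length is) * \<rho> ^ length is))" by (simp add: algebra_simps)
    finally have le: "norm (A0 is x) / V \<le> BF + (2 * real CARD('n) * C) * (m (length is) * \<rho> ^ length is)"
      using V0 by (simp add: pos_divide_le_eq mult.commute)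
    have "norm (partials is f x) = norm (coeff_factor is) * (norm (A0 is x) / V)"
      using V0 by (simp add: partials_eq_and_derivative(1)[OF x] norm_mult norm_divide)
    also have "\<dots> \<le> fact (length is) * (BF + (2 * real CARD('n) * C) * (m (length is) * \<rho> ^ length is))"
      using V0 by (intro mult_mono coeff_factor_le le) auto
    finally show ?thesis .
  qed
  then show ?thesis using C0 by (intro exI[of _ "2 * real CARD('n) * C"]) auto
qed

end

end

section \<open>Restriction of an extension to the real points\<close>

lemma real_linear_wirtinger:
  fixes L :: "complex ^ 'n \<Rightarrow> complex"
  assumes "linear L"
  shows "L v = (\<Sum>j\<in>UNIV. v $ j * ((L (axis j 1) - \<i> * L (axis j \<i>)) / 2) + cnj (v $ j) * ((L (axis j 1) + \<i> * L (axis j \<i>)) / 2))"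
proof -
  have "v = (\<Sum>j\<in>UNIV. Re (v $ j) *\<^sub>R axis j 1 + Im (v $ j) *\<^sub>R axis j \<i>)"
  proof (rule vec_eq_iff[THEN iffD2], rule allI)
    fix i
    have "(\<Sum>j\<in>UNIV. Re (v $ j) *\<^sub>R axis j 1 + Im (v $ j) *\<^sub>R axis j \<i>) $ i
      = (\<Sum>j\<in>UNIV. if j = i then of_real (Re (v $ i)) + of_real (Im (v $ i)) * \<i> else 0)"
      unfolding sum_component by (rule sum.cong) (auto simp: axis_def scaleR_conv_of_real[where 'a=complex])
    also have "\<dots> = v $ i" by (simp add: complex_eq_iff)
    finally show "v $ i = (\<Sum>j\<in>UNIV. Re (v $ j) *\<^sub>R axis j 1 + Im (v $ j) *\<^sub>R axis j \<i>) $ i" by simp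
  qed
  then have "L v = L (\<Sum>j\<in>UNIV. Re (v $ j) *\<^sub>R axis j 1 + Im (v $ j) *\<^sub>R axis j \<i>)" by simp
  also have "\<dots> = (\<Sum>j\<in>UNIV. of_real (Re (v $ j)) * L (axis j 1) + of_real (Im (v $ j)) * L (axis j \<i>))"
    by (simp add: linear_sum[OF assms] linear_add[OF assms] linear_scale[OF assms] scaleR_conv_of_real[where 'a=complex])
  also have "\<dots> = (\<Sum>j\<in>UNIV. v $ j * ((L (axis j 1) - \<i> * L (axis j \<i>)) / 2) + cnj (v $ j) * ((L (axis j 1) + \<i> * L (axis j \<i>)) / 2))"
  proof (rule sum.cong[OF refl])
    fix j
    have v: "of_real (Re (v $ j)) + \<i> * of_real (Im (v $ j)) = v $ j" "of_real (Re (v $ j)) - \<i> * of_real (Im (v $ j)) = cnj (v $ j)"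
      by (simp_all add: complex_eq_iff)
    have "of_real a * p + of_real b * q = (of_real a + \<i> * of_real b) * ((p - \<i> * q) / 2) + (of_real a - \<i> * of_real b) * ((p + \<i> * q) / 2)"
      for a b and p q :: complex
      by (simp add: complex_eq_iff field_simps)
    from this[of "Re (v $ j)" "L (axis j 1)" "Im (v $ j)" "L (axis j \<i>)", unfolded v]
    show "of_real (Re (v $ j)) * L (axis j 1) + of_real (Im (v $ j)) * L (axis j \<i>)
      = v $ j * ((L (axis j 1) - \<i> * L (axis j \<i>)) / 2) + cnj (v $ j) * ((L (axis j 1) + \<i> * L (axis j \<i>)) / 2)" .
  qed
  finally show ?thesis .
qed

text \<open>Over a finite index type every multi-index is the count function of a multiset, so the
  choice inside \<open>dalpha\<close> has a solution.\<close>

lemma dalpha_as_partials: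
  obtains "is" :: "'n::finite list" where "length is = mi_abs \<alpha>" "dalpha \<alpha> f = partials is f"
proof -
  obtain xs where "mset xs = Abs_multiset \<alpha>" using ex_mset by blast
  then have ex: "\<exists>is. \<forall>i. count (mset is) i = \<alpha> i" by (intro exI[of _ xs]) simp
  define ys where "ys = (SOME is. \<forall>i. count (mset is) i = \<alpha> i)"
  have "\<forall>i. count (mset ys) i = \<alpha> i" unfolding ys_def by (rule someI_ex[OF ex])
  then have "count (mset ys) = \<alpha>" by (intro ext) blast
  then have "length ys = mi_abs \<alpha>" using mi_abs_count[of ys] by simp
  then show ?thesis by (rule that) (simp add: dalpha_def ys_def)
qed

lemma beurling_if_extension:
  fixes M :: "nat \<Rightarrow> real" and U :: "(real ^ 'n::finite) set" and f :: "real ^ 'n \<Rightarrow> complex"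
  assumes M: "weight_sequence M"
    and lim: "filterlim (\<lambda>k. root k (small_m M k)) at_top sequentially"
    and U: "open U"
    and F: "C1c F" "\<And>x. x \<in> U \<Longrightarrow> F (cemb x) = f x"
    and dbar: "\<And>\<rho>. 0 < \<rho> \<Longrightarrow> \<exists>C\<ge>1. \<forall>z. norm (dbar F z) \<le> C * h_fun (small_m M) (\<rho> * infdist z (cemb ` closure U))"
  shows "f \<in> beurling_class M U"
proof -
  have mpos: "0 < small_m M k" for k by (rule small_m_pos[OF M])
  obtain F' where F': "\<And>z. (F has_derivative F' z) (at z)" "\<And>v. continuous_on UNIV (\<lambda>z. F' z v)"
    and cpt: "compact (closure {z. F z \<noteq> 0})" using F(1) unfolding C1c_def by blast
  define D where "D j z = (F' z (axis j 1) - \<i> * F' z (axis j \<i>)) / 2" for j z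
  define Db where "Db j z = (F' z (axis j 1) + \<i> * F' z (axis j \<i>)) / 2" for j z
  have Db: "Db j z = dbar F z $ j" for j z
    unfolding Db_def dbar_def dbar_j_def using frechet_derivative_at[OF F'(1)[of z]] by simp
  interpret wirtinger_derivatives F D Db
  proof
    fix z
    have "F' z = (\<lambda>v. \<Sum>j\<in>UNIV. v $ j * D j z + cnj (v $ j) * Db j z)"
      unfolding D_def Db_def by (rule ext) (rule real_linear_wirtinger[OF has_derivative_linear[OF F'(1)]])
    then show "(F has_derivative (\<lambda>v. \<Sum>j\<in>UNIV. v $ j * D j z + cnj (v $ j) * Db j z)) (at z)"
      using F'(1)[of z] by simp
  qed (auto simp: D_def[abs_def] Db_def[abs_def] intro!: continuous_intros F'(2))
  have flat: "\<exists>C\<ge>0. \<forall>x\<in>U. \<forall>r>0. \<forall>\<theta> j k. norm (Db j (pt x r \<theta>)) \<le> C * small_m M k * (\<rho> * r) ^ k" if \<rho>: "0 < \<rho>" for \<rho>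
  proof -
    define n where "n = real CARD('n)"
    have n: "1 \<le> n" by (simp add: n_def Suc_leI)
    \<comment> \<open>Norms of torus points are estimated by \<open>n\<close>, so on the torus of
      radius \<open>r\<close> the distance is at most \<open>r * n\<close>; the smaller parameter
      compensates for this.\<close>
    have "0 < \<rho> / n" using \<rho> n by simp
    then obtain C where C: "1 \<le> C" "\<And>z. norm (dbar F z) \<le> C * h_fun (small_m M) (\<rho> / n * infdist z (cemb ` closure U))"
      using dbar by blast
    have "norm (Db j (pt x r \<theta>)) \<le> C * small_m M k * (\<rho> * r) ^ k" if x: "x \<in> U" and r: "0 < r" for x r \<theta> j k
    proof -
      let ?z = "pt x r \<theta>"
      define d where "d = infdist ?z (cemb ` closure U)"
      have d0: "0 \<le> d" by (simp add: d_def infdist_nonneg)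
      have "d \<le> dist ?z (cemb x)" unfolding d_def by (rule infdist_le) (use x closure_subset in blast)
      also have "\<dots> = r * norm (torus_point \<theta>)" using r by (simp add: pt_def dist_norm)
      also have "\<dots> \<le> r * n" using r norm_torus_point_le[of \<theta>] by (simp add: n_def)
      finally have "\<rho> / n * d \<le> \<rho> / n * (r * n)" using \<rho> n by (intro mult_left_mono) auto
      then have dr: "\<rho> / n * d \<le> \<rho> * r" using n by simp
      have "h_fun (small_m M) (\<rho> / n * d) \<le> small_m M k * (\<rho> * r) ^ k"
      proof (cases "d = 0")
        case True
        then show ?thesis using mpos[of k] \<rho> r by (simp add: h_fun_def less_imp_le)
      next
        case False
        then have pos: "0 < \<rho> / n * d" using \<rho> n d0 by simp
        have "h_fun (small_m M) (\<rho> / n * d) \<le> small_m M k * (\<rho> / n * d) ^ k" by (rule h_fun_le[OF mpos pos])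
        also have "\<dots> \<le> small_m M k * (\<rho> * r) ^ k" using dr pos mpos[of k] by (intro mult_left_mono power_mono) auto
        finally show ?thesis .
      qed
      then have "C * h_fun (small_m M) (\<rho> / n * d) \<le> C * (small_m M k * (\<rho> * r) ^ k)" using C(1) by (intro mult_left_mono) auto
      moreover have "norm (Db j ?z) \<le> norm (dbar F ?z)" unfolding Db by (rule Finite_Cartesian_Product.norm_nth_le)
      ultimately show ?thesis using C(2)[of ?z] by (simp add: d_def mult.assoc)
    qed
    then show ?thesis using C(1) by (intro exI[of _ C]) auto
  qed
  interpret flat_extension F D Db U "small_m M"
    by unfold_locales (fact U mpos flat)+
  have fF: "f x = F (cemb x)" if "x \<in> U" for x using F(2)[OF that] by simp
  obtain BF where BF: "\<And>z. norm (F z) \<le> BF"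
  proof -
    have "bounded (F ` closure {z. F z \<noteq> 0})"
      using compact_continuous_image[OF continuous_on_subset[OF cF] cpt] compact_imp_bounded by blast
    then have "bounded (insert 0 (F ` closure {z. F z \<noteq> 0}))" by simp
    then obtain B where B: "\<And>w. w \<in> insert 0 (F ` closure {z. F z \<noteq> 0}) \<Longrightarrow> norm w \<le> B" unfolding bounded_iff by blast
    have "norm (F z) \<le> B" for z
      by (rule B) (use closure_subset[of "{z. F z \<noteq> 0}"] in auto)
    then show ?thesis using that by blast
  qed
  have "\<exists>C. \<forall>x\<in>U. \<forall>\<alpha>. norm (dalpha \<alpha> f x) / (\<rho> ^ mi_abs \<alpha> * M (mi_abs \<alpha>)) \<le> C" if \<rho>: "0 < \<rho>" for \<rho>
  proof -
    obtain C where C: "0 \<le> C" "\<And>x is. x \<in> U \<Longrightarrow> norm (partials is f x) \<le> fact (length is) * (BF + C * (small_m M (length is) * \<rho> ^ length is))"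
      using partials_restriction_bound[OF fF BF \<rho>] by blast
    \<comment> \<open>All terms \<open>small_m M k * \<rho> ^ k\<close> are at least
      \<open>h\<close>, so the constant \<open>BF\<close> is absorbed into them at the cost of the
      factor \<open>1 / h\<close>.\<close>
    define h where "h = h_fun (small_m M) \<rho>"
    have h: "0 < h" unfolding h_def by (rule h_fun_pos[OF mpos lim \<rho>])
    have BF0: "0 \<le> BF" using order_trans[OF norm_ge_zero BF] .
    have "norm (dalpha \<alpha> f x) / (\<rho> ^ mi_abs \<alpha> * M (mi_abs \<alpha>)) \<le> BF / h + C" if x: "x \<in> U" for x \<alpha>
    proof -
      obtain "is" where "is": "length is = mi_abs \<alpha>" "dalpha \<alpha> f = partials is f" by (rule dalpha_as_partials)
      define k where "k = mi_abs \<alpha>"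
      have hk: "h \<le> small_m M k * \<rho> ^ k" unfolding h_def by (rule h_fun_le[OF mpos \<rho>])
      have pos: "0 < \<rho> ^ k * M k" using \<rho> weight_sequence_pos[OF M] by simp
      have "norm (dalpha \<alpha> f x) \<le> fact k * (BF + C * (small_m M k * \<rho> ^ k))" using C(2)[OF x, of "is"] "is" by (simp add: k_def)
      also have "\<dots> \<le> fact k * (BF / h * (small_m M k * \<rho> ^ k) + C * (small_m M k * \<rho> ^ k))"
      proof (intro mult_left_mono add_right_mono)
        have "BF / h * h \<le> BF / h * (small_m M k * \<rho> ^ k)" using hk BF0 h by (intro mult_left_mono) auto
        then show "BF \<le> BF / h * (small_m M k * \<rho> ^ k)" using h by simp
      qed simp
      also have "\<dots> = (BF / h + C) * (\<rho> ^ k * M k)" by (simp add: small_m_def algebra_simps)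
      finally show ?thesis using pos by (simp add: pos_divide_le_eq k_def)
    qed
    then show ?thesis by blast
  qed
  then show ?thesis using smooth_on_restriction[OF fF] by (simp add: beurling_class_def)
qed

theorem theorem3p13:
  fixes M :: "nat \<Rightarrow> real" and U :: "(real ^ 'n) set" and f :: "real ^ 'n \<Rightarrow> complex"
  assumes "weight_sequence M"
    and "strongly_log_convex M"
    and "filterlim (\<lambda>k. root k (small_m M k)) at_top sequentially"
    and "\<exists>B. \<forall>k. root (Suc k) (M (Suc k) / M k) \<le> B"
    and "D_domain U"
  shows "f \<in> beurling_class M U \<longleftrightarrow>
    (\<exists>F. C1c F \<and> (\<forall>x\<in>U. F (cemb x) = f x) \<and>
      (\<forall>\<rho>>0. \<exists>C\<ge>1. \<forall>z. norm (dbar F z) \<le> C * h_fun (small_m M) (\<rho> * infdist z (cemb ` closure U))))"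
proof
  assume "f \<in> beurling_class M U"
  then show "\<exists>F. C1c F \<and> (\<forall>x\<in>U. F (cemb x) = f x) \<and>
      (\<forall>\<rho>>0. \<exists>C\<ge>1. \<forall>z. norm (dbar F z) \<le> C * h_fun (small_m M) (\<rho> * infdist z (cemb ` closure U)))"
    by (rule extension_if_beurling[OF assms])
next
  assume "\<exists>F. C1c F \<and> (\<forall>x\<in>U. F (cemb x) = f x) \<and>
      (\<forall>\<rho>>0. \<exists>C\<ge>1. \<forall>z. norm (dbar F z) \<le> C * h_fun (small_m M) (\<rho> * infdist z (cemb ` closure U)))"
  moreover have "open U" using assms(5) by (simp add: D_domain_def)
  ultimately show "f \<in> beurling_class M U"
    using beurling_if_extension[OF assms(1,3)] by blast
qed

end
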